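(* Let $(X,T)$ be a minimal tree shift, and let $\boldsymbol{\sigma}=(\sigma_n)_{n\ge0}$ be the sequence of (proper) coding morphisms of a return word $S$-adic representation of $(X,T)$. Then the natural Bratteli-Vershik system $(X_B,\varphi_\omega)$ associated with $\boldsymbol{\sigma}$ is properly ordered and is topologically conjugate to $(X,T)$. Its topological rank is at most the size of the alphabet of $X$.
   Context: Shifts. $T$ is the left shift; a shift $(X,T)$ is a closed shift-invariant $X\subseteq\mathcal{A}^{\mathbb{Z}}$, $\mathcal{A}$ a finite alphabet; it is minimal if $\emptyset$ and $X$ are its only closed shift-invariant subsets. $\mathcal{L}_X$ is the set of finite subwords of points of $X$. For $w\in\mathcal{L}_X$ the extension graph $G(w)$ is the undirected bipartite graph whose vertex set is the disjoint union of $\{a\in\mathcal{A}: aw\in\mathcal{L}_X\}$ and $\{b\in\mathcal{A}: wb\in\mathcal{L}_X\}$, with an edge $(a,b)$ whenever $awb\in\mathcal{L}_X$. The minimal shift $X$ is a tree shift if $G(w)$ is a tree for every $w\in\mathcal{L}_X$ (including the empty word). Morphisms $\mathcal{A}\to\mathcal{B}^+$ send letters to non-empty words and are extended by concatenation to words and two-sided sequences. Return word $S$-adic representation. For a minimal shift $X$ and $w\in\mathcal{L}_X$, a return word to $w$ is a non-empty word $v$ such that $vw\in\mathcal{L}_X$, $vw$ has $w$ as a prefix, and $vw$ contains exactly two occurrences of $w$; the set $\mathcal{R}_X(w)$ of return words to $w$ is finite. A coding morphism for a finite set of words $R$ is a morphism $\tau$ mapping a finite alphabet $\mathcal{B}$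 bijectively onto $R$. Let $\Gamma_X(w)=\{v\in\mathcal{L}_X: vw\in\mathcal{L}_X\cap w\mathcal{A}^+\}$; for a coding morphism $\tau$ of $\mathcal{R}_X(w)$, the derived shift of $X$ with respect to $w$ and $\tau$ is the (minimal) shift with language $\tau^{-1}(\Gamma_X(w))\cup\{\varepsilon\}$, $\varepsilon$ the empty word. Start with $X^{(0)}=X$ and a point $x^{(0)}\in X$. Given $X^{(n)}$ and $x^{(n)}\in X^{(n)}$, let $\tau_n$ be a coding morphism for $\mathcal{R}_{X^{(n)}}(x^{(n)}_{-1}x^{(n)}_0)$, let $X^{(n+1)}$ be the derived shift of $X^{(n)}$ with respect to $x^{(n)}_{-1}x^{(n)}_0$ and $\tau_n$, and let $x^{(n+1)}\in X^{(n+1)}$ be the point with $T^{-1}(x^{(n)})=\tau_n(x^{(n+1)})$. The associated proper coding morphism $\sigma_n$ is defined on the same alphabet as $\tau_n$ by $x^{(n)}_{-1}\,\sigma_n(b)=\tau_n(b)\,x^{(n)}_{-1}$ for every letter $b$, i.e., $\sigma_n$ codes the set $(x^{(n)}_{-1})^{-1}\mathcal{R}_{X^{(n)}}(x^{(n)}_{-1}x^{(n)}_0)\,x^{(n)}_{-1}$. Each $\sigma_n(b)$ begins with $x_0^{(n)}$ and ends with $x_{-1}^{(n)}$. Write $\sigma_n:\mathcal{A}_{n+1}\to\mathcal{A}_n^+$, where $\mathcal{A}_n$ is the alphabet of $X^{(n)}$. Natural Bratteli-Vershik system. The ordered Bratteli diagram $(B,\omega)$ of $\boldsymbol{\sigma}$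 has vertex sets $V_0=\{v_0\}$ and, for $n\ge1$, $V_n$ a copy of $\mathcal{A}_{n-1}$; $E_0$ has exactly one edge from $v_0$ to each vertex of $V_1$; for $n\ge1$, $a\in\mathcal{A}_n$ and $1\le j\le|\sigma_{n-1}(a)|$ there is exactly one edge in $E_n$ with range $a\in V_{n+1}$ labelled $j-1$, whose source is the $j$-th letter of $\sigma_{n-1}(a)$. Edges with common range are ordered by label. $X_B$ is the space of infinite paths from $v_0$, with the topology generated by cylinder sets. A path is maximal (minimal) if all its edges are maximal (minimal) among edges with the same range. $(B,\omega)$ is properly ordered if there is exactly one infinite maximal path and exactly one infinite minimal path. The Vershik map $\varphi_\omega$ sends a non-maximal path $x$, with $n$ smallest such that $x_n$ is not maximal, to the path $y$ with $y_i=x_i$ for $i>n$, $y_n$ the successor of $x_n$, and $(y_0,\dots,y_{n-1})$ the minimal path from $v_0$ to the source of $y_n$; in the properly ordered case the maximal path is sent to the minimal path and $\varphi_\omega$ is a homeomorphism of $X_B$. Rank. The rank of a Bratteli diagram with vertex sets $(V_n)$ is the minimum $k$ such that $|V_n|=k$ for infinitely many $n$. The topological rank of a system is the minimal $k$ such that it is topologically conjugate to a topological Bratteli-Vershik system (one whose Vershik map is a homeomorphism) on a Bratteli diagram of rank $k$. *)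

theory Defs
  imports "HOL-Analysis.Analysis" "HOL-Library.Sublist" "HOL-Library.Extended_Nat"
begin

section \<open>Two-sided shifts and their languages\<close>

definition shift_map :: "(int \<Rightarrow> 'a) \<Rightarrow> int \<Rightarrow> 'a" where
  "shift_map x = (\<lambda>i. x (i + 1))"

definition full_shift :: "'a set \<Rightarrow> (int \<Rightarrow> 'a) topology" where
  "full_shift A = product_topology (\<lambda>_. discrete_topology A) UNIV"

definition shift_space :: "'a set \<Rightarrow> (int \<Rightarrow> 'a) set \<Rightarrow> bool" where
  "shift_space A X \<longleftrightarrow> finite A \<and> closedin (full_shift A) X \<and> shift_map ` X = X"

definition minimal_shift :: "'a set \<Rightarrow> (int \<Rightarrow> 'a) set \<Rightarrow> bool" where
  "minimal_shift A X \<longleftrightarrow> shift_space A X \<and>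
     (\<forall>Y. Y \<subseteq> X \<and> closedin (full_shift A) Y \<and> shift_map ` Y = Y \<longrightarrow> Y = {} \<or> Y = X)"

text \<open>The letters that actually occur in \<open>X\<close>; the ambient finite set in
  \<^const>\<open>shift_space\<close> may be larger.\<close>

definition alphabet :: "(int \<Rightarrow> 'a) set \<Rightarrow> 'a set" where
  "alphabet X = (\<Union>x\<in>X. range x)"

definition subword :: "(int \<Rightarrow> 'a) \<Rightarrow> int \<Rightarrow> nat \<Rightarrow> 'a list" where
  "subword x i n = map (\<lambda>k. x (i + int k)) [0..<n]"

definition language :: "(int \<Rightarrow> 'a) set \<Rightarrow> 'a list set" where
  "language X = {subword x i n | x i n. x \<in> X}"


section \<open>Extension graphs and tree shifts\<close>

text \<open>An undirected simple graph is a vertex set with a set of two-element sets of vertices.\<close>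

definition cycle_in :: "'v set set \<Rightarrow> 'v list \<Rightarrow> bool" where
  "cycle_in E c \<longleftrightarrow> length c \<ge> 3 \<and> distinct c \<and>
     (\<forall>i. Suc i < length c \<longrightarrow> {c ! i, c ! Suc i} \<in> E) \<and> {last c, hd c} \<in> E"

definition is_tree :: "'v set \<Rightarrow> 'v set set \<Rightarrow> bool" where
  "is_tree V E \<longleftrightarrow> V \<noteq> {} \<and> (\<forall>u\<in>V. \<forall>v\<in>V. (u, v) \<in> {(p, q). {p, q} \<in> E}\<^sup>*) \<and>
     (\<nexists>c. cycle_in E c)"

definition ext_verts :: "(int \<Rightarrow> 'a) set \<Rightarrow> 'a list \<Rightarrow> ('a + 'a) set" where
  "ext_verts X w = Inl ` {a. a # w \<in> language X} \<union> Inr ` {b. w @ [b] \<in> language X}"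

definition ext_edges :: "(int \<Rightarrow> 'a) set \<Rightarrow> 'a list \<Rightarrow> ('a + 'a) set set" where
  "ext_edges X w = {{Inl a, Inr b} | a b. a # w @ [b] \<in> language X}"

definition minimal_tree_shift :: "'a set \<Rightarrow> (int \<Rightarrow> 'a) set \<Rightarrow> bool" where
  "minimal_tree_shift A X \<longleftrightarrow> minimal_shift A X \<and>
     (\<forall>w\<in>language X. is_tree (ext_verts X w) (ext_edges X w))"


section \<open>Return words, derived shifts, return word S-adic representations\<close>

definition occurrences :: "'a list \<Rightarrow> 'a list \<Rightarrow> nat set" where
  "occurrences w u = {i. i + length w \<le> length u \<and> take (length w) (drop i u) = w}"

definition return_words :: "(int \<Rightarrow> 'a) set \<Rightarrow> 'a list \<Rightarrow> 'a list set" where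
  "return_words X w =
     {v. v \<noteq> [] \<and> v @ w \<in> language X \<and> prefix w (v @ w) \<and> card (occurrences w (v @ w)) = 2}"

definition Gamma_words :: "(int \<Rightarrow> 'a) set \<Rightarrow> 'a list \<Rightarrow> 'a list set" where
  "Gamma_words X w = {v \<in> language X. v @ w \<in> language X \<and> (\<exists>u. u \<noteq> [] \<and> v @ w = w @ u)}"

text \<open>A morphism is given by its values on letters; only its values on the domain alphabet matter.\<close>

definition morph_word :: "('b \<Rightarrow> 'a list) \<Rightarrow> 'b list \<Rightarrow> 'a list" where
  "morph_word \<tau> u = concat (map \<tau> u)"

text \<open>The two-sided concatenation, with the image of the letter at \<open>0\<close> starting at position \<open>0\<close>.
  For \<open>\<tau>\<close> with non-empty values, the coordinate \<open>n \<ge> 0\<close> lies in the image of the letters at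
  \<open>0, \<dots>, n\<close>, and the coordinate \<open>- m < 0\<close> in the image of those at \<open>- m, \<dots>, - 1\<close>, at
  distance \<open>m\<close> from the right end.\<close>

definition morph_seq :: "('b \<Rightarrow> 'a list) \<Rightarrow> (int \<Rightarrow> 'b) \<Rightarrow> int \<Rightarrow> 'a" where
  "morph_seq \<tau> x n =
     (if n \<ge> 0 then morph_word \<tau> (subword x 0 (nat n + 1)) ! nat n
      else let u = morph_word \<tau> (subword x n (nat (- n))) in u ! (length u - nat (- n)))"

definition coding_morphism :: "'b set \<Rightarrow> ('b \<Rightarrow> 'a list) \<Rightarrow> 'a list set \<Rightarrow> bool" where
  "coding_morphism B \<tau> R \<longleftrightarrow> finite B \<and> (\<forall>b\<in>B. \<tau> b \<noteq> []) \<and> bij_betw \<tau> B R"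

text \<open>A shift is determined by its language, so this determines \<open>Y\<close>.\<close>

definition is_derived_shift ::
  "(int \<Rightarrow> 'a) set \<Rightarrow> 'a list \<Rightarrow> 'b set \<Rightarrow> ('b \<Rightarrow> 'a list) \<Rightarrow> (int \<Rightarrow> 'b) set \<Rightarrow> bool" where
  "is_derived_shift X w B \<tau> Y \<longleftrightarrow> shift_space B Y \<and>
     language Y = {u \<in> lists B. morph_word \<tau> u \<in> Gamma_words X w} \<union> {[]}"

text \<open>\<open>\<sigma>\<close> is the sequence of proper coding morphisms, \<open>\<sigma> n\<close> being defined on \<open>Al (Suc n)\<close> with values
  in words over \<open>Al n\<close>.\<close>

definition return_word_rep ::
  "(int \<Rightarrow> 'a) set \<Rightarrow> (nat \<Rightarrow> 'a set) \<Rightarrow> (nat \<Rightarrow> 'a \<Rightarrow> 'a list) \<Rightarrow> bool" where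
  "return_word_rep X Al \<sigma> \<longleftrightarrow>
     (\<exists>(Xs :: nat \<Rightarrow> (int \<Rightarrow> 'a) set) (xs :: nat \<Rightarrow> int \<Rightarrow> 'a) (\<tau> :: nat \<Rightarrow> 'a \<Rightarrow> 'a list).
        Xs 0 = X \<and> Al 0 = alphabet X \<and>
        (\<forall>n. xs n \<in> Xs n \<and>
             coding_morphism (Al (Suc n)) (\<tau> n) (return_words (Xs n) [xs n (- 1), xs n 0]) \<and>
             is_derived_shift (Xs n) [xs n (- 1), xs n 0] (Al (Suc n)) (\<tau> n) (Xs (Suc n)) \<and>
             inv shift_map (xs n) = morph_seq (\<tau> n) (xs (Suc n)) \<and>
             (\<forall>b\<in>Al (Suc n). xs n (- 1) # \<sigma> n b = \<tau> n b @ [xs n (- 1)])))"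


section \<open>Ordered Bratteli diagrams and Vershik maps\<close>

text \<open>The edges at level \<open>n\<close> go from the vertices at level \<open>n\<close> to those at level \<open>Suc n\<close>.\<close>

record ('v, 'e) ordered_diagram =
  dverts :: "nat \<Rightarrow> 'v set"
  dedges :: "nat \<Rightarrow> 'e set"
  dsrc :: "nat \<Rightarrow> 'e \<Rightarrow> 'v"
  drng :: "nat \<Rightarrow> 'e \<Rightarrow> 'v"
  dord :: "nat \<Rightarrow> ('e \<times> 'e) set"

definition ordered_bratteli :: "('v, 'e) ordered_diagram \<Rightarrow> bool" where
  "ordered_bratteli D \<longleftrightarrow>
     (\<exists>v0. dverts D 0 = {v0}) \<and>
     (\<forall>n. finite (dverts D n) \<and> dverts D n \<noteq> {} \<and> finite (dedges D n) \<and>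
          (\<forall>e\<in>dedges D n. dsrc D n e \<in> dverts D n \<and> drng D n e \<in> dverts D (Suc n)) \<and>
          (\<forall>v\<in>dverts D n. \<exists>e\<in>dedges D n. dsrc D n e = v) \<and>
          (\<forall>v\<in>dverts D (Suc n). \<exists>e\<in>dedges D n. drng D n e = v) \<and>
          dord D n \<subseteq> {(e, e'). e \<in> dedges D n \<and> e' \<in> dedges D n \<and> drng D n e = drng D n e'} \<and>
          (\<forall>v\<in>dverts D (Suc n).
             linear_order_on {e \<in> dedges D n. drng D n e = v}
               (Restr (dord D n) {e \<in> dedges D n. drng D n e = v})))"

definition inf_paths :: "('v, 'e) ordered_diagram \<Rightarrow> (nat \<Rightarrow> 'e) set" where
  "inf_paths D = {x. \<forall>n. x n \<in> dedges D n \<and> drng D n (x n) = dsrc D (Suc n) (x (Suc n))}"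

definition cylinder :: "('v, 'e) ordered_diagram \<Rightarrow> (nat \<Rightarrow> 'e) \<Rightarrow> nat \<Rightarrow> (nat \<Rightarrow> 'e) set" where
  "cylinder D x n = {y \<in> inf_paths D. \<forall>i<n. y i = x i}"

definition path_topology :: "('v, 'e) ordered_diagram \<Rightarrow> (nat \<Rightarrow> 'e) topology" where
  "path_topology D = topology_generated_by {cylinder D x n | x n. x \<in> inf_paths D}"

definition max_edge :: "('v, 'e) ordered_diagram \<Rightarrow> nat \<Rightarrow> 'e \<Rightarrow> bool" where
  "max_edge D n e \<longleftrightarrow> e \<in> dedges D n \<and>
     (\<forall>e'\<in>dedges D n. drng D n e' = drng D n e \<longrightarrow> (e', e) \<in> dord D n)"

definition min_edge :: "('v, 'e) ordered_diagram \<Rightarrow> nat \<Rightarrow> 'e \<Rightarrow> bool" where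
  "min_edge D n e \<longleftrightarrow> e \<in> dedges D n \<and>
     (\<forall>e'\<in>dedges D n. drng D n e' = drng D n e \<longrightarrow> (e, e') \<in> dord D n)"

definition max_path :: "('v, 'e) ordered_diagram \<Rightarrow> (nat \<Rightarrow> 'e) \<Rightarrow> bool" where
  "max_path D x \<longleftrightarrow> x \<in> inf_paths D \<and> (\<forall>n. max_edge D n (x n))"

definition min_path :: "('v, 'e) ordered_diagram \<Rightarrow> (nat \<Rightarrow> 'e) \<Rightarrow> bool" where
  "min_path D x \<longleftrightarrow> x \<in> inf_paths D \<and> (\<forall>n. min_edge D n (x n))"

definition properly_ordered :: "('v, 'e) ordered_diagram \<Rightarrow> bool" where
  "properly_ordered D \<longleftrightarrow> ordered_bratteli D \<and> (\<exists>!x. max_path D x) \<and> (\<exists>!x. min_path D x)"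

definition edge_succ :: "('v, 'e) ordered_diagram \<Rightarrow> nat \<Rightarrow> 'e \<Rightarrow> 'e \<Rightarrow> bool" where
  "edge_succ D n e e' \<longleftrightarrow> e \<noteq> e' \<and> (e, e') \<in> dord D n \<and>
     (\<forall>f. f \<noteq> e \<and> (e, f) \<in> dord D n \<longrightarrow> (e', f) \<in> dord D n)"

text \<open>The Vershik rule on non-maximal paths. Since \<open>y\<close> is an infinite path, its edges before level
  \<open>n\<close> form a path from the top vertex to the source of \<open>y n\<close>.\<close>

definition path_succ :: "('v, 'e) ordered_diagram \<Rightarrow> (nat \<Rightarrow> 'e) \<Rightarrow> nat \<Rightarrow> 'e" where
  "path_succ D x = (let n = (LEAST n. \<not> max_edge D n (x n)) in
     THE y. y \<in> inf_paths D \<and> (\<forall>i>n. y i = x i) \<and> edge_succ D n (x n) (y n) \<and>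
            (\<forall>i<n. min_edge D i (y i)))"

text \<open>The Vershik map of a properly ordered diagram.\<close>

definition vershik :: "('v, 'e) ordered_diagram \<Rightarrow> (nat \<Rightarrow> 'e) \<Rightarrow> nat \<Rightarrow> 'e" where
  "vershik D x = (if max_path D x then THE y. min_path D y else path_succ D x)"

text \<open>For a diagram with several maximal or minimal paths the rule on non-maximal paths leaves the
  images of the maximal paths open: a topological Bratteli-Vershik system is given by a
  homeomorphism \<open>\<phi>\<close> extending that rule and sending maximal paths to minimal ones. For a properly
  ordered diagram this forces \<open>\<phi>\<close> to agree with \<^const>\<open>vershik\<close> on all infinite paths.\<close>

definition topological_BV :: "('v, 'e) ordered_diagram \<Rightarrow> ((nat \<Rightarrow> 'e) \<Rightarrow> nat \<Rightarrow> 'e) \<Rightarrow> bool" where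
  "topological_BV D \<phi> \<longleftrightarrow> ordered_bratteli D \<and>
     (\<forall>x\<in>inf_paths D. if max_path D x then min_path D (\<phi> x) else \<phi> x = path_succ D x) \<and>
     homeomorphic_map (path_topology D) (path_topology D) \<phi>"


section \<open>Conjugacy and topological rank\<close>

definition top_conjugate :: "'x topology \<Rightarrow> ('x \<Rightarrow> 'x) \<Rightarrow> 'y topology \<Rightarrow> ('y \<Rightarrow> 'y) \<Rightarrow> bool" where
  "top_conjugate S f S' g \<longleftrightarrow>
     (\<exists>h. homeomorphic_map S S' h \<and> (\<forall>x\<in>topspace S. h (f x) = g (h x)))"

definition bratteli_rank :: "('v, 'e) ordered_diagram \<Rightarrow> enat" where
  "bratteli_rank D = Inf {enat k | k. \<exists>\<^sub>\<infinity>n. card (dverts D n) = k}"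

text \<open>The vertex and edge sets at each level are finite, so diagrams with vertices and edges in
  \<^typ>\<open>nat\<close> represent all diagrams up to isomorphism. The value is \<open>\<infinity>\<close> if no diagram of finite
  rank exists.\<close>

definition topological_rank :: "'x topology \<Rightarrow> ('x \<Rightarrow> 'x) \<Rightarrow> enat" where
  "topological_rank S f = Inf {enat k | k.
     \<exists>(D :: (nat, nat) ordered_diagram) \<phi>.
       topological_BV D \<phi> \<and> bratteli_rank D = enat k \<and> top_conjugate S f (path_topology D) \<phi>}"


section \<open>The natural diagram of a sequence of morphisms\<close>

text \<open>The top vertex is \<^const>\<open>None\<close>. The edge \<open>(a, j)\<close> has range \<open>Some a\<close> and label \<open>j\<close>
  (labels start at \<open>0\<close>); at level \<open>0\<close> only the label \<open>0\<close> occurs.\<close>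

definition natural_diagram ::
  "(nat \<Rightarrow> 'a set) \<Rightarrow> (nat \<Rightarrow> 'a \<Rightarrow> 'a list) \<Rightarrow> ('a option, 'a \<times> nat) ordered_diagram" where
  "natural_diagram Al \<sigma> =
     (let E = (\<lambda>n. case n of 0 \<Rightarrow> Al 0 \<times> {0}
                         | Suc m \<Rightarrow> {(a, j). a \<in> Al (Suc m) \<and> j < length (\<sigma> m a)}) in
      \<lparr> dverts = (\<lambda>n. case n of 0 \<Rightarrow> {None} | Suc m \<Rightarrow> Some ` Al m),
        dedges = E,
        dsrc = (\<lambda>n (a, j). case n of 0 \<Rightarrow> None | Suc m \<Rightarrow> Some (\<sigma> m a ! j)),
        drng = (\<lambda>n (a, j). Some a),
        dord = (\<lambda>n. {((a, i), (b, j)). (a, i) \<in> E n \<and> (b, j) \<in> E n \<and> a = b \<and> i \<le> j}) \<rparr>)"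

end

theory Submission
  imports Defs
begin

text \<open>
  Cutting each point of \<open>X\<close> at the occurrences of a two-letter word \<open>l r\<close> (between \<open>l\<close> and \<open>r\<close>)
  desubstitutes it uniquely and continuously by \<open>\<sigma>\<^sub>0\<close>. Iterating, a point is sent to the path that
  records its letter at \<open>0\<close> and the position of \<open>0\<close> inside the image of that letter at every level.
  Shifting the point moves the path by the Vershik rule. Since all \<open>\<sigma>\<^sub>n(b)\<close> begin with the same letter
  and end with the same letter, there is one minimal and one maximal path; hence the Vershik map is
  injective and so is the coding of points. It is onto because its image is compact and dense.

  For the rank, let \<open>\<rho>(u)\<close> be the number of right extensions of \<open>u\<close> minus one. Acyclicity of the
  extension graphs gives \<open>\<Sum>\<^sub>a \<rho>(a u) \<le> \<rho>(u)\<close>. The words in which \<open>w\<close> occurs only as a prefix form a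
  suffix code, so their \<open>\<rho>\<close> sums to at most \<open>\<rho>(\<epsilon>)\<close>; they are also the inner nodes of the tree whose
  leaves are the complete return words to \<open>w\<close>, so \<open>w\<close> has at most \<open>\<rho>(\<epsilon>) + 1\<close> return words, the number
  of letters. This bound, unlike the tree property, passes to derived shifts at once: the return words
  to \<open>u\<close> in the derived shift embed into the return words to \<open>\<tau>(u) w\<close>.
\<close>

section \<open>Subwords, shifts and the product topology\<close>

text \<open>Of the shift at level \<open>n + 1\<close> the representation prescribes the language.
  Minimality is therefore not carried along the levels; uniform recurrence of the language takes its
  place. It passes down through the equivalence of \<open>u \<in> language Y\<close> with
  \<open>\<tau>(u) w \<in> language X\<close>, and it supplies what desubstitution needs: cuts
  without bound in both directions, and every letter in every point. The tree hypothesis enters only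
  at level 0, but there for all non-empty \<open>w\<close>, because return words at level
  \<open>n\<close> turn into return words of \<open>X\<close> to long words. Desubstitution is
  defined on every point of a level, not only along the chosen base points. Once the coding is known
  to be bijective, the existence of successors of paths and the homeomorphism property of the
  Vershik map are read off from the shift instead of being built in the diagram. The definition of
  \<open>topological_rank\<close> admits diagrams over \<open>nat\<close>, hence the transport of
  the natural diagram along injections.\<close>

definition shift_by :: "int \<Rightarrow> (int \<Rightarrow> 'a) \<Rightarrow> int \<Rightarrow> 'a" where
  "shift_by j x = (\<lambda>i. x (i + j))"

lemma shift_by_apply [simp]: "shift_by j x i = x (i + j)"
  by (simp add: shift_by_def)

lemma shift_by_0 [simp]: "shift_by 0 x = x"
  by (simp add: shift_by_def)

lemma shift_by_shift_by [simp]: "shift_by i (shift_by j x) = shift_by (i + j) x"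
  by (auto simp: shift_by_def algebra_simps)

lemma shift_map_eq_shift_by: "shift_map = shift_by 1"
  by (auto simp: shift_map_def shift_by_def)

lemma length_subword [simp]: "length (subword x i n) = n"
  by (simp add: subword_def)

lemma nth_subword [simp]: "k < n \<Longrightarrow> subword x i n ! k = x (i + int k)"
  by (simp add: subword_def)

lemma subword_0 [simp]: "subword x i 0 = []"
  by (simp add: subword_def)

lemma subword_append: "subword x i (m + n) = subword x i m @ subword x (i + int m) n"
  by (rule nth_equalityI) (auto simp: nth_append algebra_simps)

lemma subword_shift_by [simp]: "subword (shift_by j x) i n = subword x (i + j) n"
  by (rule nth_equalityI) (auto simp: algebra_simps)

lemma subword_Suc: "subword x i (Suc n) = x i # subword x (i + 1) n"
  using subword_append[of x i 1 n] by (simp add: subword_def)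

lemma subword_Suc_last: "subword x i (Suc n) = subword x i n @ [x (i + int n)]"
  using subword_append[of x i n 1] by (simp add: subword_def)

lemma subword_cong:
  "(\<And>k. k < n \<Longrightarrow> x (i + int k) = y (j + int k)) \<Longrightarrow> subword x i n = subword y j n"
  by (rule nth_equalityI) auto

lemma subword_eqD: "subword x i n = subword y j n \<Longrightarrow> k < n \<Longrightarrow> x (i + int k) = y (j + int k)"
  by (metis nth_subword)

text \<open>Forward shifts use one inclusion of the invariance of \<open>X\<close>, backward shifts
  the other: a preimage of \<open>y\<close> in \<open>X\<close> can only be
  \<open>shift_by (- 1) y\<close>.\<close>

lemma shift_space_shift_by:
  assumes "shift_space A X" "x \<in> X"
  shows "shift_by j x \<in> X"
proof -
  have X: "shift_by 1 ` X = X"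
    using assms(1) by (simp add: shift_space_def shift_map_eq_shift_by)
  have inv: "shift_by (- 1) y \<in> X" if "y \<in> X" for y
  proof -
    from that X obtain z where "z \<in> X" "y = shift_by 1 z" by blast
    then show ?thesis by simp
  qed
  have pos: "shift_by (int n) x \<in> X" for n
  proof (induction n)
    case (Suc n)
    have "shift_by 1 (shift_by (int n) x) \<in> X" using Suc X by blast
    then show ?case by (simp del: shift_by_apply add: algebra_simps)
  qed (use assms in simp)
  have neg: "shift_by (- int n) x \<in> X" for n
  proof (induction n)
    case (Suc n)
    then show ?case using inv[OF Suc] by (simp del: shift_by_apply add: algebra_simps)
  qed (use assms in simp)
  show ?thesis
    using pos[of "nat j"] neg[of "nat (- j)"] by (cases "j \<ge> 0") auto
qed

lemma subword_in_language: "x \<in> X \<Longrightarrow> subword x i n \<in> language X"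
  by (auto simp: language_def)

lemma languageE:
  assumes "u \<in> language X"
  obtains x i where "x \<in> X" "u = subword x i (length u)"
  using assms by (auto simp: language_def)

lemma language_factor:
  assumes "u @ v @ z \<in> language X"
  shows "v \<in> language X"
proof -
  obtain x i where x: "x \<in> X" "u @ v @ z = subword x i (length (u @ v @ z))"
    using assms by (rule languageE)
  have "u @ v @ z = subword x i (length u) @ subword x (i + int (length u)) (length v)
      @ subword x (i + int (length u) + int (length v)) (length z)"
    using x(2) by (simp add: subword_append)
  then have "v = subword x (i + int (length u)) (length v)"
    by (metis append_eq_append_conv length_subword)
  then show ?thesis using subword_in_language[OF x(1)] by metis
qed

lemma language_prefix: "u @ v \<in> language X \<Longrightarrow> u \<in> language X"
  using language_factor[of "[]" u v X] by simp

lemma language_suffix: "u @ v \<in> language X \<Longrightarrow> v \<in> language X"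
  using language_factor[of u v "[]" X] by simp

lemma language_extend_right:
  assumes "u \<in> language X"
  obtains b where "u @ [b] \<in> language X"
proof -
  obtain x i where x: "x \<in> X" "u = subword x i (length u)"
    using assms by (rule languageE)
  have "subword x i (Suc (length u)) \<in> language X" using x by (simp add: subword_in_language)
  then show ?thesis using that x(2) by (metis subword_Suc_last)
qed

lemma singleton_in_language_iff: "[a] \<in> language X \<longleftrightarrow> a \<in> alphabet X"
proof
  assume "[a] \<in> language X"
  then obtain x i where "x \<in> X" "[a] = subword x i (length [a])" by (rule languageE)
  then show "a \<in> alphabet X" by (auto simp: alphabet_def subword_def)
next
  assume "a \<in> alphabet X"
  then obtain x i where "x \<in> X" "a = x i" by (auto simp: alphabet_def)
  then show "[a] \<in> language X"
    using subword_in_language[of x X i 1] by (simp add: subword_def)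
qed

lemma language_subset_lists: "language X \<subseteq> lists (alphabet X)"
  by (force simp: language_def subword_def alphabet_def)

section \<open>The product topology described by central windows\<close>

lemma topspace_full_shift: "topspace (full_shift A) = {x. range x \<subseteq> A}"
  by (auto simp: full_shift_def PiE_def Pi_def)

lemma shift_space_range: "shift_space A X \<Longrightarrow> x \<in> X \<Longrightarrow> x i \<in> A"
  using closedin_subset[of "full_shift A" X]
  by (auto simp: shift_space_def topspace_full_shift)

lemma shift_space_subset_topspace: "shift_space A X \<Longrightarrow> x \<in> X \<Longrightarrow> x \<in> topspace (full_shift A)"
  using shift_space_range by (auto simp: topspace_full_shift)

lemma alphabet_subset: "shift_space A X \<Longrightarrow> alphabet X \<subseteq> A"
  by (auto simp: alphabet_def shift_space_range)

text \<open>Windows centred at 0 form a neighbourhood base of the product topology. The radius is an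
  integer, so a negative \<open>m\<close> imposes no condition, not even at the coordinate
  0.\<close>

definition agree :: "int \<Rightarrow> (int \<Rightarrow> 'a) \<Rightarrow> (int \<Rightarrow> 'a) \<Rightarrow> bool" where
  "agree m x y \<longleftrightarrow> (\<forall>i. \<bar>i\<bar> \<le> m \<longrightarrow> x i = y i)"

lemma openin_full_shift_iff:
  "openin (full_shift A) S \<longleftrightarrow> S \<subseteq> topspace (full_shift A) \<and>
     (\<forall>x\<in>S. \<exists>m. \<forall>y\<in>topspace (full_shift A). agree m x y \<longrightarrow> y \<in> S)" (is "?L \<longleftrightarrow> ?R")
proof
  assume L: ?L
  show ?R
  proof (intro conjI ballI)
    show "S \<subseteq> topspace (full_shift A)" using L by (rule openin_subset)
    fix x assume "x \<in> S"
    then obtain U where U: "finite {i. U i \<noteq> A}" "x \<in> PiE UNIV U" "PiE UNIV U \<subseteq> S"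
      using L unfolding full_shift_def openin_product_topology_alt by (auto 0 3)
    \<comment> \<open>\<open>m\<close> bounds the finitely many constrained coordinates; the
      inserted 0 keeps the set under \<open>Max\<close> non-empty.\<close>
    define m where "m = Max (insert 0 (abs ` {i. U i \<noteq> A}))"
    have m: "\<bar>i\<bar> \<le> m" if "U i \<noteq> A" for i
      unfolding m_def using U(1) that by (intro Max_ge) auto
    show "\<exists>m. \<forall>y\<in>topspace (full_shift A). agree m x y \<longrightarrow> y \<in> S"
    proof (intro exI[of _ m] ballI impI)
      fix y assume y: "y \<in> topspace (full_shift A)" "agree m x y"
      have "y i \<in> U i" for i
      proof (cases "U i = A")
        case True then show ?thesis using y by (auto simp: topspace_full_shift)
      next
        case False
        then have "y i = x i" using m y(2) by (auto simp: agree_def)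
        then show ?thesis using U(2) by auto
      qed
      then show "y \<in> S" using U(3) by (auto simp: PiE_def)
    qed
  qed
next
  assume R: ?R
  show ?L
    unfolding full_shift_def openin_product_topology_alt
  proof (intro ballI)
    fix x assume x: "x \<in> S"
    then obtain m where m: "\<And>y. y \<in> topspace (full_shift A) \<Longrightarrow> agree m x y \<Longrightarrow> y \<in> S"
      using R by blast
    have xA: "range x \<subseteq> A" using x R by (auto simp: topspace_full_shift)
    define U where "U = (\<lambda>i. if \<bar>i\<bar> \<le> m then {x i} else A)"
    have fin: "finite {i. U i \<noteq> A}"
      by (rule finite_subset[of _ "{-m..m}"]) (auto simp: U_def split: if_splits)
    have sub: "PiE UNIV U \<subseteq> S"
    proof
      fix y assume y: "y \<in> PiE UNIV U"
      then have yU: "y i \<in> U i" for i by auto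
      show "y \<in> S"
      proof (rule m)
        show "y \<in> topspace (full_shift A)"
          using yU xA by (fastforce simp: topspace_full_shift U_def split: if_splits)
        show "agree m x y" using yU by (fastforce simp: agree_def U_def split: if_splits)
      qed
    qed
    have "x \<in> PiE UNIV U" using xA by (auto simp: U_def)
    moreover have "\<forall>i. U i \<subseteq> A" using xA by (auto simp: U_def)
    ultimately show "\<exists>U. finite {i \<in> UNIV. U i \<noteq> topspace (discrete_topology A)} \<and>
      (\<forall>i\<in>UNIV. openin (discrete_topology A) (U i)) \<and> x \<in> PiE UNIV U \<and> PiE UNIV U \<subseteq> S"
      using fin sub by (intro exI[of _ U]) auto
  qed
qed

text \<open>A point outside the closed set \<open>X\<close> is separated from it by a window. The
  word seen there occurs in some point of \<open>X\<close>, and shifting that point moves the word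
  into the window.\<close>

lemma shift_space_memI:
  assumes "shift_space A X" "\<And>i n. subword x i n \<in> language X"
  shows "x \<in> X"
proof (rule ccontr)
  assume "x \<notin> X"
  have "x i \<in> A" for i
    using assms(2)[of i 1] alphabet_subset[OF assms(1)]
    by (auto simp: subword_def singleton_in_language_iff)
  with \<open>x \<notin> X\<close> have "x \<in> topspace (full_shift A) - X" by (auto simp: topspace_full_shift)
  moreover have "openin (full_shift A) (topspace (full_shift A) - X)"
    using assms(1) by (auto simp: shift_space_def)
  ultimately obtain m
    where m: "\<And>y. y \<in> topspace (full_shift A) \<Longrightarrow> agree m x y \<Longrightarrow> y \<notin> X"
    unfolding openin_full_shift_iff by blast
  \<comment> \<open>A window of radius \<open>m\<close> has 2m + 1 coordinates; for negative
    \<open>m\<close> the length is 0 and agreement is vacuous.\<close>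
  define n where "n = nat (2 * m + 1)"
  obtain z i where z: "z \<in> X" "subword x (- m) n = subword z i n"
    using assms(2)[of "- m" n] by (metis languageE length_subword)
  let ?z = "shift_by (i + m) z"
  have "?z \<in> X" by (rule shift_space_shift_by[OF assms(1) z(1)])
  moreover have "agree m x ?z"
    unfolding agree_def
  proof (intro allI impI)
    fix k assume "\<bar>k\<bar> \<le> m"
    then have "nat (k + m) < n" "int (nat (k + m)) = k + m" by (auto simp: n_def)
    then show "x k = ?z k"
      using subword_eqD[OF z(2), of "nat (k + m)"] by (simp add: algebra_simps)
  qed
  moreover have "?z \<in> topspace (full_shift A)"
    by (rule shift_space_subset_topspace[OF assms(1) \<open>?z \<in> X\<close>])
  ultimately show False using m by blast
qed

section \<open>Uniform recurrence of minimal shifts\<close>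

text \<open>Uniform recurrence, phrased for the language alone so that it can be transferred to a
  derived shift through words.\<close>

definition recurrent_language :: "(int \<Rightarrow> 'a) set \<Rightarrow> bool" where
  "recurrent_language X \<longleftrightarrow>
     (\<forall>u\<in>language X. \<exists>N. \<forall>v\<in>language X. N \<le> length v \<longrightarrow> sublist u v)"

lemma compact_full_shift: "finite A \<Longrightarrow> compact_space (full_shift A)"
  by (auto simp: full_shift_def compact_space_product_topology compact_space_discrete_topology)

text \<open>If arbitrarily long words avoid \<open>u\<close>, compactness produces a point avoiding
  \<open>u\<close> everywhere. Such points form a closed invariant set that is neither empty nor all
  of \<open>X\<close>.\<close>

lemma minimal_shift_recurrent:
  assumes "minimal_shift A X"
  shows "recurrent_language X"
  unfolding recurrent_language_def
proof (rule ballI, rule ccontr)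
  fix u assume u: "u \<in> language X"
    and "\<nexists>N. \<forall>v\<in>language X. N \<le> length v \<longrightarrow> sublist u v"
  then have long: "\<exists>v\<in>language X. N \<le> length v \<and> \<not> sublist u v" for N by blast
  have ss: "shift_space A X" using assms by (simp add: minimal_shift_def)
  let ?top = "full_shift A"
  have Xtop: "x \<in> topspace ?top" if "x \<in> X" for x
    using ss that by (rule shift_space_subset_topspace)
  define len where "len = length u"
  define F where "F = (\<lambda>n. {x \<in> X. \<forall>i. \<bar>i\<bar> \<le> int n \<longrightarrow> subword x i len \<noteq> u})"
  have closed: "closedin ?top (F n)" for n
  proof -
    have "openin ?top (topspace ?top - {x \<in> topspace ?top. \<forall>i. \<bar>i\<bar> \<le> int n \<longrightarrow> subword x i len \<noteq> u})"
      unfolding openin_full_shift_iff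
    proof (intro conjI ballI)
      fix x assume "x \<in> topspace ?top - {x \<in> topspace ?top. \<forall>i. \<bar>i\<bar> \<le> int n \<longrightarrow> subword x i len \<noteq> u}"
      then obtain i where i: "\<bar>i\<bar> \<le> int n" "subword x i len = u" by auto
      have "subword y i len = u" if "agree (\<bar>i\<bar> + int len) x y" for y
        unfolding i(2)[symmetric] by (rule subword_cong) (use that in \<open>auto simp: agree_def\<close>)
      then show "\<exists>m. \<forall>y\<in>topspace ?top. agree m x y \<longrightarrow>
          y \<in> topspace ?top - {x \<in> topspace ?top. \<forall>i. \<bar>i\<bar> \<le> int n \<longrightarrow> subword x i len \<noteq> u}"
        using i(1) by blast
    qed auto
    then have "closedin ?top {x \<in> topspace ?top. \<forall>i. \<bar>i\<bar> \<le> int n \<longrightarrow> subword x i len \<noteq> u}"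
      by (auto simp: closedin_def)
    moreover have "closedin ?top X" using ss by (simp add: shift_space_def)
    ultimately have "closedin ?top
        (X \<inter> {x \<in> topspace ?top. \<forall>i. \<bar>i\<bar> \<le> int n \<longrightarrow> subword x i len \<noteq> u})"
      by (rule closedin_Int[rotated])
    also have "X \<inter> {x \<in> topspace ?top. \<forall>i. \<bar>i\<bar> \<le> int n \<longrightarrow> subword x i len \<noteq> u} = F n"
      using Xtop by (auto simp: F_def)
    finally show ?thesis .
  qed
  have nonempty: "F n \<noteq> {}" for n
  proof -
    obtain v where v: "v \<in> language X" "2 * n + 1 + len \<le> length v" "\<not> sublist u v"
      using long by blast
    obtain x i where x: "x \<in> X" "v = subword x i (length v)" using v(1) by (rule languageE)
    let ?x = "shift_by (i + int n) x"
    have "subword ?x j len \<noteq> u" if "\<bar>j\<bar> \<le> int n" for j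
    proof
      assume eq: "subword ?x j len = u"
      define k where "k = nat (j + int n)"
      have "length v = k + (len + (length v - k - len))" using v(2) that by (auto simp: k_def)
      then have "v = subword x i (k + (len + (length v - k - len)))" using x(2) by metis
      also have "\<dots> = subword x i k @ subword x (i + int k) len @
          subword x (i + int k + int len) (length v - k - len)"
        unfolding subword_append by simp
      also have "subword x (i + int k) len = u"
      proof -
        have "int k = j + int n" using that by (simp add: k_def)
        then show ?thesis using eq by (simp add: algebra_simps)
      qed
      finally show False using v(3) by (metis sublist_appendI)
    qed
    then have "?x \<in> F n" using shift_space_shift_by[OF ss x(1)] by (auto simp: F_def)
    then show ?thesis by blast
  qed
  have "decseq F" by (rule decseq_SucI) (unfold F_def, force)
  then have "(\<Inter>n. F n) \<noteq> {}"
    using compact_full_shift[of A] ss closed nonempty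
    by (intro compact_space_imp_nest[of ?top]) (auto simp: shift_space_def)
  moreover define Y where "Y = (\<Inter>n. F n)"
  ultimately have "Y \<noteq> {}" by simp
  have Y: "Y = {x \<in> X. \<forall>i. subword x i len \<noteq> u}"
  proof (intro equalityI subsetI)
    fix x assume x: "x \<in> Y"
    have "subword x i len \<noteq> u" for i
      using x unfolding Y_def F_def by (auto dest!: spec[of _ "nat \<bar>i\<bar>"])
    then show "x \<in> {x \<in> X. \<forall>i. subword x i len \<noteq> u}" using x by (auto simp: Y_def F_def)
  qed (auto simp: Y_def F_def)
  have "shift_by j x \<in> Y" if "x \<in> Y" for x j
    using that shift_space_shift_by[OF ss] by (auto simp: Y)
  then have "shift_map ` Y = Y"
    unfolding shift_map_eq_shift_by
    by (auto simp: image_iff) (metis shift_by_shift_by shift_by_0 add.right_inverse)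
  moreover have "closedin ?top Y" unfolding Y_def using closed by (intro closedin_INT) auto
  moreover have "Y \<subseteq> X" by (auto simp: Y)
  ultimately have "Y = X" using assms \<open>Y \<noteq> {}\<close> unfolding minimal_shift_def by blast
  moreover obtain x i where "x \<in> X" "u = subword x i len" using u unfolding len_def by (rule languageE)
  ultimately show False by (auto simp: Y)
qed

section \<open>Return words in tree shifts\<close>

lemma occurrences_iff: "i \<in> occurrences w u \<longleftrightarrow> (\<exists>p s. u = p @ w @ s \<and> length p = i)"
proof
  assume i: "i \<in> occurrences w u"
  have "u = take i u @ take (length w) (drop i u) @ drop (length w) (drop i u)"
    by (metis append_take_drop_id)
  also have "take (length w) (drop i u) = w" using i by (simp add: occurrences_def)
  finally show "\<exists>p s. u = p @ w @ s \<and> length p = i"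
    using i by (intro exI[of _ "take i u"] exI) (auto simp: occurrences_def)
qed (auto simp: occurrences_def)

lemma occurrencesI: "u = p @ w @ s \<Longrightarrow> i = length p \<Longrightarrow> i \<in> occurrences w u"
  using occurrences_iff by blast

lemma occurrences_le: "i \<in> occurrences w u \<Longrightarrow> i + length w \<le> length u"
  by (simp add: occurrences_def)

lemma occurrences_append: "occurrences w u \<subseteq> occurrences w (u @ z)"
  by (auto simp: occurrences_def)

lemma occurrences_append_iff:
  "i + length w \<le> length u \<Longrightarrow> i \<in> occurrences w (u @ z) \<longleftrightarrow> i \<in> occurrences w u"
  by (auto simp: occurrences_def)

lemma finite_occurrences: "finite (occurrences w u)"
  by (rule finite_subset[of _ "{..length u}"]) (auto simp: occurrences_def)

lemma occurrences_drop_iff: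
  "k \<le> i \<Longrightarrow> k \<le> length u \<Longrightarrow> i \<in> occurrences w u \<longleftrightarrow> i - k \<in> occurrences w (drop k u)"
  by (auto simp: occurrences_def)

text \<open>The two ends of \<open>v w\<close> carry distinct occurrences since \<open>v\<close> is
  non-empty, so a count of two leaves no others.\<close>

lemma return_words_occurrences:
  assumes "v \<in> return_words X w"
  shows "occurrences w (v @ w) = {0, length v}"
proof -
  have "0 \<in> occurrences w (v @ w)"
    using assms by (auto simp: return_words_def prefix_def intro: occurrencesI[of _ "[]"])
  moreover have "length v \<in> occurrences w (v @ w)" "v \<noteq> []"
    using assms by (auto simp: return_words_def intro: occurrencesI[of _ v _ "[]"])
  moreover have "card (occurrences w (v @ w)) = 2" using assms by (simp add: return_words_def)
  ultimately have "card {0, length v} = card (occurrences w (v @ w))" by simp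
  then show ?thesis
    using card_subset_eq[OF finite_occurrences, of "{0, length v}" w "v @ w"]
      \<open>0 \<in> _\<close> \<open>length v \<in> _\<close> by auto
qed

lemma return_wordsI:
  assumes "v \<noteq> []" "v @ w \<in> language X" "occurrences w (v @ w) = {0, length v}"
  shows "v \<in> return_words X w"
proof -
  have "0 \<in> occurrences w (v @ w)" using assms(3) by simp
  then have "prefix w (v @ w)" by (auto simp: occurrences_iff prefix_def)
  then show ?thesis using assms by (auto simp: return_words_def)
qed

text \<open>A longest path cannot be prolonged at its first vertex, so a second neighbour of that
  vertex lies on the path and closes a cycle. The hypothesis \<open>deg\<close> expresses degree at
  least two: whichever single vertex \<open>u\<close> is excluded, a neighbour remains.\<close>

lemma cycle_if_min_degree_2:
  assumes "finite V" "V \<noteq> {}"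
    and loopless: "\<And>e. e \<in> E \<Longrightarrow> \<exists>u\<in>V. \<exists>v\<in>V. u \<noteq> v \<and> e = {u, v}"
    and deg: "\<And>v u. v \<in> V \<Longrightarrow> \<exists>u'. u' \<noteq> u \<and> {u', v} \<in> E"
  shows "\<exists>c. cycle_in E c"
proof -
  define P where "P c \<longleftrightarrow> c \<noteq> [] \<and> distinct c \<and> set c \<subseteq> V \<and>
    (\<forall>i. Suc i < length c \<longrightarrow> {c ! i, c ! Suc i} \<in> E)" for c
  have bound: "length c < Suc (card V)" if "P c" for c
    using that assms(1) by (metis P_def card_mono distinct_card less_Suc_eq_le)
  obtain v where "v \<in> V" using assms(2) by blast
  then have "P [v]" by (auto simp: P_def)
  then obtain c where c: "P c" and longest: "\<And>c'. P c' \<Longrightarrow> length c' \<le> length c"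
    using ex_has_greatest_nat[of P "[v]" length "Suc (card V)"] bound by (metis less_imp_le)
  obtain x cs where cs: "c = x # cs" using c by (cases c) (auto simp: P_def)
  have "x \<in> V" using c by (auto simp: P_def cs)
  \<comment> \<open>Excluding the successor on the path makes the cycle have length at least 3. For
    a one-vertex path the excluded value is a dummy, as loops are already ruled out.\<close>
  then obtain u' where u': "u' \<noteq> (if cs = [] then x else c ! 1)" "{u', x} \<in> E"
    using deg by blast
  have "u' \<in> V" "u' \<noteq> x" using loopless[OF u'(2)] by (auto simp: doubleton_eq_iff)
  have "u' \<in> set c"
  proof (rule ccontr)
    assume "u' \<notin> set c"
    then have "P (u' # c)"
      using c u' \<open>u' \<in> V\<close> by (auto simp: P_def cs nth_Cons split: nat.splits)
    then show False using longest by fastforce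
  qed
  then obtain k where k: "k < length c" "c ! k = u'" by (auto simp: in_set_conv_nth)
  have "k \<noteq> 0" using k \<open>u' \<noteq> x\<close> cs by (cases k) auto
  moreover have "k \<noteq> 1" using k u' cs by (cases "cs = []") auto
  ultimately have "k \<ge> 2" by linarith
  have "last (take (Suc k) c) = u'" using k by (simp add: take_Suc_conv_app_nth)
  moreover have "hd (take (Suc k) c) = x" by (simp add: cs)
  ultimately have "cycle_in E (take (Suc k) c)"
    unfolding cycle_in_def using k \<open>k \<ge> 2\<close> c u'(2) by (auto simp: P_def)
  then show ?thesis by blast
qed

text \<open>Acyclicity yields a vertex of degree at most one; deleting it removes one vertex and at
  most one edge.\<close>

lemma acyclic_card_edges:
  assumes "finite V" "V \<noteq> {}"
    and "\<And>e. e \<in> E \<Longrightarrow> \<exists>u\<in>V. \<exists>v\<in>V. u \<noteq> v \<and> e = {u, v}"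
    and "\<nexists>c. cycle_in E c"
  shows "card E < card V"
  using assms
proof (induction "card V" arbitrary: V E rule: less_induct)
  case less
  have "E \<subseteq> Pow V" using less.prems(3) by fastforce
  then have finE: "finite E" using less.prems(1) by (meson finite_Pow_iff finite_subset)
  \<comment> \<open>If \<open>v\<close> is isolated, \<open>u\<close> is a dummy and
    \<open>{u, v}\<close> need not be an edge; it is the sole candidate for an edge lost with
    \<open>v\<close>.\<close>
  obtain v u where v: "v \<in> V" "\<And>u'. {u', v} \<in> E \<Longrightarrow> u' = u"
    using cycle_if_min_degree_2[of V E] less.prems by blast
  define E' where "E' = {e \<in> E. v \<notin> e}"
  have E: "E \<subseteq> insert {u, v} E'"
  proof
    fix e assume e: "e \<in> E"
    show "e \<in> insert {u, v} E'"
    proof (cases "v \<in> e")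
      case True
      then obtain u' where "e = {u', v}" using less.prems(3)[OF e] by (auto simp: insert_commute)
      then show ?thesis using v e by auto
    qed (use e in \<open>simp add: E'_def\<close>)
  qed
  have finE': "finite E'" using finE by (simp add: E'_def)
  have le: "card E \<le> Suc (card E')"
    using card_mono[OF _ E] finE' by (simp add: card_insert_if split: if_splits)
  show ?case
  proof (cases "V = {v}")
    case True
    then have "E = {}" using less.prems(3) by fastforce
    then show ?thesis using True by simp
  next
    case False
    have edges: "\<exists>u\<in>V - {v}. \<exists>w\<in>V - {v}. u \<noteq> w \<and> e = {u, w}" if "e \<in> E'" for e
      using less.prems(3)[of e] that by (auto simp: E'_def)
    have acyc: "\<nexists>c. cycle_in E' c"
      using less.prems(4) by (auto simp: cycle_in_def E'_def)
    have "card E' < card (V - {v})"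
      using edges acyc False v(1) less.prems(1)
      by (intro less.hyps card_Diff1_less) auto
    then show ?thesis using le v(1) less.prems(1) by (simp add: card_Diff_singleton_if)
  qed
qed

text \<open>The function \<rho> of the overview, taken in the integers to avoid truncated
  subtraction; outside the language its value is -1.\<close>

definition right_excess :: "(int \<Rightarrow> 'a) set \<Rightarrow> 'a list \<Rightarrow> int" where
  "right_excess X u = int (card {b. u @ [b] \<in> language X}) - 1"

lemma finite_right_ext: "finite (alphabet X) \<Longrightarrow> finite {b. u @ [b] \<in> language X}"
  by (rule finite_subset[of _ "alphabet X"])
    (auto simp: singleton_in_language_iff dest: language_suffix)

lemma finite_left_ext: "finite (alphabet X) \<Longrightarrow> finite {a. a # u \<in> language X}"
  by (rule finite_subset[of _ "alphabet X"])
    (auto simp: singleton_in_language_iff[symmetric] dest: language_prefix[of "[_]" u, simplified])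

lemma right_excess_nonneg:
  assumes "finite (alphabet X)" "u \<in> language X"
  shows "right_excess X u \<ge> 0"
proof -
  obtain b where "u @ [b] \<in> language X" using assms(2) by (rule language_extend_right)
  then have "card {b. u @ [b] \<in> language X} > 0"
    using finite_right_ext[OF assms(1)] by (auto simp: card_gt_0_iff)
  then show ?thesis by (simp add: right_excess_def)
qed

text \<open>An acyclic extension graph has fewer edges than vertices; counted by left letters, this bounds
  the total right branching of the left extensions of \<open>u\<close> by that of \<open>u\<close>.\<close>

lemma sum_right_excess_left_ext:
  assumes fin: "finite (alphabet X)" and u: "u \<in> language X"
    and tree: "is_tree (ext_verts X u) (ext_edges X u)"
  shows "(\<Sum>a | a # u \<in> language X. right_excess X (a # u)) \<le> right_excess X u"
proof -
  let ?L = "{a. a # u \<in> language X}" and ?R = "{b. u @ [b] \<in> language X}"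
  let ?E = "SIGMA a:?L. {b. (a # u) @ [b] \<in> language X}"
  have finL: "finite ?L" and finR: "finite ?R"
    using finite_left_ext[OF fin] finite_right_ext[OF fin] by auto
  have V: "finite (ext_verts X u)" unfolding ext_verts_def using finL finR by auto
  have cardV: "card (ext_verts X u) = card ?L + card ?R"
    unfolding ext_verts_def using finL finR
    by (subst card_Un_disjoint) (auto simp: card_image)
  have edges: "ext_edges X u = (\<lambda>(a, b). {Inl a, Inr b}) ` ?E"
    using language_prefix[of "_ # u"] by (fastforce simp: ext_edges_def)
  have "inj_on (\<lambda>(a, b). {Inl a, Inr b}) ?E" by (auto simp: inj_on_def doubleton_eq_iff)
  then have "card (ext_edges X u) = card ?E" unfolding edges by (rule card_image)
  also have "\<dots> = (\<Sum>a\<in>?L. card {b. (a # u) @ [b] \<in> language X})"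
    using finL finite_right_ext[OF fin] by (intro card_SigmaI) blast+
  finally have E: "int (card (ext_edges X u)) =
      (\<Sum>a\<in>?L. right_excess X (a # u)) + int (card ?L)"
    by (simp add: right_excess_def sum_subtractf)
  have "card (ext_edges X u) < card (ext_verts X u)"
  proof (rule acyclic_card_edges)
    fix e assume "e \<in> ext_edges X u"
    then obtain a b where ab: "a # u @ [b] \<in> language X" "e = {Inl a, Inr b}"
      by (auto simp: ext_edges_def)
    moreover have "a # u \<in> language X" "u @ [b] \<in> language X"
      using ab(1) language_prefix[of "a # u" "[b]"] language_suffix[of "[a]" "u @ [b]"] by auto
    ultimately show "\<exists>v\<in>ext_verts X u. \<exists>v'\<in>ext_verts X u. v \<noteq> v' \<and> e = {v, v'}"
      by (auto simp: ext_verts_def)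
  qed (use V tree in \<open>auto simp: is_tree_def\<close>)
  then show ?thesis using E cardV by (simp add: right_excess_def)
qed

text \<open>Descend the tree of left extensions from \<open>v\<close>. At a member of
  \<open>U\<close> the code property leaves only \<open>v\<close> itself; elsewhere the words of
  \<open>U\<close> ending in \<open>v\<close> split according to the letter before that suffix, and
  the one-letter inequality applies.\<close>

lemma sum_right_excess_suffix_code:
  assumes fin: "finite (alphabet X)"
    and tree: "\<And>u. u \<in> language X \<Longrightarrow> is_tree (ext_verts X u) (ext_edges X u)"
    and U: "finite U" "U \<subseteq> language X"
    and code: "\<And>u v. u \<in> U \<Longrightarrow> v \<in> U \<Longrightarrow> suffix u v \<Longrightarrow> u = v"
    and bound: "\<And>u. u \<in> U \<Longrightarrow> length u \<le> M"
    and v: "v \<in> language X"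
  shows "sum (right_excess X) {u \<in> U. suffix v u} \<le> right_excess X v"
  using v
proof (induction "Suc M - length v" arbitrary: v rule: less_induct)
  case less
  show ?case
  proof (cases "v \<in> U")
    case True
    then have "{u \<in> U. suffix v u} = {v}" using code by auto
    then show ?thesis by simp
  next
    case False
    let ?L = "{a. a # v \<in> language X}"
    have eq: "{u \<in> U. suffix v u} = (\<Union>a\<in>?L. {u \<in> U. suffix (a # v) u})" (is "?A = ?B")
    proof
      show "?A \<subseteq> ?B"
      proof
        fix u assume "u \<in> ?A"
        then obtain p where u: "u \<in> U" "u = p @ v" by (auto simp: suffix_def)
        with False have "p \<noteq> []" by auto
        then obtain p' a where p: "p = p' @ [a]" by (metis rev_exhaust)
        have "a # v \<in> language X" using u U(2) p language_suffix[of p' "a # v"] by auto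
        then show "u \<in> ?B" using u p by (auto simp: suffix_def)
      qed
      show "?B \<subseteq> ?A" by (auto simp: suffix_def) 
    qed
    have "sum (right_excess X) {u \<in> U. suffix v u} =
        (\<Sum>a\<in>?L. sum (right_excess X) {u \<in> U. suffix (a # v) u})"
      unfolding eq using U(1) finite_left_ext[OF fin]
      by (intro sum.UNION_disjoint) (auto simp: suffix_def)
    also have "\<dots> \<le> (\<Sum>a\<in>?L. right_excess X (a # v))"
    proof (rule sum_mono)
      fix a assume a: "a \<in> ?L"
      show "sum (right_excess X) {u \<in> U. suffix (a # v) u} \<le> right_excess X (a # v)"
      \<comment> \<open>Beyond length \<open>M\<close> no word of \<open>U\<close> is left, and the
        empty sum is bounded by nonnegativity. The measure \<open>Suc M - length v\<close> still
        decreases when the length goes from \<open>M\<close> to \<open>M + 1\<close>.\<close>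
      proof (cases "length v \<le> M")
        case True
        then show ?thesis using a by (intro less.hyps) auto
      next
        case False
        then have "{u \<in> U. suffix (a # v) u} = {}" using bound suffix_length_le by fastforce
        then show ?thesis using right_excess_nonneg[OF fin, of "a # v"] a by (simp only: sum.empty) simp
      qed
    qed
    also have "\<dots> \<le> right_excess X v"
      by (rule sum_right_excess_left_ext[OF fin less.prems tree[OF less.prems]])
    finally show ?thesis .
  qed
qed

text \<open>The nodes and leaves of the tree of prefixes, starting at \<open>w\<close>, of complete return words.\<close>

definition return_nodes :: "(int \<Rightarrow> 'a) set \<Rightarrow> 'a list \<Rightarrow> 'a list set" where
  "return_nodes X w = {u \<in> language X. occurrences w u = {0}}"

definition return_leaves :: "(int \<Rightarrow> 'a) set \<Rightarrow> 'a list \<Rightarrow> 'a list set" where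
  "return_leaves X w =
     {u \<in> language X. \<exists>k>0. occurrences w u = {0, k} \<and> k + length w = length u}"

text \<open>A new letter can create only the occurrence that ends at it. Its position
  \<open>?k\<close> is positive because \<open>w\<close> already fits into \<open>v\<close>.\<close>

lemma return_nodes_extend:
  assumes "w \<noteq> []" "v \<in> return_nodes X w" "v @ [b] \<in> language X"
  shows "v @ [b] \<in> return_nodes X w \<union> return_leaves X w"
proof -
  let ?k = "Suc (length v) - length w"
  have v: "occurrences w v = {0}" using assms(2) by (simp add: return_nodes_def)
  then have len: "length w \<le> length v" using occurrences_le[of 0 w v] by simp
  have "occurrences w v \<subseteq> occurrences w (v @ [b])" by (rule occurrences_append)
  moreover have "i \<in> occurrences w v \<or> i = ?k" if "i \<in> occurrences w (v @ [b])" for i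
    using occurrences_le[OF that] occurrences_append_iff[of i w v "[b]"] that by fastforce
  ultimately have "occurrences w (v @ [b]) = {0} \<or> occurrences w (v @ [b]) = {0, ?k}"
    using v by blast
  then show ?thesis
  proof
    assume "occurrences w (v @ [b]) = {0, ?k}"
    then have "v @ [b] \<in> return_leaves X w"
      unfolding return_leaves_def using assms(3) len
      by (intro CollectI conjI exI[of _ ?k]) auto
    then show ?thesis by simp
  qed (use assms(3) in \<open>simp add: return_nodes_def\<close>)
qed

text \<open>A finite tree has one more leaf than the sum, over its inner nodes, of the number of
  children minus one. The recursion runs from a node to its one-letter extensions and stops at
  leaves.\<close>

lemma card_return_leaves_below:
  assumes fin: "finite (alphabet X)" and w: "w \<noteq> []"
    and nodes: "finite (return_nodes X w)"
    and bound: "\<And>u. u \<in> return_nodes X w \<union> return_leaves X w \<Longrightarrow> length u \<le> M"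
    and v: "v \<in> return_nodes X w \<union> return_leaves X w"
  shows "int (card {c \<in> return_leaves X w. prefix v c}) \<le>
    1 + sum (right_excess X) {u \<in> return_nodes X w. prefix v u}"
  using v
proof (induction "Suc M - length v" arbitrary: v rule: less_induct)
  case less
  let ?U = "return_nodes X w" and ?C = "return_leaves X w"
  have nonneg: "right_excess X u \<ge> 0" if "u \<in> ?U" for u
    using that right_excess_nonneg[OF fin] by (auto simp: return_nodes_def)
  show ?case
  proof (cases "v \<in> ?C")
    case True
    then obtain k where k: "k > 0" "occurrences w v = {0, k}" "k + length w = length v"
      by (auto simp: return_leaves_def)
    \<comment> \<open>Nothing lies strictly below a leaf: the second occurrence in \<open>c\<close>
      is the one in \<open>v\<close>, and it ends both words.\<close>
    have "c = v" if c: "c \<in> ?C" "prefix v c" for c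
    proof -
      obtain z where z: "c = v @ z" using c(2) by (auto simp: prefix_def)
      obtain k' where k': "occurrences w c = {0, k'}" "k' + length w = length c"
        using c(1) by (auto simp: return_leaves_def)
      have "k \<in> occurrences w c" using k(2) occurrences_append[of w v z] z by auto
      then have "k = k'" using k'(1) k(1) by auto
      then show ?thesis using k(3) k'(2) z by simp
    qed
    then have "{c \<in> ?C. prefix v c} \<subseteq> {v}" by auto
    then have "card {c \<in> ?C. prefix v c} \<le> 1"
      using card_mono[of "{v}"] by auto
    moreover have "sum (right_excess X) {u \<in> ?U. prefix v u} \<ge> 0"
      using nonneg by (intro sum_nonneg) auto
    ultimately show ?thesis by linarith
  next
    case False
    then have v: "v \<in> ?U" using less.prems by blast
    let ?R = "{b. v @ [b] \<in> language X}"
    have finR: "finite ?R" by (rule finite_right_ext[OF fin])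
    have ext: "\<exists>b\<in>?R. prefix (v @ [b]) c" if c: "c \<in> language X" "prefix v c" "c \<noteq> v" for c
    proof -
      obtain z where z: "c = v @ z" using c(2) by (auto simp: prefix_def)
      then obtain b z' where "z = b # z'" using c(3) by (cases z) auto
      then have "c = (v @ [b]) @ z'" using z by simp
      then show ?thesis using c(1) language_prefix[of "v @ [b]" z'] by (auto simp: prefix_def)
    qed
    have C: "{c \<in> ?C. prefix v c} = (\<Union>b\<in>?R. {c \<in> ?C. prefix (v @ [b]) c})"
    proof (intro equalityI subsetI)
      fix c assume c: "c \<in> {c \<in> ?C. prefix v c}"
      then have "c \<in> language X" "c \<noteq> v" using False by (auto simp: return_leaves_def)
      then show "c \<in> (\<Union>b\<in>?R. {c \<in> ?C. prefix (v @ [b]) c})" using c ext[of c] by blast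
    qed (auto dest: append_prefixD)
    have U: "{u \<in> ?U. prefix v u} = insert v (\<Union>b\<in>?R. {u \<in> ?U. prefix (v @ [b]) u})"
    proof (intro equalityI subsetI)
      fix c assume c: "c \<in> {c \<in> ?U. prefix v c}"
      then have "c \<in> language X" by (auto simp: return_nodes_def)
      then show "c \<in> insert v (\<Union>b\<in>?R. {c \<in> ?U. prefix (v @ [b]) c})" using c ext[of c] by blast
    qed (use v in \<open>auto dest: append_prefixD\<close>)
    have "int (card {c \<in> ?C. prefix v c}) \<le> int (\<Sum>b\<in>?R. card {c \<in> ?C. prefix (v @ [b]) c})"
      unfolding C of_nat_le_iff by (rule card_UN_le[OF finR])
    then have "int (card {c \<in> ?C. prefix v c}) \<le> (\<Sum>b\<in>?R. int (card {c \<in> ?C. prefix (v @ [b]) c}))"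
      by (simp only: of_nat_sum)
    also have "\<dots> \<le> (\<Sum>b\<in>?R. 1 + sum (right_excess X) {u \<in> ?U. prefix (v @ [b]) u})"
    proof (rule sum_mono)
      fix b assume "b \<in> ?R"
      then have "v @ [b] \<in> ?U \<union> ?C" using return_nodes_extend[OF w v] by auto
      moreover have "length v \<le> M" using bound v by blast
      ultimately show "int (card {c \<in> ?C. prefix (v @ [b]) c})
          \<le> 1 + sum (right_excess X) {u \<in> ?U. prefix (v @ [b]) u}"
        by (intro less.hyps) auto
    qed
    also have "\<dots> = int (card ?R) +
        (\<Sum>b\<in>?R. sum (right_excess X) {u \<in> ?U. prefix (v @ [b]) u})"
      by (simp add: sum.distrib)
    also have "(\<Sum>b\<in>?R. sum (right_excess X) {u \<in> ?U. prefix (v @ [b]) u}) =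
        sum (right_excess X) (\<Union>b\<in>?R. {u \<in> ?U. prefix (v @ [b]) u})"
      using finR nodes by (subst sum.UNION_disjoint) (auto simp: prefix_def)
    \<comment> \<open>The excess of \<open>v\<close> is the number of its children minus one, so
      adding 1 accounts for the ones contributed by the children.\<close>
    also have "int (card ?R) + \<dots> = 1 + sum (right_excess X) {u \<in> ?U. prefix v u}"
      unfolding U using finR nodes
      by (subst sum.insert) (auto simp: prefix_def right_excess_def)
    finally show ?thesis .
  qed
qed

lemma card_return_words_tree:
  assumes "minimal_tree_shift A X" "w \<in> language X" "w \<noteq> []"
  shows "finite (return_words X w)" "card (return_words X w) \<le> card (alphabet X)"
proof -
  have min: "minimal_shift A X"
    and tree: "\<And>u. u \<in> language X \<Longrightarrow> is_tree (ext_verts X u) (ext_edges X u)"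
    using assms(1) by (auto simp: minimal_tree_shift_def)
  have ss: "shift_space A X" using min by (simp add: minimal_shift_def)
  have fin: "finite (alphabet X)"
    using alphabet_subset[OF ss] ss finite_subset by (auto simp: shift_space_def)
  let ?U = "return_nodes X w" and ?C = "return_leaves X w"
  obtain N where N: "\<And>v. v \<in> language X \<Longrightarrow> N \<le> length v \<Longrightarrow> sublist w v"
    using minimal_shift_recurrent[OF min] assms(2) unfolding recurrent_language_def by blast
  \<comment> \<open>Without its first letter an overlong node would still contain \<open>w\<close>,
    and that occurrence has positive position in the node.\<close>
  have lenU: "length u \<le> N" if u: "u \<in> ?U" for u
  proof (rule ccontr)
    assume "\<not> length u \<le> N"
    then obtain a u' where u': "u = a # u'" "N \<le> length u'" by (cases u) auto
    have "u' \<in> language X" using u u' language_suffix[of "[a]" u'] by (auto simp: return_nodes_def)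
    then obtain p s where "u' = p @ w @ s" using N[OF _ u'(2)] by (auto simp: sublist_def)
    then have "Suc (length p) \<in> occurrences w u"
      using u' by (intro occurrencesI[of _ "a # p" _ s]) auto
    then show False using u by (auto simp: return_nodes_def)
  qed
  \<comment> \<open>Dropping the last letter destroys exactly the final occurrence, so every leaf is
    a child of a node and its length exceeds the bound for nodes by at most one.\<close>
  have butlast: "\<exists>u b. c = u @ [b] \<and> u \<in> ?U" if c: "c \<in> ?C" for c
  proof -
    obtain k where k: "k > 0" "occurrences w c = {0, k}" "k + length w = length c" "c \<in> language X"
      using c by (auto simp: return_leaves_def)
    then have "c \<noteq> []" by auto
    then obtain u b where c: "c = u @ [b]" by (metis rev_exhaust)
    have "u \<in> language X" using k(4) c by (auto intro: language_prefix)
    moreover have "occurrences w u = {0}"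
    proof -
      have "i + length w \<le> length u" if "i \<in> occurrences w u" for i using that by (rule occurrences_le)
      moreover have "occurrences w u \<subseteq> {0, k}" using occurrences_append[of w u "[b]"] k(2) c by simp
      moreover have "0 \<in> occurrences w u"
        using occurrences_append_iff[of 0 w u "[b]"] k c by auto
      moreover have "\<not> k + length w \<le> length u" using k(3) c by simp
      ultimately show ?thesis by blast
    qed
    ultimately show ?thesis using c by (auto simp: return_nodes_def)
  qed
  have bound: "length u \<le> Suc N" if "u \<in> ?U \<union> ?C" for u
    using that lenU butlast by fastforce
  have "?U \<union> ?C \<subseteq> {u. set u \<subseteq> alphabet X \<and> length u \<le> Suc N}"
  proof
    fix u assume u: "u \<in> ?U \<union> ?C"
    then have "u \<in> language X" by (auto simp: return_nodes_def return_leaves_def)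
    then show "u \<in> {u. set u \<subseteq> alphabet X \<and> length u \<le> Suc N}"
      using language_subset_lists[of X] bound[OF u] by auto
  qed
  then have finUC: "finite (?U \<union> ?C)" using finite_lists_length_le[OF fin] by (rule finite_subset)
  have prefix: "prefix w u" if "u \<in> ?U \<union> ?C" for u
  proof -
    have "0 \<in> occurrences w u" using that by (auto simp: return_nodes_def return_leaves_def)
    then show ?thesis by (auto simp: occurrences_iff prefix_def)
  qed
  have "0 \<in> occurrences w w" by (rule occurrencesI[of _ "[]" _ "[]"]) auto
  moreover have "i = 0" if "i \<in> occurrences w w" for i using occurrences_le[OF that] by simp
  ultimately have "occurrences w w = {0}" by blast
  then have wU: "w \<in> ?U" using assms(2) by (auto simp: return_nodes_def)
  \<comment> \<open>Nodes begin with \<open>w\<close>, so a node that is a proper suffix of another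
    would give the latter a second occurrence of \<open>w\<close>.\<close>
  have code: "u = v" if uv: "u \<in> ?U" "v \<in> ?U" "suffix u v" for u v
  proof -
    obtain p where p: "v = p @ u" using uv(3) by (auto simp: suffix_def)
    obtain s where s: "u = w @ s" using prefix uv(1) by (auto simp: prefix_def)
    have "length p \<in> occurrences w v" by (rule occurrencesI[of _ p _ s]) (use p s in auto)
    then show ?thesis using uv(2) p by (auto simp: return_nodes_def)
  qed
  have "{c \<in> ?C. prefix w c} = ?C" "{u \<in> ?U. prefix w u} = ?U" using prefix by auto
  then have "int (card ?C) \<le> 1 + sum (right_excess X) ?U"
    using card_return_leaves_below[OF fin assms(3), of "Suc N" w] finUC bound wU by auto
  also have "sum (right_excess X) {u \<in> ?U. suffix [] u} \<le> right_excess X []"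
    using finUC lenU code language_prefix[of "[]" w] assms(2)
    by (intro sum_right_excess_suffix_code[where M = N, OF fin tree]) (auto simp: return_nodes_def)
  \<comment> \<open>Right extensions of the empty word are the letters of \<open>X\<close>, so its
    excess is their number minus one.\<close>
  then have "1 + sum (right_excess X) ?U \<le> int (card (alphabet X))"
    by (simp add: right_excess_def singleton_in_language_iff)
  finally have le: "card ?C \<le> card (alphabet X)" by simp
  have inj: "inj_on (\<lambda>v. v @ w) (return_words X w)" by (auto simp: inj_on_def)
  have sub: "(\<lambda>v. v @ w) ` return_words X w \<subseteq> ?C"
  proof (rule image_subsetI)
    fix v assume v: "v \<in> return_words X w"
    then have "length v > 0" "v @ w \<in> language X" by (auto simp: return_words_def)
    then show "v @ w \<in> ?C"
      using return_words_occurrences[OF v] unfolding return_leaves_def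
      by (intro CollectI conjI exI[of _ "length v"]) auto
  qed
  show "finite (return_words X w)" using inj sub finUC by (metis finite_Un inj_on_finite)
  show "card (return_words X w) \<le> card (alphabet X)"
    using card_inj_on_le[OF inj sub] finUC le by simp
qed

section \<open>Derived shifts\<close>

lemma morph_word_Nil [simp]: "morph_word \<tau> [] = []"
  by (simp add: morph_word_def)

lemma morph_word_Cons [simp]: "morph_word \<tau> (b # u) = \<tau> b @ morph_word \<tau> u"
  by (simp add: morph_word_def)

lemma morph_word_append [simp]: "morph_word \<tau> (u @ v) = morph_word \<tau> u @ morph_word \<tau> v"
  by (simp add: morph_word_def)

text \<open>One derivation step. It yields statements relating words of \<open>X\<close> and of
  \<open>Y\<close>, which apply in the same form at every level.\<close>

locale derived_shift =
  fixes X :: "(int \<Rightarrow> 'a) set" and w :: "'a list" and B :: "'b set"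
    and \<tau> :: "'b \<Rightarrow> 'a list" and Y :: "(int \<Rightarrow> 'b) set"
  assumes coding: "coding_morphism B \<tau> (return_words X w)"
    and derived: "is_derived_shift X w B \<tau> Y"
    and w_language: "w \<in> language X"
begin

lemma tau_return_word: "b \<in> B \<Longrightarrow> \<tau> b \<in> return_words X w"
  using coding by (auto simp: coding_morphism_def bij_betw_def)

lemma tau_nonempty: "b \<in> B \<Longrightarrow> \<tau> b \<noteq> []"
  using coding by (auto simp: coding_morphism_def)

lemma tau_inj: "b \<in> B \<Longrightarrow> c \<in> B \<Longrightarrow> \<tau> b = \<tau> c \<Longrightarrow> b = c"
  using coding by (auto simp: coding_morphism_def bij_betw_def inj_on_def)

lemma length_morph_word: "u \<in> lists B \<Longrightarrow> length u \<le> length (morph_word \<tau> u)"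
proof (induction u)
  case (Cons b u)
  then show ?case using tau_nonempty[of b] by (cases "\<tau> b") auto
qed simp

text \<open>The \<open>w\<close> at the right end is pushed to the left through one return word
  after another, since each \<open>\<tau> b w\<close> begins with \<open>w\<close>.\<close>

lemma morph_word_prefix_w: "u \<in> lists B \<Longrightarrow> \<exists>s. morph_word \<tau> u @ w = w @ s"
proof (induction u)
  case (Cons b u)
  then obtain s where s: "morph_word \<tau> u @ w = w @ s" by auto
  have "prefix w (\<tau> b @ w)"
    using tau_return_word[of b] Cons.prems by (auto simp: return_words_def)
  then obtain s' where "\<tau> b @ w = w @ s'" by (auto simp: prefix_def)
  then show ?case using s by (intro exI[of _ "s' @ s"]) (metis append.assoc morph_word_Cons)
qed simp

text \<open>The remaining conditions in \<open>Gamma_words\<close> follow from the \<open>w\<close>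
  at the left end. The empty word, added separately in the definition, fits because \<open>w\<close>
  is in the language of \<open>X\<close>.\<close>

lemma in_language_derived_iff:
  "u \<in> language Y \<longleftrightarrow> u \<in> lists B \<and> morph_word \<tau> u @ w \<in> language X"
proof (cases "u = []")
  case True
  then show ?thesis using derived w_language by (auto simp: is_derived_shift_def)
next
  case False
  have "morph_word \<tau> u \<in> Gamma_words X w"
    if u: "u \<in> lists B" "morph_word \<tau> u @ w \<in> language X"
  proof -
    obtain s where s: "morph_word \<tau> u @ w = w @ s" using morph_word_prefix_w[OF u(1)] by blast
    have "s \<noteq> []" using length_morph_word[OF u(1)] False s by auto
    moreover have "morph_word \<tau> u \<in> language X" using u(2) by (rule language_prefix)
    ultimately show ?thesis using u(2) s by (auto simp: Gamma_words_def)
  qed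
  then show ?thesis using derived False by (auto simp: is_derived_shift_def Gamma_words_def)
qed

lemma letter_in_language_derived: "b \<in> B \<Longrightarrow> [b] \<in> language Y"
  using tau_return_word[of b] by (auto simp: in_language_derived_iff return_words_def)

text \<open>If one of the two words were a proper prefix of the other, its final \<open>w\<close>
  would be a third occurrence in the longer one.\<close>

lemma return_word_prefix_code:
  assumes "b \<in> B" "c \<in> B" "prefix (\<tau> b @ w) z" "prefix (\<tau> c @ w) z"
  shows "b = c"
proof -
  have "b = c" if bc: "b \<in> B" "c \<in> B" "prefix (\<tau> b @ w) (\<tau> c @ w)" for b c
  proof -
    obtain s where "\<tau> c @ w = \<tau> b @ w @ s" using bc(3) by (auto simp: prefix_def)
    then have "length (\<tau> b) \<in> occurrences w (\<tau> c @ w)" by (rule occurrencesI) simp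
    then have "length (\<tau> b) = length (\<tau> c)"
      using return_words_occurrences[OF tau_return_word[OF bc(2)]] tau_nonempty[OF bc(1)] by auto
    then have "\<tau> b = \<tau> c" using bc(3) by (auto simp: prefix_def)
    then show ?thesis using tau_inj bc by blast
  qed
  then show ?thesis using assms prefix_same_cases by metis
qed

text \<open>The appended \<open>w\<close> makes decoding from the left possible: the first block on
  each side is followed by a visible \<open>w\<close>, so the prefix code identifies it.\<close>

lemma prefix_of_morph_word_prefix:
  "u \<in> lists B \<Longrightarrow> z \<in> lists B \<Longrightarrow> prefix (morph_word \<tau> u @ w) (morph_word \<tau> z @ w) \<Longrightarrow> prefix u z"
proof (induction u arbitrary: z)
  case (Cons b u)
  have "length (morph_word \<tau> (b # u)) \<le> length (morph_word \<tau> z)"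
    using prefix_length_le[OF Cons.prems(3)] by simp
  then have "z \<noteq> []" using length_morph_word[OF Cons.prems(1)] by auto
  then obtain c z' where z: "z = c # z'" by (cases z) auto
  obtain s where "morph_word \<tau> u @ w = w @ s" using morph_word_prefix_w[of u] Cons.prems by auto
  moreover obtain s' where "morph_word \<tau> z' @ w = w @ s'"
    using morph_word_prefix_w[of z'] Cons.prems z by auto
  ultimately have "prefix (\<tau> b @ w) (morph_word \<tau> z @ w)" "prefix (\<tau> c @ w) (morph_word \<tau> z @ w)"
    using Cons.prems(3) z by (auto simp: prefix_def)
  then have "b = c" using Cons.prems z by (intro return_word_prefix_code[of b c]) auto
  then show ?case using Cons.IH[of z'] Cons.prems z by auto
qed simp

lemma morph_word_inj:
  assumes "u \<in> lists B" "z \<in> lists B" "morph_word \<tau> u = morph_word \<tau> z"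
  shows "u = z"
  using prefix_of_morph_word_prefix[of u z] prefix_of_morph_word_prefix[of z u] assms
  by (auto intro: prefix_order.antisym)

text \<open>An occurrence starting in the first block is contained in \<open>\<tau> c w\<close>,
  where \<open>w\<close> occurs only at the two ends; so none starts strictly inside a
  block.\<close>

lemma occurrence_is_cut:
  "z \<in> lists B \<Longrightarrow> p \<in> occurrences w (morph_word \<tau> z @ w) \<Longrightarrow>
    \<exists>i\<le>length z. p = length (morph_word \<tau> (take i z))"
proof (induction z arbitrary: p)
  case Nil
  then show ?case using occurrences_le[of p w] by fastforce
next
  case (Cons c z)
  then have c: "c \<in> B" and z: "z \<in> lists B" by auto
  show ?case
  proof (cases "p < length (\<tau> c)")
    case True
    obtain s where s: "morph_word \<tau> z @ w = w @ s" using morph_word_prefix_w[OF z] by blast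
    then have "p \<in> occurrences w ((\<tau> c @ w) @ s)" using Cons.prems(2) by simp
    then have "p \<in> occurrences w (\<tau> c @ w)" using True occurrences_append_iff[of p w "\<tau> c @ w" s] by simp
    then have "p = 0" using return_words_occurrences[OF tau_return_word[OF c]] True by auto
    then show ?thesis by (intro exI[of _ 0]) simp
  next
    case False
    then have "p - length (\<tau> c) \<in> occurrences w (morph_word \<tau> z @ w)"
      using Cons.prems(2) occurrences_drop_iff[of "length (\<tau> c)" p "morph_word \<tau> (c # z) @ w" w] by simp
    then obtain i where "i \<le> length z" "p - length (\<tau> c) = length (morph_word \<tau> (take i z))"
      using Cons.IH z by blast
    then show ?thesis using False by (intro exI[of _ "Suc i"]) simp
  qed
qed

text \<open>The word \<open>\<tau>(u) w\<close> begins with \<open>w\<close>, so it starts at a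
  block boundary; from there decoding shows that \<open>u\<close> itself is read.\<close>

lemma occurrence_of_image:
  assumes "u \<in> lists B" "z \<in> lists B" "p \<in> occurrences (morph_word \<tau> u @ w) (morph_word \<tau> z @ w)"
  shows "\<exists>i. i \<in> occurrences u z \<and> p = length (morph_word \<tau> (take i z))"
proof -
  obtain q s where q: "morph_word \<tau> z @ w = q @ (morph_word \<tau> u @ w) @ s" "length q = p"
    using assms(3) by (auto simp: occurrences_iff)
  obtain s' where s': "morph_word \<tau> u @ w = w @ s'" using morph_word_prefix_w[OF assms(1)] by blast
  have "p \<in> occurrences w (morph_word \<tau> z @ w)"
    using q s' by (intro occurrencesI[of _ q _ "s' @ s"]) auto
  then obtain i where i: "i \<le> length z" "p = length (morph_word \<tau> (take i z))"
    using occurrence_is_cut assms(2) by blast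
  have "morph_word \<tau> z @ w = morph_word \<tau> (take i z) @ morph_word \<tau> (drop i z) @ w"
    by (metis append.assoc append_take_drop_id morph_word_append)
  then have "morph_word \<tau> (drop i z) @ w = (morph_word \<tau> u @ w) @ s"
    using q i(2) by (metis append_eq_append_conv)
  then have "prefix (morph_word \<tau> u @ w) (morph_word \<tau> (drop i z) @ w)" by (auto simp: prefix_def)
  moreover have "drop i z \<in> lists B" using assms(2) by (auto dest: in_set_dropD)
  ultimately have "prefix u (drop i z)" using prefix_of_morph_word_prefix assms(1) by blast
  then obtain t where "drop i z = u @ t" by (auto simp: prefix_def)
  then have "z = take i z @ u @ t" by (metis append_take_drop_id)
  then have "i \<in> occurrences u z" by (rule occurrencesI) (use i in simp)
  then show ?thesis using i by blast
qed

text \<open>The same \<open>N\<close> serves, as images are at least as long as the words: a long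
  \<open>v\<close> has an image containing \<open>\<tau>(u) w\<close>, which decodes to an
  occurrence of \<open>u\<close>.\<close>

lemma derived_recurrent:
  assumes "recurrent_language X"
  shows "recurrent_language Y"
  unfolding recurrent_language_def
proof (rule ballI)
  fix u assume u: "u \<in> language Y"
  then have uB: "u \<in> lists B" and "morph_word \<tau> u @ w \<in> language X"
    by (auto simp: in_language_derived_iff)
  then obtain N where N: "\<And>v. v \<in> language X \<Longrightarrow> N \<le> length v \<Longrightarrow> sublist (morph_word \<tau> u @ w) v"
    using assms unfolding recurrent_language_def by blast
  have "sublist u v" if v: "v \<in> language Y" "N \<le> length v" for v
  proof -
    have vB: "v \<in> lists B" and vX: "morph_word \<tau> v @ w \<in> language X"
      using v by (auto simp: in_language_derived_iff)
    have "sublist (morph_word \<tau> u @ w) (morph_word \<tau> v @ w)"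
      using N[OF vX] length_morph_word[OF vB] v(2) by simp
    then obtain p s where "morph_word \<tau> v @ w = p @ (morph_word \<tau> u @ w) @ s"
      unfolding sublist_def by metis
    then have "length p \<in> occurrences (morph_word \<tau> u @ w) (morph_word \<tau> v @ w)"
      by (rule occurrencesI) simp
    then show ?thesis
      using occurrence_of_image[OF uB vB] by (auto simp: occurrences_iff)
  qed
  then show "\<exists>N. \<forall>v\<in>language Y. N \<le> length v \<longrightarrow> sublist u v" by blast
qed

text \<open>Occurrences of \<open>\<tau>(u) w\<close> in the image come from occurrences of
  \<open>u\<close> in \<open>v u\<close>, hence again only the two ends. Iterated, this moves counts
  of return words at any level back to \<open>X\<close>.\<close>

lemma derived_return_word:
  assumes "v \<in> return_words Y u"
  shows "morph_word \<tau> v \<in> return_words X (morph_word \<tau> u @ w)"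
proof (rule return_wordsI)
  have v: "v \<noteq> []" "v @ u \<in> language Y" using assms by (auto simp: return_words_def)
  have occ: "occurrences u (v @ u) = {0, length v}" using assms by (rule return_words_occurrences)
  have B: "v \<in> lists B" "u \<in> lists B" "v @ u \<in> lists B"
    using v(2) in_language_derived_iff by auto
  show "morph_word \<tau> v \<noteq> []" using length_morph_word[OF B(1)] v(1) by auto
  show "morph_word \<tau> v @ morph_word \<tau> u @ w \<in> language X"
    using v(2) in_language_derived_iff by auto
  obtain s where s: "v @ u = u @ s"
    using occ by (metis append_Nil insertI1 length_0_conv occurrences_iff)
  then have "s \<in> lists B" using B(3) by auto
  then obtain t where "morph_word \<tau> s @ w = w @ t" using morph_word_prefix_w by blast
  then have "morph_word \<tau> (v @ u) @ w = (morph_word \<tau> u @ w) @ t"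
    unfolding s by simp
  then have "0 \<in> occurrences (morph_word \<tau> u @ w) (morph_word \<tau> v @ morph_word \<tau> u @ w)"
    by (intro occurrencesI[of _ "[]" _ t]) auto
  moreover have "length (morph_word \<tau> v) \<in>
      occurrences (morph_word \<tau> u @ w) (morph_word \<tau> v @ morph_word \<tau> u @ w)"
    by (rule occurrencesI[of _ "morph_word \<tau> v" _ "[]"]) auto
  moreover have "p \<in> {0, length (morph_word \<tau> v)}"
    if "p \<in> occurrences (morph_word \<tau> u @ w) (morph_word \<tau> v @ morph_word \<tau> u @ w)" for p
    using occurrence_of_image[OF B(2,3), of p] that occ by auto
  ultimately show "occurrences (morph_word \<tau> u @ w) (morph_word \<tau> v @ morph_word \<tau> u @ w) =
      {0, length (morph_word \<tau> v)}" by blast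
qed

lemma card_derived_return_words:
  assumes "finite (return_words X (morph_word \<tau> u @ w))"
  shows "finite (return_words Y u)"
    "card (return_words Y u) \<le> card (return_words X (morph_word \<tau> u @ w))"
proof -
  have "return_words Y u \<subseteq> lists B"
    using in_language_derived_iff by (auto simp: return_words_def)
  then have inj: "inj_on (morph_word \<tau>) (return_words Y u)"
    using morph_word_inj by (auto simp: inj_on_def subset_iff)
  have sub: "morph_word \<tau> ` return_words Y u \<subseteq> return_words X (morph_word \<tau> u @ w)"
    using derived_return_word by blast
  show "finite (return_words Y u)" using inj_on_finite[OF inj sub assms] .
  show "card (return_words Y u) \<le> card (return_words X (morph_word \<tau> u @ w))"
    using card_inj_on_le[OF inj sub assms] .
qed

end

section \<open>Enumerating the cutting points\<close>

text \<open>Placing 0 between \<open>c 0\<close> and \<open>c 1\<close> fixes the indexing and so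
  makes the enumeration unique; an element equal to 0 is \<open>c 0\<close>.\<close>

definition cut_enum :: "int set \<Rightarrow> (int \<Rightarrow> int) \<Rightarrow> bool" where
  "cut_enum C c \<longleftrightarrow> c 0 \<le> 0 \<and> 0 < c 1 \<and>
     (\<forall>i. c i \<in> C \<and> c i < c (i + 1) \<and> (\<forall>z. c i < z \<and> z < c (i + 1) \<longrightarrow> z \<notin> C))"

lemma ex_cut_enum:
  assumes above: "\<And>i. \<exists>z\<in>C. i < z" and below: "\<And>i. \<exists>z\<in>C. z < i"
  shows "\<exists>c. cut_enum C c"
proof -
  define nxt where "nxt i = i + 1 + int (LEAST n. i + 1 + int n \<in> C)" for i
  define prv where "prv i = i - 1 - int (LEAST n. i - 1 - int n \<in> C)" for i
  have nxt: "nxt i \<in> C \<and> i < nxt i \<and> (\<forall>z. i < z \<and> z < nxt i \<longrightarrow> z \<notin> C)" for i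
  proof -
    obtain z where "z \<in> C" "i < z" using above by blast
    then have "i + 1 + int (nat (z - i - 1)) \<in> C" by simp
    then have "nxt i \<in> C" unfolding nxt_def by (rule LeastI)
    moreover have "z \<notin> C" if "i < z" "z < nxt i" for z
    proof -
      have "nat (z - i - 1) < (LEAST n. i + 1 + int n \<in> C)" using that unfolding nxt_def by linarith
      then show ?thesis using not_less_Least[of "nat (z - i - 1)"] that by fastforce
    qed
    moreover have "i < nxt i" by (simp add: nxt_def)
    ultimately show ?thesis by blast
  qed
  have prv: "prv i \<in> C \<and> prv i < i \<and> (\<forall>z. prv i < z \<and> z < i \<longrightarrow> z \<notin> C)" for i
  proof -
    obtain z where "z \<in> C" "z < i" using below by blast
    then have "i - 1 - int (nat (i - z - 1)) \<in> C" by simp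
    then have "prv i \<in> C" unfolding prv_def by (rule LeastI)
    moreover have "z \<notin> C" if "prv i < z" "z < i" for z
    proof -
      have "nat (i - z - 1) < (LEAST n. i - 1 - int n \<in> C)" using that unfolding prv_def by linarith
      then show ?thesis using not_less_Least[of "nat (i - z - 1)"] that by fastforce
    qed
    moreover have "prv i < i" by (simp add: prv_def)
    ultimately show ?thesis by blast
  qed
  \<comment> \<open>\<open>prv 1\<close> is the largest element of \<open>C\<close> that is at most
    0; the rest is generated from it in both directions.\<close>
  define c where "c i = (if i \<ge> 0 then (nxt ^^ nat i) (prv 1) else (prv ^^ nat (- i)) (prv 1))" for i
  have c0: "c 0 = prv 1" by (simp add: c_def)
  have up: "c (i + 1) = nxt (c i)" if "i \<ge> 0" for i
    using that by (simp add: c_def nat_add_distrib)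
  have down: "c i = prv (c (i + 1))" if i: "i < 0" for i
  proof -
    have "nat (- i) = Suc (nat (- (i + 1)))" using i by simp
    then show ?thesis using i by (simp add: c_def)
  qed
  have inC: "c i \<in> C" for i
  proof (cases "i \<le> 0")
    case True
    then show ?thesis using down[of i] prv c0 by (cases "i = 0") auto
  next
    case False
    then show ?thesis using up[of "i - 1"] nxt by auto
  qed
  have gap: "c i < c (i + 1) \<and> (\<forall>z. c i < z \<and> z < c (i + 1) \<longrightarrow> z \<notin> C)" for i
  proof (cases "i \<ge> 0")
    case True
    then show ?thesis using up[OF True] nxt[of "c i"] by simp
  next
    case False
    then show ?thesis using down[of i] prv[of "c (i + 1)"] by auto
  qed
  have "c 0 \<le> 0" using prv[of 1] c0 by simp
  moreover have "0 < c 1" using inC[of 1] gap[of 0] prv[of 1] c0 by force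
  ultimately show ?thesis using inC gap unfolding cut_enum_def by blast
qed

lemma cut_enum_strict_mono:
  assumes "cut_enum C c" "i < j"
  shows "c i < c j"
proof -
  have "c i < c (i + 1 + int n)" for n
  proof (induction n)
    case (Suc n)
    have "c (i + 1 + int n) < c (i + 1 + int n + 1)" using assms(1) unfolding cut_enum_def by blast
    then show ?case using Suc by (simp add: algebra_simps)
  qed (use assms(1) in \<open>auto simp: cut_enum_def\<close>)
  from this[of "nat (j - i - 1)"] show ?thesis using assms(2) by simp
qed

lemma cut_enum_mono: "cut_enum C c \<Longrightarrow> i \<le> j \<Longrightarrow> c i \<le> c j"
  using cut_enum_strict_mono[of C c i j] by (cases "i = j") auto

text \<open>The largest elements up to 0 agree, and from there enumerations that skip nothing stay
  together as long as both sets look alike. With \<open>C = C'\<close> this is uniqueness; with a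
  finite window it is the source of continuity of desubstitution.\<close>

lemma cut_enum_local:
  assumes c: "cut_enum C c" and c': "cut_enum C' c'"
    and same: "\<And>z. c (- int m) \<le> z \<Longrightarrow> z \<le> c (int m + 1) \<Longrightarrow> z \<in> C \<longleftrightarrow> z \<in> C'"
    and i: "- int m \<le> i" "i \<le> int m + 1"
  shows "c' i = c i"
proof -
  note mono = cut_enum_mono[OF c]
  have C: "c i \<in> C" "c i < c (i + 1)" "\<And>z. c i < z \<Longrightarrow> z < c (i + 1) \<Longrightarrow> z \<notin> C" for i
    using c unfolding cut_enum_def by blast+
  have C': "c' i \<in> C'" "c' i < c' (i + 1)" "\<And>z. c' i < z \<Longrightarrow> z < c' (i + 1) \<Longrightarrow> z \<notin> C'" for i
    using c' unfolding cut_enum_def by blast+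
  have z: "c 0 \<le> 0" "0 < c 1" "c' 0 \<le> 0" "0 < c' 1"
    using c c' by (auto simp: cut_enum_def)
  have mem: "c i \<in> C'" if "- int m \<le> i" "i \<le> int m + 1" for i
    using same[of "c i"] C(1) mono that by blast
  have base: "c' 0 = c 0"
  proof (rule antisym; rule ccontr)
    assume "\<not> c' 0 \<le> c 0"
    then have "c 0 < c' 0" "c' 0 < c 1" using z by auto
    moreover have "c' 0 \<in> C"
      using same[of "c' 0"] C'(1)[of 0] mono[of "- int m" 0] mono[of 1 "int m + 1"] calculation by auto
    ultimately show False using C(3)[of 0 "c' 0"] by simp
  next
    assume "\<not> c 0 \<le> c' 0"
    then show False using C'(3)[of 0 "c 0"] mem[of 0] z by simp
  qed
  have up: "c' (int n) = c (int n)" if "n \<le> m + 1" for n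
    using that
  proof (induction n)
    case (Suc n)
    then have eq: "c' (int n) = c (int n)" by simp
    have "c (int n + 1) \<in> C'" using mem[of "int n + 1"] Suc.prems by simp
    then have le: "c' (int n + 1) \<le> c (int n + 1)"
      using C'(3)[of "int n" "c (int n + 1)"] C(2)[of "int n"] eq by force
    have gt: "c (int n) < c' (int n + 1)" using C'(2)[of "int n"] eq by simp
    have "c' (int n + 1) \<in> C"
      using same[of "c' (int n + 1)"] C'(1) le gt mono[of "- int m" "int n"]
        mono[of "int n + 1" "int m + 1"] Suc.prems by simp
    then have "\<not> c' (int n + 1) < c (int n + 1)" using C(3)[OF gt] by blast
    then show ?case using le by (simp add: algebra_simps)
  qed (simp add: base)
  have down: "c' (- int n) = c (- int n)" if "n \<le> m" for n
    using that
  proof (induction n)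
    case (Suc n)
    let ?j = "- int n - 1"
    have eq: "c' (?j + 1) = c (?j + 1)" using Suc by simp
    have "c ?j \<in> C'" using mem[of ?j] Suc.prems by simp
    then have ge: "c ?j \<le> c' ?j"
      using C'(3)[of ?j "c ?j"] C(2)[of ?j] eq by force
    have lt: "c' ?j < c (?j + 1)" using C'(2)[of ?j] eq by simp
    have "c' ?j \<in> C"
      using same[of "c' ?j"] C'(1) ge lt mono[of "- int m" ?j]
        mono[of "?j + 1" "int m + 1"] Suc.prems by simp
    then have "\<not> c ?j < c' ?j" using C(3)[of ?j "c' ?j"] lt by blast
    then have "c' ?j = c ?j" using ge by simp
    moreover have "- int (Suc n) = ?j" by simp
    ultimately show ?case by (simp only:)
  qed (simp add: base)
  show ?thesis
    using up[of "nat i"] down[of "nat (- i)"] i by (cases "i \<ge> 0") auto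
qed

lemma cut_enum_unique: "cut_enum C c \<Longrightarrow> cut_enum C c' \<Longrightarrow> c' = c"
proof (rule ext)
  fix i assume "cut_enum C c" "cut_enum C c'"
  then show "c' i = c i" by (rule cut_enum_local[where m = "nat \<bar>i\<bar>"]) auto
qed

section \<open>Desubstitution\<close>

text \<open>\<open>D x\<close> is the desubstituted point and \<open>K x\<close> the position of the coordinate \<open>0\<close> of \<open>x\<close> inside
  the image of the letter \<open>D x 0\<close>.\<close>

definition desubst_maps ::
  "(int \<Rightarrow> 'a) set \<Rightarrow> (int \<Rightarrow> 'b) set \<Rightarrow> ('b \<Rightarrow> 'a list) \<Rightarrow> ((int \<Rightarrow> 'a) \<Rightarrow> int \<Rightarrow> 'b) \<Rightarrow>
    ((int \<Rightarrow> 'a) \<Rightarrow> nat) \<Rightarrow> bool" where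
  "desubst_maps X Y \<sigma> D K \<longleftrightarrow> (\<forall>x\<in>X.
     D x \<in> Y \<and> K x < length (\<sigma> (D x 0)) \<and> \<sigma> (D x 0) ! K x = x 0 \<and>
     (\<forall>i. \<forall>k<length (\<sigma> (D x i)). \<exists>j. D (shift_by j x) = shift_by i (D x) \<and> K (shift_by j x) = k) \<and>
     (if Suc (K x) < length (\<sigma> (D x 0))
      then D (shift_by 1 x) = D x \<and> K (shift_by 1 x) = Suc (K x)
      else D (shift_by 1 x) = shift_by 1 (D x) \<and> K (shift_by 1 x) = 0) \<and>
     (\<forall>m. \<exists>m'. \<forall>x'\<in>X. agree m' x x' \<longrightarrow> agree m (D x) (D x') \<and> K x = K x'))"

text \<open>A derivation step at the two-letter word \<open>l r\<close>, seen through \<sigma>: its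
  blocks are those of \<tau> moved one letter to the right.\<close>

locale return_desubstitution = derived_shift X "[l, r]" B \<tau> Y
  for X :: "(int \<Rightarrow> 'a) set" and l r :: 'a and B :: "'b set"
    and \<tau> :: "'b \<Rightarrow> 'a list" and Y :: "(int \<Rightarrow> 'b) set" +
  fixes \<sigma> :: "'b \<Rightarrow> 'a list"
  assumes sigma: "b \<in> B \<Longrightarrow> l # \<sigma> b = \<tau> b @ [l]"
    and recurrent: "recurrent_language X"
    and shift_invariant: "x \<in> X \<Longrightarrow> shift_by j x \<in> X"
begin

lemma sigma_nonempty: "b \<in> B \<Longrightarrow> \<sigma> b \<noteq> []"
  using sigma[of b] tau_nonempty[of b] by (auto simp: append_eq_Cons_conv)

lemma last_sigma: "b \<in> B \<Longrightarrow> last (\<sigma> b) = l"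
  using sigma[of b] sigma_nonempty[of b] by (metis last_ConsR last_snoc)

text \<open>The word \<open>\<tau> b l r\<close>, which is \<open>l \<sigma>(b) r\<close>, begins
  with \<open>l r\<close>, and its second letter is the first of \<open>\<sigma> b\<close>.\<close>

lemma hd_sigma:
  assumes b: "b \<in> B"
  shows "hd (\<sigma> b) = r"
proof -
  have "prefix [l, r] (\<tau> b @ [l, r])"
    using tau_return_word[OF b] by (auto simp: return_words_def)
  moreover have "\<tau> b @ [l, r] = (l # \<sigma> b) @ [r]" using sigma[OF b] by simp
  ultimately show ?thesis using sigma_nonempty[OF b] by (cases "\<sigma> b") auto
qed

lemma sigma_inj: "b \<in> B \<Longrightarrow> c \<in> B \<Longrightarrow> \<sigma> b = \<sigma> c \<Longrightarrow> b = c"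
  using sigma[of b] sigma[of c] tau_inj[of b c] by auto

definition cuts :: "(int \<Rightarrow> 'a) \<Rightarrow> int set" where
  "cuts x = {i. x (i - 1) = l \<and> x i = r}"

text \<open>This says that \<open>x\<close> is the two-sided image of \<open>y\<close> under
  \<sigma> shifted by \<open>- c 0\<close>, with block boundaries exactly at the cuts; the image
  itself is never formed.\<close>

definition desub :: "(int \<Rightarrow> 'a) \<Rightarrow> (int \<Rightarrow> 'b) \<Rightarrow> (int \<Rightarrow> int) \<Rightarrow> bool" where
  "desub x y c \<longleftrightarrow> cut_enum (cuts x) c \<and>
     (\<forall>i. y i \<in> B \<and> \<sigma> (y i) = subword x (c i) (nat (c (i + 1) - c i)))"

lemma occurrences_subword_iff:
  "k \<in> occurrences [l, r] (subword x j n) \<longleftrightarrow> k + 2 \<le> n \<and> j + int k + 1 \<in> cuts x"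
proof (cases "k + 2 \<le> n")
  case True
  then have "n = k + (Suc (Suc 0) + (n - k - 2))" by simp
  then have "subword x j n = subword x j (k + (Suc (Suc 0) + (n - k - 2)))" by (rule arg_cong)
  also have "\<dots> = subword x j k @ [x (j + int k), x (j + int k + 1)] @ 
      subword x (j + int k + 2) (n - k - 2)"
    unfolding subword_append by (simp add: subword_Suc)
  finally show ?thesis using True by (auto simp: occurrences_def cuts_def)
qed (auto simp: occurrences_def)

text \<open>Recurrence puts \<open>l r\<close> into every window of a fixed length \<open>N\<close>,
  on either side of \<open>i\<close>.\<close>

lemma cuts_unbounded:
  assumes x: "x \<in> X"
  shows "\<exists>z\<in>cuts x. i < z" "\<exists>z\<in>cuts x. z < i"
proof -
  obtain N where N: "\<And>v. v \<in> language X \<Longrightarrow> N \<le> length v \<Longrightarrow> sublist [l, r] v"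
    using recurrent w_language unfolding recurrent_language_def by blast
  have *: "\<exists>z\<in>cuts x. j < z \<and> z < j + int N" for j
  proof -
    have "sublist [l, r] (subword x j N)" by (rule N) (use x in \<open>auto simp: subword_in_language\<close>)
    then obtain p s where "subword x j N = p @ [l, r] @ s" by (auto simp: sublist_def)
    then have "length p \<in> occurrences [l, r] (subword x j N)" by (rule occurrencesI) simp
    then have "length p + 2 \<le> N" "j + int (length p) + 1 \<in> cuts x"
      unfolding occurrences_subword_iff by auto
    then show ?thesis by (intro bexI[of _ "j + int (length p) + 1"]) auto
  qed
  show "\<exists>z\<in>cuts x. i < z" using *[of i] by blast
  show "\<exists>z\<in>cuts x. z < i" using *[of "i - int N"] by auto
qed

lemma cut_enum_gap:
  assumes "cut_enum (cuts x) c"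
  shows "c i < c (i + 1)" "x (c i - 1) = l" "x (c i) = r"
    "c i < z \<Longrightarrow> z < c (i + 1) \<Longrightarrow> z \<notin> cuts x"
proof -
  have "c i \<in> cuts x" "c i < c (i + 1)" "\<forall>z. c i < z \<and> z < c (i + 1) \<longrightarrow> z \<notin> cuts x"
    using assms unfolding cut_enum_def by blast+
  then show "c i < c (i + 1)" "x (c i - 1) = l" "x (c i) = r"
    "c i < z \<Longrightarrow> z < c (i + 1) \<Longrightarrow> z \<notin> cuts x" by (auto simp: cuts_def)
qed

text \<open>The stretch of \<open>x\<close> from one \<open>l r\<close> to the next is a return
  word, hence the \<tau>-image of a letter; read one coordinate later it is the
  \<sigma>-image.\<close>

lemma ex_desub:
  assumes x: "x \<in> X"
  shows "\<exists>y c. desub x y c"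
proof -
  obtain c where c: "cut_enum (cuts x) c"
    using ex_cut_enum[of "cuts x"] cuts_unbounded[OF x] by blast
  note gap = cut_enum_gap[OF c]
  have "\<exists>b. b \<in> B \<and> \<sigma> b = subword x (c i) (nat (c (i + 1) - c i))" for i
  proof -
    define n where "n = nat (c (i + 1) - c i)"
    have n: "c (i + 1) = c i + int n" "n > 0" using gap(1)[of i] by (auto simp: n_def)
    \<comment> \<open>The start is \<open>c i - 1\<close>, not \<open>c i\<close>, because the
      letter \<open>l\<close> of the occurrence sits to the left of the cut.\<close>
    define v where "v = subword x (c i - 1) n"
    have vw: "v @ [l, r] = subword x (c i - 1) (n + 2)"
      using gap(2,3)[of "i + 1"] n unfolding v_def subword_append
      by (simp add: numeral_2_eq_2 subword_Suc algebra_simps)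
    have "k \<in> occurrences [l, r] (v @ [l, r]) \<longleftrightarrow> k = 0 \<or> k = n" for k
    proof -
      have "k \<in> occurrences [l, r] (v @ [l, r]) \<longleftrightarrow> k \<le> n \<and> c i + int k \<in> cuts x"
        unfolding vw occurrences_subword_iff by simp
      moreover have "c i \<in> cuts x" "c i + int n \<in> cuts x"
        using c n(1) unfolding cut_enum_def by metis+
      moreover have "c i + int k \<notin> cuts x" if "0 < k" "k < n"
        using gap(4)[of i "c i + int k"] that n(1) by simp
      ultimately show ?thesis by (cases "k = 0"; cases "k = n") auto
    qed
    then have "occurrences [l, r] (v @ [l, r]) = {0, length v}" by (auto simp: v_def)
    moreover have "v \<noteq> []" using n(2) by (metis length_subword less_nat_zero_code list.size(3) v_def)
    moreover have "v @ [l, r] \<in> language X" unfolding vw using x by (rule subword_in_language)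
    ultimately have "v \<in> return_words X [l, r]" by (intro return_wordsI)
    then obtain b where b: "b \<in> B" "\<tau> b = v"
      using coding unfolding coding_morphism_def bij_betw_def by (metis imageE)
    have "l # \<sigma> b = subword x (c i - 1) n @ [x (c i - 1 + int n)]"
      using sigma[OF b(1)] b(2) gap(2)[of "i + 1"] n(1) by (simp add: v_def algebra_simps)
    also have "\<dots> = subword x (c i - 1) (Suc n)" by (simp only: subword_Suc_last)
    also have "\<dots> = l # subword x (c i) n" using gap(2)[of i] by (simp add: subword_Suc)
    finally show ?thesis using b(1) n_def by blast
  qed
  then obtain y where "\<And>i. y i \<in> B \<and> \<sigma> (y i) = subword x (c i) (nat (c (i + 1) - c i))" by metis
  then show ?thesis using c unfolding desub_def by blast
qed

lemma desub_unique:
  assumes "desub x y c" "desub x y' c'"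
  shows "y' = y" "c' = c"
proof -
  show c: "c' = c" using assms cut_enum_unique unfolding desub_def by blast
  show "y' = y" using assms sigma_inj unfolding desub_def c by (metis ext)
qed

lemma desub_tau:
  assumes "desub x y c"
  shows "\<tau> (y i) = subword x (c i - 1) (nat (c (i + 1) - c i))"
proof -
  let ?n = "nat (c (i + 1) - c i)"
  have "\<tau> (y i) @ [l] = l # subword x (c i) ?n"
    using assms sigma[of "y i"] by (simp add: desub_def)
  also have "\<dots> = subword x (c i - 1) (Suc ?n)"
    using assms cut_enum_gap(2)[of x c i] by (simp add: desub_def subword_Suc)
  finally show ?thesis unfolding subword_Suc_last by simp
qed

lemma desub_morph_word:
  assumes "desub x y c"
  shows "morph_word \<tau> (subword y i m) = subword x (c i - 1) (nat (c (i + int m) - c i))"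
proof (induction m)
  case (Suc m)
  have c: "cut_enum (cuts x) c" using assms by (simp add: desub_def)
  have le: "c i \<le> c (i + int m)" "c (i + int m) \<le> c (i + int m + 1)"
    using cut_enum_mono[OF c] by auto
  have "morph_word \<tau> (subword y i (Suc m)) = morph_word \<tau> (subword y i m) @ \<tau> (y (i + int m))"
    by (simp add: subword_Suc_last)
  also have "\<dots> = subword x (c i - 1) (nat (c (i + int m) - c i)) @
      subword x (c (i + int m) - 1) (nat (c (i + int m + 1) - c (i + int m)))"
    using Suc desub_tau[OF assms] by simp
  also have "c (i + int m) - 1 = c i - 1 + int (nat (c (i + int m) - c i))" using le by simp
  also have "subword x (c i - 1) (nat (c (i + int m) - c i)) @
      subword x (c i - 1 + int (nat (c (i + int m) - c i))) (nat (c (i + int m + 1) - c (i + int m))) =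
      subword x (c i - 1) (nat (c (i + int m) - c i) + nat (c (i + int m + 1) - c (i + int m)))"
    by (simp only: subword_append)
  also have "nat (c (i + int m) - c i) + nat (c (i + int m + 1) - c (i + int m)) =
      nat (c (i + int (Suc m)) - c i)"
    using le by (simp add: algebra_simps flip: nat_add_distrib)
  finally show ?case .
qed simp

text \<open>\<open>Y\<close> is a shift space with prescribed language, so membership is tested on
  words: each word of \<open>y\<close> decodes a word of \<open>x\<close> that is followed by
  \<open>l r\<close>.\<close>

lemma desub_mem:
  assumes "x \<in> X" "desub x y c"
  shows "y \<in> Y"
proof (rule shift_space_memI)
  show "shift_space B Y" using derived by (simp add: is_derived_shift_def)
  fix i n
  have c: "cut_enum (cuts x) c" using assms by (simp add: desub_def)
  let ?k = "nat (c (i + int n) - c i)"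
  have k: "c i + int ?k = c (i + int n)" using cut_enum_mono[OF c, of i "i + int n"] by simp
  have "morph_word \<tau> (subword y i n) @ [l, r] = subword x (c i - 1) (?k + 2)"
    unfolding desub_morph_word[OF assms(2)] subword_append
    using k cut_enum_gap(2,3)[OF c, of "i + int n"]
    by (simp add: numeral_2_eq_2 subword_Suc algebra_simps)
  then have "morph_word \<tau> (subword y i n) @ [l, r] \<in> language X"
    using assms(1) by (simp add: subword_in_language)
  moreover have "subword y i n \<in> lists B"
    using assms(2) by (auto simp: desub_def subword_def)
  ultimately show "subword y i n \<in> language Y" by (simp add: in_language_derived_iff)
qed

text \<open>Moving position \<open>k\<close> of block \<open>i\<close> to the origin renumbers the
  blocks by \<open>i\<close>; the bounds on \<open>k\<close> keep the origin inside the new block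
  0.\<close>

lemma desub_shift:
  assumes "desub x y c" "0 \<le> k" "k < c (i + 1) - c i"
  shows "desub (shift_by (c i + k) x) (shift_by i y) (\<lambda>t. c (t + i) - c i - k)"
proof -
  have c: "cut_enum (cuts x) c" using assms by (simp add: desub_def)
  have cuts: "z \<in> cuts (shift_by (c i + k) x) \<longleftrightarrow> z + c i + k \<in> cuts x" for z
    by (simp add: cuts_def algebra_simps)
  have "cut_enum (cuts (shift_by (c i + k) x)) (\<lambda>t. c (t + i) - c i - k)"
    unfolding cut_enum_def cuts
  proof (intro conjI allI impI)
    fix j
    show "c (j + i) - c i - k + c i + k \<in> cuts x"
      using c by (simp add: cut_enum_def)
    have shift: "c (j + 1 + i) = c ((j + i) + 1)" by (simp add: algebra_simps)
    then show "c (j + i) - c i - k < c (j + 1 + i) - c i - k"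
      using cut_enum_gap(1)[OF c, of "j + i"] by simp
    fix z assume "c (j + i) - c i - k < z \<and> z < c (j + 1 + i) - c i - k"
    then show "z + c i + k \<notin> cuts x"
      using cut_enum_gap(4)[OF c, of "j + i" "z + c i + k"] shift by simp
  qed (use assms in \<open>auto simp: algebra_simps\<close>)
  moreover have "shift_by i y t \<in> B \<and> \<sigma> (shift_by i y t) = subword (shift_by (c i + k) x)
      (c (t + i) - c i - k) (nat (c (t + 1 + i) - c i - k - (c (t + i) - c i - k)))" for t
    using assms(1) by (simp add: desub_def algebra_simps)
  ultimately show ?thesis by (simp add: desub_def)
qed

lemma desub_local:
  assumes "desub x y c"
  shows "\<exists>m'. \<forall>x' y' c'. desub x' y' c' \<longrightarrow> agree m' x x' \<longrightarrow> agree m y y' \<and> c' 0 = c 0"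
proof -
  define M where "M = nat m"
  \<comment> \<open>The window covers all coordinates from \<open>c (- M) - 1\<close> to
    \<open>c (M + 1)\<close>; the extra 1 is there because a cut is detected from the letter to its
    left as well.\<close>
  define m' where "m' = \<bar>c (- int M)\<bar> + \<bar>c (int M + 1)\<bar> + 1"
  have c: "cut_enum (cuts x) c" using assms by (simp add: desub_def)
  have "agree m y y' \<and> c' 0 = c 0" if d': "desub x' y' c'" and ag: "agree m' x x'" for x' y' c'
  proof -
    have c': "cut_enum (cuts x') c'" using d' by (simp add: desub_def)
    have same: "x' z = x z" if "c (- int M) - 1 \<le> z" "z \<le> c (int M + 1)" for z
      using ag that unfolding agree_def m'_def by auto
    have eq: "c' i = c i" if "- int M \<le> i" "i \<le> int M + 1" for i
      by (rule cut_enum_local[OF c c' _ that]) (simp add: cuts_def same)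
    have "y i = y' i" if i: "\<bar>i\<bar> \<le> m" for i
    proof -
      have i': "- int M \<le> i" "i \<le> int M" using i by (auto simp: M_def)
      have "subword x' (c' i) (nat (c' (i + 1) - c' i)) = subword x (c i) (nat (c (i + 1) - c i))"
      proof (rule subword_cong[THEN trans])
        show "x' (c' i + int k) = x (c i + int k)" if "k < nat (c' (i + 1) - c' i)" for k
          using that i' eq[of i] eq[of "i + 1"] cut_enum_mono[OF c, of "- int M" i]
            cut_enum_mono[OF c, of "i + 1" "int M + 1"] same[of "c i + int k"] by simp
      qed (use i' eq[of i] eq[of "i + 1"] in simp)
      then show ?thesis using assms d' sigma_inj unfolding desub_def by metis
    qed
    then show ?thesis using eq[of 0] by (auto simp: agree_def)
  qed
  then show ?thesis by blast
qed

lemma ex_desubst_maps: "\<exists>D K. desubst_maps X Y \<sigma> D K"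
proof -
  \<comment> \<open>Choice gives total functions, and on \<open>X\<close> uniqueness of the
    desubstitution determines them. \<open>K\<close> is the distance from the start of block 0 to
    the origin.\<close>
  define D where "D x = (SOME y. \<exists>c. desub x y c)" for x
  define c where "c x = (SOME c. desub x (D x) c)" for x
  define K where "K x = nat (- c x 0)" for x
  have d: "desub x (D x) (c x)" if "x \<in> X" for x
  proof -
    have "\<exists>c. desub x (D x) c" unfolding D_def by (rule someI_ex[OF ex_desub[OF that]])
    then show ?thesis unfolding c_def by (rule someI_ex)
  qed
  have eqs: "D x = y" "K x = nat (- c' 0)" if "x \<in> X" "desub x y c'" for x y c'
    using desub_unique[OF d[OF that(1)] that(2)] by (auto simp: K_def)
  have "desubst_maps X Y \<sigma> D K"
    unfolding desubst_maps_def
  proof (intro ballI conjI)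
    fix x assume x: "x \<in> X"
    let ?y = "D x" and ?c = "c x"
    note dx = d[OF x]
    have c: "cut_enum (cuts x) ?c" using dx by (simp add: desub_def)
    have len: "length (\<sigma> (?y i)) = nat (?c (i + 1) - ?c i)" for i
      using dx by (simp add: desub_def)
    have K: "int (K x) = - ?c 0" "0 < ?c 1" using c by (auto simp: cut_enum_def K_def)
    show "?y \<in> Y" using desub_mem[OF x dx] .
    show Klt: "K x < length (\<sigma> (?y 0))" using K len[of 0] by (simp add: zless_nat_eq_int_zless)
    have "\<sigma> (?y 0) = subword x (?c 0) (length (\<sigma> (?y 0)))"
      using dx by (simp add: desub_def)
    then have "\<sigma> (?y 0) ! K x = subword x (?c 0) (length (\<sigma> (?y 0))) ! K x" by simp
    also have "\<dots> = x 0" using Klt K by simp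
    finally show "\<sigma> (?y 0) ! K x = x 0" .
    have sh: "D (shift_by (?c i + int k) x) = shift_by i ?y \<and> K (shift_by (?c i + int k) x) = k"
      if "k < length (\<sigma> (?y i))" for i k
    proof -
      have "desub (shift_by (?c i + int k) x) (shift_by i ?y) (\<lambda>t. ?c (t + i) - ?c i - int k)"
        using that len[of i] by (intro desub_shift[OF dx]) auto
      from eqs[OF shift_invariant[OF x] this] show ?thesis by simp
    qed
    show "\<forall>i. \<forall>k<length (\<sigma> (?y i)).
        \<exists>j. D (shift_by j x) = shift_by i ?y \<and> K (shift_by j x) = k"
      using sh by blast
    \<comment> \<open>A shift by one brings the origin to position \<open>K x + 1\<close> of block
      0, or to position 0 of block 1 if block 0 is exhausted.\<close>
    show "if Suc (K x) < length (\<sigma> (?y 0))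
      then D (shift_by 1 x) = ?y \<and> K (shift_by 1 x) = Suc (K x)
      else D (shift_by 1 x) = shift_by 1 ?y \<and> K (shift_by 1 x) = 0"
    proof (cases "Suc (K x) < length (\<sigma> (?y 0))")
      case True
      moreover have "?c 0 + int (Suc (K x)) = 1" using K by simp
      ultimately show ?thesis using sh[of "Suc (K x)" 0] by (simp only: shift_by_0 if_True)
    next
      case False
      then have "?c 1 + int 0 = 1" using K len[of 0] by auto
      moreover have "0 < length (\<sigma> (?y 1))" using len[of 1] cut_enum_gap(1)[OF c, of 1] by simp
      ultimately show ?thesis using sh[of 0 1] False by (simp only: if_False)
    qed
    show "\<forall>m. \<exists>m'. \<forall>x'\<in>X. agree m' x x' \<longrightarrow> agree m ?y (D x') \<and> K x = K x'"
    proof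
      fix m
      obtain m' where m': "\<And>x' y' c'. desub x' y' c' \<Longrightarrow> agree m' x x' \<Longrightarrow> agree m ?y y' \<and> c' 0 = ?c 0"
        using desub_local[OF dx] by blast
      show "\<exists>m'. \<forall>x'\<in>X. agree m' x x' \<longrightarrow> agree m ?y (D x') \<and> K x = K x'"
        using m'[OF d] by (intro exI[of _ m']) (auto simp: K_def)
    qed
  qed
  then show ?thesis by blast
qed

end

section \<open>Path spaces\<close>

lemma cylinder_recenter: "y \<in> cylinder D x n \<Longrightarrow> cylinder D y n = cylinder D x n"
  by (auto simp: cylinder_def)

lemma cylinder_subset_inf_paths: "cylinder D x n \<subseteq> inf_paths D"
  by (auto simp: cylinder_def)

text \<open>Cylinders around a common path are nested, so finite intersections give nothing new and
  the generating sets form a base.\<close>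

lemma openin_path_topology_iff:
  "openin (path_topology D) S \<longleftrightarrow>
     S \<subseteq> inf_paths D \<and> (\<forall>x\<in>S. \<exists>n. cylinder D x n \<subseteq> S)" (is "_ \<longleftrightarrow> ?R S")
proof
  assume "openin (path_topology D) S"
  then have "generate_topology_on {cylinder D x n | x n. x \<in> inf_paths D} S"
    unfolding path_topology_def openin_topology_generated_by_iff .
  then show "?R S"
  proof (induction rule: generate_topology_on.induct)
    case (Int a b)
    show ?case
    proof (intro conjI ballI)
      fix x assume "x \<in> a \<inter> b"
      then obtain n n' where "cylinder D x n \<subseteq> a" "cylinder D x n' \<subseteq> b" using Int.IH by blast
      then have "cylinder D x (max n n') \<subseteq> a \<inter> b" by (fastforce simp: cylinder_def)
      then show "\<exists>n. cylinder D x n \<subseteq> a \<inter> b" by blast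
    qed (use Int.IH in blast)
  next
    case (UN C)
    then show ?case by (meson Sup_upper Union_iff Union_least subset_trans)
  next
    case (Basis s)
    then obtain x n where s: "s = cylinder D x n" by blast
    then show ?case using cylinder_recenter[of _ D x n] cylinder_subset_inf_paths by blast
  qed simp
next
  assume R: "?R S"
  define C where "C = {cylinder D x n | x n. x \<in> S \<and> cylinder D x n \<subseteq> S}"
  have "S = \<Union>C"
  proof
    show "S \<subseteq> \<Union>C"
    proof
      fix x assume x: "x \<in> S"
      then obtain n where "cylinder D x n \<subseteq> S" using R by blast
      moreover have "x \<in> cylinder D x n" using x R by (auto simp: cylinder_def)
      ultimately show "x \<in> \<Union>C" using x unfolding C_def by blast
    qed
  qed (auto simp: C_def)
  moreover have "openin (path_topology D) (\<Union>C)"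
    unfolding path_topology_def using R
    by (intro openin_Union) (auto simp: C_def intro!: topology_generated_by_Basis)
  ultimately show "openin (path_topology D) S" by simp
qed

lemma topspace_path_topology [simp]: "topspace (path_topology D) = inf_paths D"
proof
  show "topspace (path_topology D) \<subseteq> inf_paths D"
    using openin_topspace[of "path_topology D"] unfolding openin_path_topology_iff by blast
  have "openin (path_topology D) (inf_paths D)"
    unfolding openin_path_topology_iff by (auto simp: cylinder_def)
  then show "inf_paths D \<subseteq> topspace (path_topology D)" by (rule openin_subset)
qed

lemma openin_cylinder: "openin (path_topology D) (cylinder D x n)"
  unfolding openin_path_topology_iff using cylinder_recenter[of _ D x n] cylinder_subset_inf_paths
  by blast

lemma Hausdorff_path_topology: "Hausdorff_space (path_topology D)"
  unfolding Hausdorff_space_def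
proof (intro allI impI)
  fix x y assume xy: "x \<in> topspace (path_topology D) \<and> y \<in> topspace (path_topology D) \<and> x \<noteq> y"
  then obtain n where n: "x n \<noteq> y n" by blast
  have "disjnt (cylinder D x (Suc n)) (cylinder D y (Suc n))"
    using n by (auto simp: disjnt_def cylinder_def)
  moreover have "x \<in> cylinder D x (Suc n)" "y \<in> cylinder D y (Suc n)"
    using xy by (auto simp: cylinder_def)
  ultimately show "\<exists>U V. openin (path_topology D) U \<and> openin (path_topology D) V \<and>
      x \<in> U \<and> y \<in> V \<and> disjnt U V"
    using openin_cylinder by blast
qed

text \<open>The level \<open>n\<close> is a parameter, so that uniqueness and transport can be
  stated without the description operator in \<open>path_succ\<close>.\<close>

definition path_succ_pred ::
  "('v, 'e) ordered_diagram \<Rightarrow> nat \<Rightarrow> (nat \<Rightarrow> 'e) \<Rightarrow> (nat \<Rightarrow> 'e) \<Rightarrow> bool" where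
  "path_succ_pred D n p q \<longleftrightarrow> q \<in> inf_paths D \<and> (\<forall>i>n. q i = p i) \<and>
     edge_succ D n (p n) (q n) \<and> (\<forall>i<n. min_edge D i (q i))"

lemma path_succ_eq_The:
  "path_succ D p = (THE q. path_succ_pred D (LEAST n. \<not> max_edge D n (p n)) p q)"
  by (simp add: path_succ_def path_succ_pred_def Let_def)

section \<open>The Vershik map of the natural diagram\<close>

definition in_degree :: "(nat \<Rightarrow> 'a \<Rightarrow> 'a list) \<Rightarrow> nat \<Rightarrow> 'a \<Rightarrow> nat" where
  "in_degree \<sigma> n a = (case n of 0 \<Rightarrow> 1 | Suc m \<Rightarrow> length (\<sigma> m a))"

context
  fixes Al :: "nat \<Rightarrow> 'a set" and \<sigma> :: "nat \<Rightarrow> 'a \<Rightarrow> 'a list"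
begin

abbreviation (input) "ND \<equiv> natural_diagram Al \<sigma>"

lemma dverts_natural: "dverts ND 0 = {None}" "dverts ND (Suc m) = Some ` Al m"
  by (simp_all add: natural_diagram_def Let_def)

lemma mem_dedges_natural: "e \<in> dedges ND n \<longleftrightarrow> fst e \<in> Al n \<and> snd e < in_degree \<sigma> n (fst e)"
  by (cases e; cases n) (auto simp: natural_diagram_def Let_def in_degree_def)

lemma dsrc_natural: "dsrc ND 0 e = None" "dsrc ND (Suc m) e = Some (\<sigma> m (fst e) ! snd e)"
  by (simp_all add: natural_diagram_def Let_def split: prod.splits)

lemma drng_natural: "drng ND n e = Some (fst e)"
  by (simp add: natural_diagram_def Let_def split: prod.splits)

lemma mem_dord_natural: "(e, e') \<in> dord ND n \<longleftrightarrow>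
    e \<in> dedges ND n \<and> e' \<in> dedges ND n \<and> fst e = fst e' \<and> snd e \<le> snd e'"
  by (auto simp: natural_diagram_def Let_def)

lemma mem_inf_paths_natural: "p \<in> inf_paths ND \<longleftrightarrow>
    (\<forall>n. p n \<in> dedges ND n \<and> fst (p n) = \<sigma> n (fst (p (Suc n))) ! snd (p (Suc n)))"
  by (simp add: inf_paths_def dsrc_natural drng_natural)

lemma max_edge_natural:
  "max_edge ND n e \<longleftrightarrow> e \<in> dedges ND n \<and> Suc (snd e) = in_degree \<sigma> n (fst e)"
proof
  assume e: "max_edge ND n e"
  let ?e = "(fst e, in_degree \<sigma> n (fst e) - 1)"
  have "?e \<in> dedges ND n" using e by (auto simp: max_edge_def mem_dedges_natural)
  then have "(?e, e) \<in> dord ND n" using e by (auto simp: max_edge_def drng_natural)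
  then show "e \<in> dedges ND n \<and> Suc (snd e) = in_degree \<sigma> n (fst e)"
    by (auto simp: mem_dord_natural mem_dedges_natural)
qed (auto simp: max_edge_def mem_dord_natural mem_dedges_natural drng_natural)

lemma min_edge_natural: "min_edge ND n e \<longleftrightarrow> e \<in> dedges ND n \<and> snd e = 0"
proof
  assume e: "min_edge ND n e"
  have "(fst e, 0) \<in> dedges ND n" using e by (auto simp: min_edge_def mem_dedges_natural)
  then have "(e, (fst e, 0)) \<in> dord ND n" using e by (auto simp: min_edge_def drng_natural)
  then show "e \<in> dedges ND n \<and> snd e = 0" by (auto simp: mem_dord_natural)
qed (auto simp: min_edge_def mem_dord_natural drng_natural)

lemma edge_succ_natural: "edge_succ ND n e e' \<longleftrightarrow>
    e \<in> dedges ND n \<and> e' \<in> dedges ND n \<and> e' = (fst e, Suc (snd e))"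
proof
  assume s: "edge_succ ND n e e'"
  then have e: "e \<in> dedges ND n" "e' \<in> dedges ND n" "fst e = fst e'" "snd e < snd e'"
    by (auto simp: edge_succ_def mem_dord_natural prod_eq_iff)
  \<comment> \<open>The next label is available because \<open>e'\<close> has a larger one;
    minimality of the successor then forces \<open>e'\<close> to carry exactly that label.\<close>
  let ?f = "(fst e, Suc (snd e))"
  have "?f \<noteq> e" by (metis n_not_Suc_n snd_conv)
  moreover have "(e, ?f) \<in> dord ND n" using e by (auto simp: mem_dord_natural mem_dedges_natural)
  ultimately have "(e', ?f) \<in> dord ND n" using s by (auto simp: edge_succ_def)
  then show "e \<in> dedges ND n \<and> e' \<in> dedges ND n \<and> e' = (fst e, Suc (snd e))"
    using e by (auto simp: mem_dord_natural prod_eq_iff)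
next
  assume "e \<in> dedges ND n \<and> e' \<in> dedges ND n \<and> e' = (fst e, Suc (snd e))"
  then show "edge_succ ND n e e'"
    by (auto simp: edge_succ_def mem_dord_natural prod_eq_iff)
qed

text \<open>The source of an edge is the range of the edge before it, so going from a common tail
  towards the top only labels have to be compared.\<close>

lemma inf_paths_natural_eqI:
  assumes "p \<in> inf_paths ND" "q \<in> inf_paths ND" "\<And>i. n \<le> i \<Longrightarrow> p i = q i"
    and "\<And>i. i < n \<Longrightarrow> fst (p i) = fst (q i) \<Longrightarrow> snd (p i) = snd (q i)"
  shows "p = q"
proof -
  have "p (n - d) = q (n - d)" for d
  proof (induction d)
    case (Suc d)
    show ?case
    proof (cases "d < n")
      case True
      then have S: "n - d = Suc (n - Suc d)" by simp
      have "fst (p (n - Suc d)) = fst (q (n - Suc d))"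
        using assms(1,2) Suc unfolding S mem_inf_paths_natural by metis
      then show ?thesis using assms(4)[of "n - Suc d"] True by (simp add: prod_eq_iff)
    qed (use Suc in simp)
  qed (use assms(3) in simp)
  then have "p i = q i" if "i < n" for i
    by (metis diff_diff_cancel less_imp_le that)
  then show ?thesis using assms(3) by (metis ext not_le)
qed

text \<open>The Vershik rule as a relation, free of \<open>LEAST\<close> and \<open>THE\<close>. It
  can be read from \<open>q\<close> as well as from \<open>p\<close>, which is how injectivity is
  obtained.\<close>

definition vershik_rel :: "(nat \<Rightarrow> 'a \<times> nat) \<Rightarrow> (nat \<Rightarrow> 'a \<times> nat) \<Rightarrow> bool" where
  "vershik_rel p q \<longleftrightarrow> p \<in> inf_paths ND \<and> q \<in> inf_paths ND \<and>
     ((\<forall>i. max_edge ND i (p i)) \<and> (\<forall>i. min_edge ND i (q i)) \<or>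
      (\<exists>n. (\<forall>i<n. max_edge ND i (p i)) \<and> \<not> max_edge ND n (p n) \<and>
           (\<forall>i<n. min_edge ND i (q i)) \<and> edge_succ ND n (p n) (q n) \<and> (\<forall>i>n. q i = p i)))"

lemma path_succ_natural_unique:
  assumes "path_succ_pred ND n p q" "path_succ_pred ND n p q'"
  shows "q' = q"
proof (rule inf_paths_natural_eqI[where n = n])
  fix i assume "n \<le> i"
  then show "q' i = q i"
    using assms by (cases "i = n") (auto simp: path_succ_pred_def edge_succ_natural)
qed (use assms in \<open>auto simp: path_succ_pred_def min_edge_natural\<close>)

lemma vershik_rel_path_succ:
  assumes "vershik_rel p q" "\<not> max_path ND p"
  shows "path_succ_pred ND (LEAST n. \<not> max_edge ND n (p n)) p q"
proof -
  obtain n where n: "\<forall>i<n. max_edge ND i (p i)" "\<not> max_edge ND n (p n)" "path_succ_pred ND n p q"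
    using assms by (auto simp: vershik_rel_def max_path_def path_succ_pred_def)
  have "(LEAST n. \<not> max_edge ND n (p n)) = n"
    using n(1,2) by (intro Least_equality) (auto simp: not_less[symmetric])
  then show ?thesis using n(3) by simp
qed

lemma vershik_eqI:
  assumes "vershik_rel p q" "\<exists>!q. min_path ND q"
  shows "vershik ND p = q"
proof (cases "max_path ND p")
  case True
  then have "min_path ND q"
    using assms(1) by (auto simp: vershik_rel_def min_path_def max_path_def)
  then show ?thesis using True assms(2) by (auto simp: vershik_def intro: the1_equality)
next
  case False
  have "path_succ ND p = q"
    unfolding path_succ_eq_The
    using vershik_rel_path_succ[OF assms(1) False] path_succ_natural_unique
    by (intro the_equality) blast+
  then show ?thesis using False by (simp add: vershik_def)
qed

text \<open>The level of the change is visible in \<open>q\<close> as its first non-minimal edge;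
  before it the labels of \<open>p\<close> are maximal, and after it \<open>p\<close> equals
  \<open>q\<close>. If \<open>q\<close> is minimal everywhere, only the unique maximal path precedes
  it.\<close>

lemma vershik_rel_inj:
  assumes "vershik_rel p q" "vershik_rel p' q" "\<exists>!p. max_path ND p"
  shows "p = p'"
proof -
  have paths: "p \<in> inf_paths ND" "p' \<in> inf_paths ND" using assms(1,2) by (auto simp: vershik_rel_def)
  show ?thesis
  proof (cases "\<forall>i. min_edge ND i (q i)")
    case True
    then have "snd (q n) = 0" for n by (simp add: min_edge_natural)
    then have "\<not> edge_succ ND n e (q n)" for n e
      unfolding edge_succ_natural by (metis nat.distinct(1) snd_conv)
    then have "max_path ND p" "max_path ND p'"
      using assms(1,2) by (auto simp: vershik_rel_def max_path_def)
    then show ?thesis using assms(3) by blast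
  next
    case False
    then obtain n n' where n: "\<forall>i<n. max_edge ND i (p i)" "\<forall>i<n. min_edge ND i (q i)"
        "edge_succ ND n (p n) (q n)" "\<forall>i>n. q i = p i"
      and n': "\<forall>i<n'. max_edge ND i (p' i)" "\<forall>i<n'. min_edge ND i (q i)"
        "edge_succ ND n' (p' n') (q n')" "\<forall>i>n'. q i = p' i"
      using assms(1,2) unfolding vershik_rel_def by blast
    have "\<not> min_edge ND n (q n)" "\<not> min_edge ND n' (q n')"
      using n(3) n'(3) by (auto simp: edge_succ_natural min_edge_natural)
    then have [simp]: "n' = n" using n(2) n'(2) by (metis linorder_neqE_nat)
    show ?thesis
    proof (rule inf_paths_natural_eqI[OF paths, where n = n])
      fix i assume "n \<le> i"
      then show "p i = p' i"
        using n(3,4) n'(3,4) by (cases "i = n") (auto simp: edge_succ_natural prod_eq_iff)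
    next
      fix i assume i: "i < n" "fst (p i) = fst (p' i)"
      then have "Suc (snd (p i)) = in_degree \<sigma> i (fst (p i))" "Suc (snd (p' i)) = in_degree \<sigma> i (fst (p' i))"
        using n(1) n'(1) by (simp_all add: max_edge_natural)
      then show "snd (p i) = snd (p' i)" using i(2) by simp
    qed
  qed
qed

end

section \<open>Towers of desubstitutions\<close>

lemma openin_subshift:
  assumes "X \<subseteq> topspace (full_shift A)"
  shows "openin (subtopology (full_shift A) X) V \<longleftrightarrow>
    V \<subseteq> X \<and> (\<forall>x\<in>V. \<exists>m. \<forall>x'\<in>X. agree m x x' \<longrightarrow> x' \<in> V)" (is "_ \<longleftrightarrow> ?R")
proof
  assume "openin (subtopology (full_shift A) X) V"
  then obtain W where W: "openin (full_shift A) W" "V = W \<inter> X" by (auto simp: openin_subtopology)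
  then show ?R using assms unfolding openin_full_shift_iff by blast
next
  assume R: ?R
  \<comment> \<open>\<open>W\<close> is the union of those windows around points of \<open>V\<close>
    whose trace on \<open>X\<close> stays in \<open>V\<close>.\<close>
  define W where "W = {y \<in> topspace (full_shift A).
    \<exists>x\<in>V. \<exists>m. agree m x y \<and> (\<forall>x'\<in>X. agree m x x' \<longrightarrow> x' \<in> V)}"
  have "openin (full_shift A) W"
    unfolding openin_full_shift_iff
  proof (intro conjI ballI)
    fix y assume "y \<in> W"
    then obtain x m where "x \<in> V" "agree m x y" "\<forall>x'\<in>X. agree m x x' \<longrightarrow> x' \<in> V"
      by (auto simp: W_def)
    moreover have "agree m x y'" if "agree m y y'" for y'
      using \<open>agree m x y\<close> that by (simp add: agree_def)
    ultimately show "\<exists>m. \<forall>y'\<in>topspace (full_shift A). agree m y y' \<longrightarrow> y' \<in> W"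
      unfolding W_def by blast
  qed (auto simp: W_def)
  moreover have "V = W \<inter> X"
  proof
    have "agree m x x" for m and x :: "int \<Rightarrow> 'a" by (simp add: agree_def)
    then show "V \<subseteq> W \<inter> X" using R assms unfolding W_def by blast
  qed (auto simp: W_def)
  ultimately show "openin (subtopology (full_shift A) X) V" by (auto simp: openin_subtopology)
qed

lemma continuous_shift_by:
  assumes "X \<subseteq> topspace (full_shift A)" "\<And>x. x \<in> X \<Longrightarrow> shift_by j x \<in> X"
  shows "continuous_map (subtopology (full_shift A) X) (subtopology (full_shift A) X) (shift_by j)"
proof -
  have top: "topspace (subtopology (full_shift A) X) = X" using assms(1) by auto
  show ?thesis
    unfolding continuous_map_def top
  proof (intro conjI allI impI)
    fix U assume "openin (subtopology (full_shift A) X) U"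
    then have U: "\<And>x. x \<in> U \<Longrightarrow> \<exists>m. \<forall>x'\<in>X. agree m x x' \<longrightarrow> x' \<in> U"
      unfolding openin_subshift[OF assms(1)] by blast
    show "openin (subtopology (full_shift A) X) {x \<in> X. shift_by j x \<in> U}"
      unfolding openin_subshift[OF assms(1)]
    proof (intro conjI ballI)
      fix x assume "x \<in> {x \<in> X. shift_by j x \<in> U}"
      then obtain m where m: "\<And>x'. x' \<in> X \<Longrightarrow> agree m (shift_by j x) x' \<Longrightarrow> x' \<in> U"
        using U by blast
      have "agree m (shift_by j x) (shift_by j x')" if "agree (m + \<bar>j\<bar>) x x'" for x'
        using that by (auto simp: agree_def)
      then show "\<exists>m. \<forall>x'\<in>X. agree m x x' \<longrightarrow> x' \<in> {x \<in> X. shift_by j x \<in> U}"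
        using m assms(2) by blast
    qed auto
  qed (use assms(2) in auto)
qed

text \<open>Return words disappear here: the diagram and the coding see them only through these
  properties. The occurrence of each letter in every point of its level serves the density of the
  coded points; the common first and last letters serve the extremal paths.\<close>

locale desubst_tower =
  fixes A :: "'a set" and Xs :: "nat \<Rightarrow> (int \<Rightarrow> 'a) set" and Al :: "nat \<Rightarrow> 'a set"
    and \<sigma> :: "nat \<Rightarrow> 'a \<Rightarrow> 'a list" and l r :: "nat \<Rightarrow> 'a"
    and D :: "nat \<Rightarrow> (int \<Rightarrow> 'a) \<Rightarrow> int \<Rightarrow> 'a" and K :: "nat \<Rightarrow> (int \<Rightarrow> 'a) \<Rightarrow> nat"
  assumes maps: "desubst_maps (Xs n) (Xs (Suc n)) (\<sigma> n) (D n) (K n)"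
    and shift_mem: "x \<in> Xs n \<Longrightarrow> shift_by j x \<in> Xs n"
    and finite_letters: "finite (Al n)"
    and letter_mem: "x \<in> Xs n \<Longrightarrow> x i \<in> Al n"
    and letter_occurs: "a \<in> Al n \<Longrightarrow> x \<in> Xs n \<Longrightarrow> \<exists>i. x i = a"
    and boundary_letters: "l n \<in> Al n" "r n \<in> Al n"
    and proper: "b \<in> Al (Suc n) \<Longrightarrow> \<sigma> n b \<noteq> [] \<and> hd (\<sigma> n b) = r n \<and> last (\<sigma> n b) = l n"
    and finite_A: "finite A"
    and closed: "closedin (full_shift A) (Xs 0)"
    and nonempty: "Xs 0 \<noteq> {}"
begin

abbreviation (input) "BD \<equiv> natural_diagram Al \<sigma>"

lemma D_mem: "x \<in> Xs n \<Longrightarrow> D n x \<in> Xs (Suc n)"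
  and K_less: "x \<in> Xs n \<Longrightarrow> K n x < length (\<sigma> n (D n x 0))"
  and sigma_nth_K: "x \<in> Xs n \<Longrightarrow> \<sigma> n (D n x 0) ! K n x = x 0"
  and desubst_hit: "x \<in> Xs n \<Longrightarrow> k < length (\<sigma> n (D n x i)) \<Longrightarrow>
    \<exists>j. D n (shift_by j x) = shift_by i (D n x) \<and> K n (shift_by j x) = k"
  and desubst_shift_inner: "x \<in> Xs n \<Longrightarrow> Suc (K n x) < length (\<sigma> n (D n x 0)) \<Longrightarrow>
    D n (shift_by 1 x) = D n x \<and> K n (shift_by 1 x) = Suc (K n x)"
  and desubst_shift_end: "x \<in> Xs n \<Longrightarrow> \<not> Suc (K n x) < length (\<sigma> n (D n x 0)) \<Longrightarrow>
    D n (shift_by 1 x) = shift_by 1 (D n x) \<and> K n (shift_by 1 x) = 0"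
  and desubst_local: "x \<in> Xs n \<Longrightarrow>
    \<exists>m'. \<forall>x'\<in>Xs n. agree m' x x' \<longrightarrow> agree m (D n x) (D n x') \<and> K n x = K n x'"
  using maps[of n] unfolding desubst_maps_def by (auto split: if_splits)

primrec level :: "nat \<Rightarrow> (int \<Rightarrow> 'a) \<Rightarrow> int \<Rightarrow> 'a" where
  "level 0 x = x"
| "level (Suc n) x = D n (level n x)"

lemma level_mem: "x \<in> Xs 0 \<Longrightarrow> level n x \<in> Xs n"
  by (induction n) (auto intro: D_mem)

definition path_of :: "(int \<Rightarrow> 'a) \<Rightarrow> nat \<Rightarrow> 'a \<times> nat" where
  "path_of x n = (case n of 0 \<Rightarrow> (x 0, 0) | Suc m \<Rightarrow> (level n x 0, K m (level m x)))"

lemma path_of_simps: "path_of x 0 = (x 0, 0)" "path_of x (Suc m) = (level (Suc m) x 0, K m (level m x))"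
  by (simp_all add: path_of_def)

lemma fst_path_of: "fst (path_of x n) = level n x 0"
  by (cases n) (auto simp: path_of_simps)

lemma path_of_mem:
  assumes x: "x \<in> Xs 0"
  shows "path_of x \<in> inf_paths BD"
  unfolding mem_inf_paths_natural
proof (intro allI conjI)
  fix n
  have "fst (path_of x n) \<in> Al n" unfolding fst_path_of by (rule letter_mem[OF level_mem[OF x]])
  then show "path_of x n \<in> dedges BD n"
    using K_less[OF level_mem[OF x], of "n - 1"]
    by (cases n) (auto simp: mem_dedges_natural path_of_simps in_degree_def)
  show "fst (path_of x n) = \<sigma> n (fst (path_of x (Suc n))) ! snd (path_of x (Suc n))"
    using sigma_nth_K[OF level_mem[OF x], of n] by (simp add: fst_path_of path_of_simps)
qed

lemma Xs_nonempty: "Xs n \<noteq> {}"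
  using nonempty level_mem by blast

text \<open>The letters of \<open>\<sigma> n b\<close> are found in actual points: \<open>b\<close>
  occurs in a desubstituted point, and each position of its block can be moved to the
  origin.\<close>

lemma sigma_letters:
  assumes b: "b \<in> Al (Suc n)" and k: "k < length (\<sigma> n b)"
  shows "\<sigma> n b ! k \<in> Al n"
proof -
  obtain x where x: "x \<in> Xs n" using Xs_nonempty by blast
  obtain i where i: "D n x i = b" using letter_occurs[OF b D_mem[OF x]] by blast
  obtain j where j: "D n (shift_by j x) = shift_by i (D n x)" "K n (shift_by j x) = k"
    using desubst_hit[OF x, of k i] k i by blast
  have "\<sigma> n b ! k = shift_by j x 0"
    using sigma_nth_K[OF shift_mem[OF x], of j] j i by simp
  then show ?thesis using letter_mem[OF shift_mem[OF x, of j], of 0] by simp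
qed

lemma letter_in_image:
  assumes "a \<in> Al n"
  shows "\<exists>b\<in>Al (Suc n). \<exists>k<length (\<sigma> n b). \<sigma> n b ! k = a"
proof -
  obtain x where x: "x \<in> Xs n" using Xs_nonempty by blast
  obtain i where i: "x i = a" using letter_occurs[OF assms x] by blast
  let ?x = "shift_by i x"
  have "?x \<in> Xs n" using shift_mem[OF x] .
  then show ?thesis
    using sigma_nth_K[of ?x n] K_less[of ?x n] letter_mem[OF D_mem, of ?x n 0] i by auto
qed

section \<open>The axioms of an ordered Bratteli diagram\<close>

lemma ordered_bratteli_BD: "ordered_bratteli BD"
  unfolding ordered_bratteli_def
proof (intro conjI allI ballI)
  fix n
  show "finite (dverts BD n)" "dverts BD n \<noteq> {}"
    using finite_letters boundary_letters by (cases n; auto simp: dverts_natural)+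
  have "dedges BD n \<subseteq> (\<lambda>(a, k). (a, k)) ` (SIGMA a:Al n. {..<in_degree \<sigma> n a})"
    by (force simp: mem_dedges_natural)
  moreover have "finite (SIGMA a:Al n. {..<in_degree \<sigma> n a})"
    using finite_letters by (intro finite_SigmaI) auto
  ultimately show "finite (dedges BD n)" using finite_surj by blast
next
  fix n e assume e: "e \<in> dedges BD n"
  show "dsrc BD n e \<in> dverts BD n"
    using e sigma_letters
    by (cases n) (auto simp: dverts_natural dsrc_natural mem_dedges_natural in_degree_def)
  show "drng BD n e \<in> dverts BD (Suc n)"
    using e by (auto simp: dverts_natural drng_natural mem_dedges_natural)
next
  fix n v assume v: "v \<in> dverts BD n"
  show "\<exists>e\<in>dedges BD n. dsrc BD n e = v"
  proof (cases n)
    case 0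
    then show ?thesis
      using v boundary_letters(1)[of 0]
      by (intro bexI[of _ "(l 0, 0)"]) (auto simp: dverts_natural dsrc_natural mem_dedges_natural in_degree_def)
  next
    case (Suc m)
    then obtain a where "a \<in> Al m" "v = Some a" using v by (auto simp: dverts_natural)
    moreover obtain b k where "b \<in> Al (Suc m)" "k < length (\<sigma> m b)" "\<sigma> m b ! k = a"
      using letter_in_image \<open>a \<in> Al m\<close> by blast
    ultimately show ?thesis
      using Suc by (intro bexI[of _ "(b, k)"]) (auto simp: dsrc_natural mem_dedges_natural in_degree_def)
  qed
next
  fix n v assume "v \<in> dverts BD (Suc n)"
  then obtain a where a: "a \<in> Al n" "v = Some a" by (auto simp: dverts_natural)
  then have "(a, 0) \<in> dedges BD n"
    using proper[of a] by (cases n) (auto simp: mem_dedges_natural in_degree_def)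
  then show "\<exists>e\<in>dedges BD n. drng BD n e = v"
    using a by (intro bexI[of _ "(a, 0)"]) (auto simp: drng_natural)
next
  fix n
  show "dord BD n \<subseteq> {(e, e'). e \<in> dedges BD n \<and> e' \<in> dedges BD n \<and> drng BD n e = drng BD n e'}"
    by (auto simp: mem_dord_natural drng_natural)
next
  fix n v assume "v \<in> dverts BD (Suc n)"
  show "linear_order_on {e \<in> dedges BD n. drng BD n e = v}
      (Restr (dord BD n) {e \<in> dedges BD n. drng BD n e = v})"
    unfolding linear_order_on_def partial_order_on_def preorder_on_def refl_on_def trans_def
      antisym_def total_on_def
    by (auto simp: mem_dord_natural drng_natural)
qed (auto simp: dverts_natural)

section \<open>The shift acts on codes by the Vershik rule\<close>

lemma max_edge_level:
  assumes x: "x \<in> Xs 0"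
  shows "max_edge BD (Suc m) (path_of x (Suc m)) \<longleftrightarrow>
     \<not> Suc (K m (level m x)) < length (\<sigma> m (level (Suc m) x 0))"
proof -
  have "path_of x (Suc m) \<in> dedges BD (Suc m)"
    using path_of_mem[OF x] by (simp add: mem_inf_paths_natural)
  then show ?thesis
    using K_less[OF level_mem[OF x], of m] by (auto simp: max_edge_natural path_of_simps in_degree_def)
qed

text \<open>A carry as in an odometer: if the origin sits at the end of its block, the step to the
  right enters the next block and is a step at the next level too.\<close>

lemma level_shift_max:
  assumes x: "x \<in> Xs 0" and "\<And>i. 0 < i \<Longrightarrow> i \<le> n \<Longrightarrow> max_edge BD i (path_of x i)"
  shows "level n (shift_by 1 x) = shift_by 1 (level n x) \<and>
    (\<forall>i\<le>n. snd (path_of (shift_by 1 x) i) = 0)"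
  using assms(2)
proof (induction n)
  case (Suc n)
  have IH: "level n (shift_by 1 x) = shift_by 1 (level n x)"
    "\<forall>i\<le>n. snd (path_of (shift_by 1 x) i) = 0" using Suc by (auto simp del: shift_by_apply)
  have "\<not> Suc (K n (level n x)) < length (\<sigma> n (D n (level n x) 0))"
    using Suc.prems[of "Suc n"] max_edge_level[OF x] by simp
  from desubst_shift_end[OF level_mem[OF x] this] show ?case
    using IH by (auto simp: path_of_simps le_Suc_eq simp del: shift_by_apply)
qed (simp add: path_of_simps)

lemma vershik_rel_path_of:
  assumes x: "x \<in> Xs 0"
  shows "vershik_rel Al \<sigma> (path_of x) (path_of (shift_by 1 x))"
proof -
  let ?x = "shift_by 1 x"
  have p: "path_of x \<in> inf_paths BD" and q: "path_of ?x \<in> inf_paths BD"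
    using path_of_mem x shift_mem by blast+
  have edge: "path_of ?x i \<in> dedges BD i" for i using q by (simp add: mem_inf_paths_natural)
  show ?thesis
  proof (cases "\<forall>i. max_edge BD i (path_of x i)")
    case True
    then have "snd (path_of ?x i) = 0" for i using level_shift_max[OF x, of i] by blast
    then have "\<forall>i. min_edge BD i (path_of ?x i)" using edge by (auto simp: min_edge_natural)
    then show ?thesis using p q True by (simp add: vershik_rel_def)
  next
    case False
    define n where "n = (LEAST n. \<not> max_edge BD n (path_of x n))"
    have "\<exists>n. \<not> max_edge BD n (path_of x n)" using False by blast
    then have nmax: "\<not> max_edge BD n (path_of x n)" unfolding n_def by (rule LeastI_ex)
    have max: "max_edge BD i (path_of x i)" if "i < n" for i
      using not_less_Least[of i] that unfolding n_def by blast
    \<comment> \<open>A level-0 edge is the only edge into its vertex, so the first non-maximal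
      level is a successor.\<close>
    have "max_edge BD 0 (path_of x 0)"
      using letter_mem[OF x] by (simp add: max_edge_natural mem_dedges_natural path_of_simps in_degree_def)
    then obtain m where m: "n = Suc m" using nmax by (cases n) auto
    have lev: "level m ?x = shift_by 1 (level m x)" "\<forall>i\<le>m. snd (path_of ?x i) = 0"
      using level_shift_max[OF x, of m] max m by auto
    have "Suc (K m (level m x)) < length (\<sigma> m (D m (level m x) 0))"
      using nmax max_edge_level[OF x] m by simp
    from desubst_shift_inner[OF level_mem[OF x] this]
    have step: "level (Suc m) ?x = level (Suc m) x" "K m (level m ?x) = Suc (K m (level m x))"
      using lev by auto
    \<comment> \<open>The carry stops at level \<open>n\<close>: the point there is unchanged, and
      all later levels are computed from it.\<close>
    have "level (n + d) ?x = level (n + d) x" for d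
      by (induction d) (use step m in \<open>auto simp del: shift_by_apply\<close>)
    then have above: "level i ?x = level i x" if "n \<le> i" for i using that le_Suc_ex by blast
    have "path_of ?x i = path_of x i" if "i > n" for i
      using that above[of i] above[of "i - 1"] by (cases i) (auto simp: path_of_simps)
    moreover have "edge_succ BD n (path_of x n) (path_of ?x n)"
    proof -
      have "path_of x n \<in> dedges BD n" using p unfolding mem_inf_paths_natural by blast
      then show ?thesis using edge[of n] step m by (simp add: edge_succ_natural path_of_simps)
    qed
    moreover have "\<forall>i<n. min_edge BD i (path_of ?x i)"
      using lev(2) edge m by (auto simp: min_edge_natural)
    ultimately show ?thesis using p q max nmax unfolding vershik_rel_def by blast
  qed
qed

text \<open>The source of a maximal edge is the last letter of some \<open>\<sigma> n b\<close>,
  which is \<open>l n\<close> for every \<open>b\<close>. The path is therefore explicit, which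
  settles existence together with uniqueness.\<close>

lemma max_path_iff: "max_path BD p \<longleftrightarrow> p = (\<lambda>n. (l n, in_degree \<sigma> n (l n) - 1))"
proof
  assume "max_path BD p"
  then have p: "p \<in> inf_paths BD" and m: "\<And>n. Suc (snd (p n)) = in_degree \<sigma> n (fst (p n))"
    by (auto simp: max_path_def max_edge_natural)
  have "fst (p n) = l n" for n
  proof -
    have "fst (p (Suc n)) \<in> Al (Suc n)" "fst (p n) = \<sigma> n (fst (p (Suc n))) ! snd (p (Suc n))"
      using p unfolding mem_inf_paths_natural mem_dedges_natural by blast+
    moreover have "snd (p (Suc n)) = length (\<sigma> n (fst (p (Suc n)))) - 1"
      using m[of "Suc n"] by (simp add: in_degree_def)
    ultimately show ?thesis using proper[of "fst (p (Suc n))" n] by (metis last_conv_nth)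
  qed
  moreover have "snd (p n) = in_degree \<sigma> n (fst (p n)) - 1" for n using m[of n] by simp
  ultimately show "p = (\<lambda>n. (l n, in_degree \<sigma> n (l n) - 1))" by (auto simp: prod_eq_iff)
next
  assume p: "p = (\<lambda>n. (l n, in_degree \<sigma> n (l n) - 1))"
  have pos: "in_degree \<sigma> n (l n) > 0" for n
    using boundary_letters(1)[of n] proper[of "l n"] by (cases n) (auto simp: in_degree_def)
  have src: "l n = \<sigma> n (l (Suc n)) ! (in_degree \<sigma> (Suc n) (l (Suc n)) - 1)" for n
    using boundary_letters(1)[of "Suc n"] proper[of "l (Suc n)" n]
    by (simp add: in_degree_def) (metis One_nat_def last_conv_nth)
  have "max_edge BD n (p n)" for n
    using pos[of n] boundary_letters by (simp add: p max_edge_natural mem_dedges_natural)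
  moreover have "fst (p n) = \<sigma> n (fst (p (Suc n))) ! snd (p (Suc n))" for n
    unfolding p fst_conv snd_conv by (rule src)
  ultimately show "max_path BD p"
    unfolding max_path_def mem_inf_paths_natural by (blast intro: max_edge_natural[THEN iffD1, THEN conjunct1])
qed

lemma min_path_iff: "min_path BD p \<longleftrightarrow> p = (\<lambda>n. (r n, 0))"
proof
  assume "min_path BD p"
  then have p: "p \<in> inf_paths BD" and m: "\<And>n. snd (p n) = 0"
    by (auto simp: min_path_def min_edge_natural)
  have "fst (p n) = r n" for n
  proof -
    have "fst (p (Suc n)) \<in> Al (Suc n)" "fst (p n) = \<sigma> n (fst (p (Suc n))) ! snd (p (Suc n))"
      using p unfolding mem_inf_paths_natural mem_dedges_natural by blast+
    then show ?thesis using proper[of "fst (p (Suc n))" n] m[of "Suc n"] by (metis hd_conv_nth)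
  qed
  then show "p = (\<lambda>n. (r n, 0))" using m by (auto simp: prod_eq_iff)
next
  assume p: "p = (\<lambda>n. (r n, 0))"
  have pos: "in_degree \<sigma> n (r n) > 0" for n
    using boundary_letters(2)[of n] proper[of "r n"] by (cases n) (auto simp: in_degree_def)
  have src: "r n = \<sigma> n (r (Suc n)) ! 0" for n
    using boundary_letters(2)[of "Suc n"] proper[of "r (Suc n)" n] by (metis hd_conv_nth)
  have "min_edge BD n (p n)" for n
    using pos[of n] boundary_letters by (simp add: p min_edge_natural mem_dedges_natural)
  moreover have "fst (p n) = \<sigma> n (fst (p (Suc n))) ! snd (p (Suc n))" for n
    unfolding p fst_conv snd_conv by (rule src)
  ultimately show "min_path BD p"
    unfolding min_path_def mem_inf_paths_natural by (blast intro: min_edge_natural[THEN iffD1, THEN conjunct1])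
qed

lemma ex1_max_path: "\<exists>!p. max_path BD p" and ex1_min_path: "\<exists>!p. min_path BD p"
  unfolding max_path_iff min_path_iff by simp_all

lemma properly_ordered_BD: "properly_ordered BD"
  using ordered_bratteli_BD ex1_max_path ex1_min_path by (simp add: properly_ordered_def)

lemma vershik_path_of: "x \<in> Xs 0 \<Longrightarrow> vershik BD (path_of x) = path_of (shift_by 1 x)"
  by (rule vershik_eqI[OF vershik_rel_path_of ex1_min_path])

text \<open>The letter at \<open>0\<close> of each shift of \<open>x\<close> is read off a Vershik iterate of \<open>path_of x\<close>, and backward
  iterates are determined because the Vershik rule is injective. No growth of the word lengths is
  needed, so the periodic case is included.\<close>

lemma path_of_inj:
  assumes x: "x \<in> Xs 0" "x' \<in> Xs 0" and eq: "path_of x = path_of x'"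
  shows "x = x'"
proof -
  have pos: "path_of (shift_by (int n) x) = path_of (shift_by (int n) x')" for n
  proof (induction n)
    case (Suc n)
    then show ?case
      using vershik_path_of[OF shift_mem[OF x(1)], of "int n"]
        vershik_path_of[OF shift_mem[OF x(2)], of "int n"] by (simp del: shift_by_apply)
  qed (simp add: eq)
  have neg: "path_of (shift_by (- int n) x) = path_of (shift_by (- int n) x')" for n
  proof (induction n)
    case (Suc n)
    have "vershik_rel Al \<sigma> (path_of (shift_by (- int (Suc n)) z)) (path_of (shift_by (- int n) z))"
      if "z \<in> Xs 0" for z
      using vershik_rel_path_of[OF shift_mem[OF that], of "- int (Suc n)"] by simp
    from this[OF x(1)] this[OF x(2)] show ?case
      using Suc vershik_rel_inj ex1_max_path by metis
  qed (simp add: eq)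
  have "path_of (shift_by i x) = path_of (shift_by i x')" for i
    using pos[of "nat i"] neg[of "nat (- i)"] by (cases "i \<ge> 0") auto
  then have "path_of (shift_by i x) 0 = path_of (shift_by i x') 0" for i by simp
  then show ?thesis by (auto simp: path_of_simps)
qed

text \<open>Every path is approximated along the orbit of a single point, so that images of two-sided
  sequences under the morphisms never have to be constructed.\<close>

lemma path_of_dense:
  assumes x: "x \<in> Xs 0" and p: "p \<in> inf_paths BD"
  shows "level n x i = fst (p n) \<Longrightarrow>
    \<exists>j. level n (shift_by j x) = shift_by i (level n x) \<and> (\<forall>k\<le>n. path_of (shift_by j x) k = p k)"
proof (induction n arbitrary: i)
  case 0
  have "p 0 \<in> dedges BD 0" using p by (simp add: mem_inf_paths_natural)
  then have "snd (p 0) = 0" by (simp add: mem_dedges_natural in_degree_def)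
  then show ?case using 0 by (intro exI[of _ i]) (auto simp: path_of_simps prod_eq_iff)
next
  case (Suc n)
  have "p (Suc n) \<in> dedges BD (Suc n)"
    and src: "fst (p n) = \<sigma> n (fst (p (Suc n))) ! snd (p (Suc n))"
    using p unfolding mem_inf_paths_natural by blast+
  then have len: "snd (p (Suc n)) < length (\<sigma> n (fst (p (Suc n))))"
    by (simp add: mem_dedges_natural in_degree_def)
  obtain i' where i': "D n (shift_by i' (level n x)) = shift_by i (level (Suc n) x)"
      "K n (shift_by i' (level n x)) = snd (p (Suc n))"
    using desubst_hit[OF level_mem[OF x], of "snd (p (Suc n))" n i] len Suc.prems by auto
  have "level n x i' = shift_by i' (level n x) 0" by simp
  also have "\<dots> = \<sigma> n (D n (shift_by i' (level n x)) 0) ! K n (shift_by i' (level n x))"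
    by (rule sigma_nth_K[OF shift_mem[OF level_mem[OF x]], symmetric])
  also have "\<dots> = fst (p n)" using i' src Suc.prems by simp
  finally obtain j where j: "level n (shift_by j x) = shift_by i' (level n x)"
      "\<forall>k\<le>n. path_of (shift_by j x) k = p k"
    using Suc.IH by blast
  have "path_of (shift_by j x) (Suc n) = p (Suc n)"
    using j(1) i' Suc.prems by (simp add: path_of_simps prod_eq_iff)
  then show ?case using j i' by (intro exI[of _ j]) (auto simp: le_Suc_eq simp del: shift_by_apply)
qed

lemma level_local:
  assumes x: "x \<in> Xs 0"
  shows "\<exists>m'. \<forall>x'\<in>Xs 0. agree m' x x' \<longrightarrow>
    agree m (level n x) (level n x') \<and> (\<forall>i\<le>n. path_of x i = path_of x' i)"
proof (induction n arbitrary: m)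
  case 0
  \<comment> \<open>The radius is at least 0, so that the letter at the origin is compared even when
    \<open>m\<close> is negative.\<close>
  show ?case by (intro exI[of _ "max m 0"]) (auto simp: agree_def path_of_simps)
next
  case (Suc n)
  obtain m1 where m1: "\<And>y. y \<in> Xs n \<Longrightarrow> agree m1 (level n x) y \<Longrightarrow>
      agree (max m 0) (level (Suc n) x) (D n y) \<and> K n (level n x) = K n y"
    using desubst_local[OF level_mem[OF x], of n "max m 0"] by auto
  obtain m2 where m2: "\<And>x'. x' \<in> Xs 0 \<Longrightarrow> agree m2 x x' \<Longrightarrow>
      agree m1 (level n x) (level n x') \<and> (\<forall>i\<le>n. path_of x i = path_of x' i)"
    using Suc[of m1] by blast
  have "agree m (level (Suc n) x) (level (Suc n) x') \<and> (\<forall>i\<le>Suc n. path_of x i = path_of x' i)"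
    if x': "x' \<in> Xs 0" "agree m2 x x'" for x'
  proof -
    have "agree (max m 0) (level (Suc n) x) (level (Suc n) x')" "K n (level n x) = K n (level n x')"
      using m1[OF level_mem[OF x'(1)]] m2[OF x'] by auto
    then show ?thesis
      using m2[OF x'] by (auto simp: path_of_simps le_Suc_eq agree_def)
  qed
  then show ?case by blast
qed

section \<open>The coding is a conjugacy\<close>

lemma Xs_subset_topspace: "Xs 0 \<subseteq> topspace (full_shift A)"
  using closed by (rule closedin_subset)

abbreviation (input) "XT \<equiv> subtopology (full_shift A) (Xs 0)"

lemma topspace_XT: "topspace XT = Xs 0"
  using Xs_subset_topspace by auto

lemma continuous_path_of: "continuous_map XT (path_topology BD) path_of"
  unfolding continuous_map_def topspace_XT topspace_path_topology
proof (intro conjI allI impI)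
  fix U assume U: "openin (path_topology BD) U"
  show "openin XT {x \<in> Xs 0. path_of x \<in> U}"
    unfolding openin_subshift[OF Xs_subset_topspace]
  proof (intro conjI ballI)
    fix x assume "x \<in> {x \<in> Xs 0. path_of x \<in> U}"
    then have x: "x \<in> Xs 0" "path_of x \<in> U" by auto
    then obtain n where n: "cylinder BD (path_of x) n \<subseteq> U"
      using U unfolding openin_path_topology_iff by blast
    obtain m where m: "\<forall>x'\<in>Xs 0. agree m x x' \<longrightarrow> (\<forall>i\<le>n. path_of x i = path_of x' i)"
      using level_local[OF x(1), of 0 n] by blast
    have "path_of x' \<in> cylinder BD (path_of x) n" if "x' \<in> Xs 0" "agree m x x'" for x'
      using m that path_of_mem[of x'] by (auto simp: cylinder_def)
    then show "\<exists>m. \<forall>x'\<in>Xs 0. agree m x x' \<longrightarrow> x' \<in> {x \<in> Xs 0. path_of x \<in> U}"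
      using n by blast
  qed auto
qed (use path_of_mem in auto)

lemma compact_XT: "compact_space XT"
  using compact_full_shift[OF finite_A] closed
  by (simp add: closedin_compact_space compact_space_subtopology)

lemma path_of_surj: "path_of ` Xs 0 = inf_paths BD"
proof
  show "path_of ` Xs 0 \<subseteq> inf_paths BD" using path_of_mem by blast
  have "compactin (path_topology BD) (path_of ` Xs 0)"
    using image_compactin[OF _ continuous_path_of, of "Xs 0"] compact_XT topspace_XT
    by (simp add: compact_space_def)
  then have "closedin (path_topology BD) (path_of ` Xs 0)"
    using Hausdorff_path_topology compactin_imp_closedin by blast
  then have op: "openin (path_topology BD) (inf_paths BD - path_of ` Xs 0)"
    by (simp add: closedin_def)
  show "inf_paths BD \<subseteq> path_of ` Xs 0"
  proof (rule ccontr)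
    assume "\<not> inf_paths BD \<subseteq> path_of ` Xs 0"
    then obtain p where p: "p \<in> inf_paths BD" "p \<notin> path_of ` Xs 0" by blast
    then obtain n where n: "cylinder BD p n \<subseteq> inf_paths BD - path_of ` Xs 0"
      using op unfolding openin_path_topology_iff by blast
    obtain x where x: "x \<in> Xs 0" using nonempty by blast
    have "fst (p n) \<in> Al n" using p(1) unfolding mem_inf_paths_natural mem_dedges_natural by blast
    then obtain i where "level n x i = fst (p n)" using letter_occurs[OF _ level_mem[OF x]] by blast
    then obtain j where "\<forall>k\<le>n. path_of (shift_by j x) k = p k"
      using path_of_dense[OF x p(1)] by blast
    then have "path_of (shift_by j x) \<in> cylinder BD p n"
      using path_of_mem[OF shift_mem[OF x]] by (auto simp: cylinder_def)
    then show False using n shift_mem[OF x] by blast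
  qed
qed

lemma homeomorphic_path_of: "homeomorphic_map XT (path_topology BD) path_of"
proof (rule continuous_imp_homeomorphic_map[OF continuous_path_of compact_XT Hausdorff_path_topology])
  show "path_of ` topspace XT = topspace (path_topology BD)"
    unfolding topspace_XT by (simp add: path_of_surj)
  show "inj_on path_of (topspace XT)" unfolding topspace_XT by (auto simp: inj_on_def path_of_inj)
qed

lemma conjugate_shift: "top_conjugate XT shift_map (path_topology BD) (vershik BD)"
  unfolding top_conjugate_def
  using homeomorphic_path_of vershik_path_of
  by (intro exI[of _ path_of]) (simp add: topspace_XT shift_map_eq_shift_by)

text \<open>Every path is the code of a point, so its successor is the code of the shifted point; no
  minimal path to a given vertex has to be built.\<close>

lemma vershik_rel_vershik:
  assumes "p \<in> inf_paths BD"
  shows "vershik_rel Al \<sigma> p (vershik BD p)"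
proof -
  obtain x where "x \<in> Xs 0" "p = path_of x" using assms path_of_surj by blast
  then show ?thesis using vershik_rel_path_of vershik_path_of by simp
qed

text \<open>The Vershik map is the shift conjugated by the coding, which also covers continuity at
  the maximal path.\<close>

lemma homeomorphic_vershik: "homeomorphic_map (path_topology BD) (path_topology BD) (vershik BD)"
proof -
  obtain g where g: "homeomorphic_maps XT (path_topology BD) path_of g"
    using homeomorphic_path_of homeomorphic_map_maps by blast
  have shift: "homeomorphic_map XT XT (shift_by 1)"
    unfolding homeomorphic_map_maps homeomorphic_maps_def
    using shift_mem by (intro exI[of _ "shift_by (- 1)"] conjI continuous_shift_by Xs_subset_topspace) auto
  have "homeomorphic_map (path_topology BD) XT g"
    using g homeomorphic_maps_sym homeomorphic_map_maps by blast
  then have "homeomorphic_map (path_topology BD) (path_topology BD) (path_of \<circ> (shift_by 1 \<circ> g))"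
    by (rule homeomorphic_map_compose[OF homeomorphic_map_compose[OF _ shift] homeomorphic_path_of])
  moreover have "(path_of \<circ> (shift_by 1 \<circ> g)) p = vershik BD p" if "p \<in> inf_paths BD" for p
  proof -
    have "g p \<in> Xs 0" "path_of (g p) = p"
      using g that by (auto simp: homeomorphic_maps_def continuous_map_def topspace_XT Pi_iff)
    then show ?thesis using vershik_path_of[of "g p"] by simp
  qed
  ultimately show ?thesis by (auto intro: homeomorphic_map_eq)
qed

end

section \<open>Relabelling diagrams\<close>

text \<open>Each injection is defined on the union of all levels, so that \<open>unlabel\<close>
  does not depend on the level; a label may occur at several levels of \<open>D\<close>, as in the
  natural diagram.\<close>

locale diagram_relabelling =
  fixes D :: "('v, 'e) ordered_diagram" and fv :: "'v \<Rightarrow> 'w" and fe :: "'e \<Rightarrow> 'f"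
  assumes inj_fv: "inj_on fv (\<Union>n. dverts D n)" and inj_fe: "inj_on fe (\<Union>n. dedges D n)"
    and bratteli: "ordered_bratteli D"
begin

definition unlabel :: "'f \<Rightarrow> 'e" where
  "unlabel = inv_into (\<Union>n. dedges D n) fe"

definition relabelled :: "('w, 'f) ordered_diagram" where
  "relabelled = \<lparr> dverts = (\<lambda>n. fv ` dverts D n), dedges = (\<lambda>n. fe ` dedges D n),
     dsrc = (\<lambda>n e. fv (dsrc D n (unlabel e))), drng = (\<lambda>n e. fv (drng D n (unlabel e))),
     dord = (\<lambda>n. (\<lambda>(e, e'). (fe e, fe e')) ` dord D n) \<rparr>"

lemma unlabel: "e \<in> dedges D n \<Longrightarrow> unlabel (fe e) = e"
  unfolding unlabel_def using inj_fe by (intro inv_into_f_f) auto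

lemma fe_eq_iff: "e \<in> dedges D n \<Longrightarrow> e' \<in> dedges D n' \<Longrightarrow> fe e = fe e' \<longleftrightarrow> e = e'"
  using unlabel by metis

lemma fv_eq_iff: "v \<in> dverts D n \<Longrightarrow> v' \<in> dverts D n' \<Longrightarrow> fv v = fv v' \<longleftrightarrow> v = v'"
  using inj_fv unfolding inj_on_def by blast

lemma dsrc_mem: "e \<in> dedges D n \<Longrightarrow> dsrc D n e \<in> dverts D n"
  and drng_mem: "e \<in> dedges D n \<Longrightarrow> drng D n e \<in> dverts D (Suc n)"
  and dord_sub: "(e, e') \<in> dord D n \<Longrightarrow>
    e \<in> dedges D n \<and> e' \<in> dedges D n \<and> drng D n e = drng D n e'"
  and dord_linear: "v \<in> dverts D (Suc n) \<Longrightarrow> linear_order_on {e \<in> dedges D n. drng D n e = v}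
    (Restr (dord D n) {e \<in> dedges D n. drng D n e = v})"
  using bratteli unfolding ordered_bratteli_def by blast+

lemma dverts_relabelled: "dverts relabelled n = fv ` dverts D n"
  and dedges_relabelled: "dedges relabelled n = fe ` dedges D n"
  by (simp_all add: relabelled_def)

lemma dsrc_relabelled: "e \<in> dedges D n \<Longrightarrow> dsrc relabelled n (fe e) = fv (dsrc D n e)"
  and drng_relabelled: "e \<in> dedges D n \<Longrightarrow> drng relabelled n (fe e) = fv (drng D n e)"
  by (simp_all add: relabelled_def unlabel)

lemma drng_relabelled_eq_iff: "e \<in> dedges D n \<Longrightarrow> e' \<in> dedges D n \<Longrightarrow>
    drng relabelled n (fe e) = drng relabelled n (fe e') \<longleftrightarrow> drng D n e = drng D n e'"
  using fv_eq_iff[OF drng_mem drng_mem] by (simp add: drng_relabelled)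

lemma mem_dord_relabelled: "e \<in> dedges D n \<Longrightarrow> e' \<in> dedges D n \<Longrightarrow>
    (fe e, fe e') \<in> dord relabelled n \<longleftrightarrow> (e, e') \<in> dord D n"
proof
  assume e: "e \<in> dedges D n" "e' \<in> dedges D n" "(fe e, fe e') \<in> dord relabelled n"
  then obtain f f' where "(f, f') \<in> dord D n" "fe e = fe f" "fe e' = fe f'"
    by (auto simp: relabelled_def)
  then show "(e, e') \<in> dord D n" using dord_sub fe_eq_iff e by metis
qed (auto simp: relabelled_def)

lemma dord_relabelledE:
  assumes "(f, f') \<in> dord relabelled n"
  obtains e e' where "f = fe e" "f' = fe e'" "(e, e') \<in> dord D n"
  using assms by (auto simp: relabelled_def)

lemma max_edge_relabelled: "e \<in> dedges D n \<Longrightarrow> max_edge relabelled n (fe e) \<longleftrightarrow> max_edge D n e"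
  by (auto simp: max_edge_def dedges_relabelled drng_relabelled_eq_iff mem_dord_relabelled)

lemma min_edge_relabelled: "e \<in> dedges D n \<Longrightarrow> min_edge relabelled n (fe e) \<longleftrightarrow> min_edge D n e"
  by (auto simp: min_edge_def dedges_relabelled drng_relabelled_eq_iff mem_dord_relabelled)

text \<open>Only images of edges are related, so the quantifier over arbitrary labels reduces to
  edges of \<open>D\<close>.\<close>

lemma edge_succ_relabelled:
  assumes e: "e \<in> dedges D n" "e' \<in> dedges D n"
  shows "edge_succ relabelled n (fe e) (fe e') \<longleftrightarrow> edge_succ D n e e'"
proof -
  have "(\<forall>f. f \<noteq> fe e \<and> (fe e, f) \<in> dord relabelled n \<longrightarrow> (fe e', f) \<in> dord relabelled n) \<longleftrightarrow>
      (\<forall>f. f \<noteq> e \<and> (e, f) \<in> dord D n \<longrightarrow> (e', f) \<in> dord D n)" (is "?L \<longleftrightarrow> ?R")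
  proof
    assume L: ?L
    show ?R
    proof (intro allI impI)
      fix f assume f: "f \<noteq> e \<and> (e, f) \<in> dord D n"
      then have "f \<in> dedges D n" using dord_sub by blast
      then show "(e', f) \<in> dord D n"
        using L[rule_format, of "fe f"] f e fe_eq_iff[of f n e n] mem_dord_relabelled by auto
    qed
  next
    assume R: ?R
    show ?L
    proof (intro allI impI)
      fix f assume f: "f \<noteq> fe e \<and> (fe e, f) \<in> dord relabelled n"
      then obtain g g' where g: "fe e = fe g" "f = fe g'" "(g, g') \<in> dord D n"
        using dord_relabelledE by metis
      have ge: "g = e" and g': "g' \<in> dedges D n" using dord_sub[OF g(3)] fe_eq_iff e g(1) by blast+
      have "g' \<noteq> e" using f g(2) by blast
      then have "(e', g') \<in> dord D n" using R g(3) ge by blast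
      then show "(fe e', f) \<in> dord relabelled n" using mem_dord_relabelled[OF e(2) g'] g(2) by blast
    qed
  qed
  then show ?thesis
    unfolding edge_succ_def using fe_eq_iff[OF e] mem_dord_relabelled[OF e] by simp
qed

lemma ordered_bratteli_relabelled: "ordered_bratteli relabelled"
  unfolding ordered_bratteli_def
proof (intro conjI allI ballI)
  obtain v0 where "dverts D 0 = {v0}" using bratteli unfolding ordered_bratteli_def by blast
  then show "\<exists>v0. dverts relabelled 0 = {v0}" by (simp add: dverts_relabelled)
  fix n
  have D: "finite (dverts D n)" "dverts D n \<noteq> {}" "finite (dedges D n)"
    using bratteli unfolding ordered_bratteli_def by blast+
  then show "finite (dverts relabelled n)" "dverts relabelled n \<noteq> {}" "finite (dedges relabelled n)"
    by (auto simp: dverts_relabelled dedges_relabelled)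
  show "dsrc relabelled n e \<in> dverts relabelled n" "drng relabelled n e \<in> dverts relabelled (Suc n)"
    if "e \<in> dedges relabelled n" for e
    using that dsrc_mem drng_mem
    by (auto simp: dverts_relabelled dedges_relabelled dsrc_relabelled drng_relabelled)
  show "\<exists>e\<in>dedges relabelled n. dsrc relabelled n e = v" if v: "v \<in> dverts relabelled n" for v
  proof -
    obtain v' where v': "v' \<in> dverts D n" "v = fv v'" using v by (auto simp: dverts_relabelled)
    then obtain e where "e \<in> dedges D n" "dsrc D n e = v'"
      using bratteli unfolding ordered_bratteli_def by blast
    then show ?thesis using v' by (intro bexI[of _ "fe e"]) (auto simp: dedges_relabelled dsrc_relabelled)
  qed
  show "dord relabelled n \<subseteq> {(e, e'). e \<in> dedges relabelled n \<and> e' \<in> dedges relabelled n \<and>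
      drng relabelled n e = drng relabelled n e'}"
    using dord_sub by (auto elim!: dord_relabelledE simp: dedges_relabelled drng_relabelled)
  fix v assume "v \<in> dverts relabelled (Suc n)"
  then obtain v' where v': "v' \<in> dverts D (Suc n)" "v = fv v'" by (auto simp: dverts_relabelled)
  then obtain e where "e \<in> dedges D n" "drng D n e = v'"
    using bratteli unfolding ordered_bratteli_def by blast
  then show "\<exists>e\<in>dedges relabelled n. drng relabelled n e = v"
    using v' by (intro bexI[of _ "fe e"]) (auto simp: dedges_relabelled drng_relabelled)
  let ?S = "{e \<in> dedges D n. drng D n e = v'}"
  have S: "{e \<in> dedges relabelled n. drng relabelled n e = v} = fe ` ?S"
  proof -
    have "drng relabelled n (fe e) = v \<longleftrightarrow> drng D n e = v'" if "e \<in> dedges D n" for e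
      using fv_eq_iff[OF drng_mem[OF that] v'(1)] drng_relabelled[OF that] v'(2) by simp
    then show ?thesis unfolding dedges_relabelled by blast
  qed
  have lin: "linear_order_on ?S (Restr (dord D n) ?S)" using dord_linear v'(1) by blast
  show "linear_order_on {e \<in> dedges relabelled n. drng relabelled n e = v}
      (Restr (dord relabelled n) {e \<in> dedges relabelled n. drng relabelled n e = v})"
    unfolding S linear_order_on_def partial_order_on_def preorder_on_def
  proof (intro conjI)
    have ord: "(fe e, fe e') \<in> Restr (dord relabelled n) (fe ` ?S) \<longleftrightarrow> (e, e') \<in> Restr (dord D n) ?S"
      if "e \<in> ?S" "e' \<in> ?S" for e e' using that mem_dord_relabelled by auto
    show "Restr (dord relabelled n) (fe ` ?S) \<subseteq> fe ` ?S \<times> fe ` ?S" by blast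
    show "refl_on (fe ` ?S) (Restr (dord relabelled n) (fe ` ?S))"
    proof -
      have "refl_on ?S (Restr (dord D n) ?S)"
        using lin by (auto simp: linear_order_on_def partial_order_on_def preorder_on_def)
      then have "(e, e) \<in> Restr (dord D n) ?S" if "e \<in> ?S" for e using that by (auto simp: refl_on_def)
      then show ?thesis using ord unfolding refl_on_def by blast
    qed
    show "trans (Restr (dord relabelled n) (fe ` ?S))"
    proof (rule transI)
      fix a b c
      assume abc: "(a, b) \<in> Restr (dord relabelled n) (fe ` ?S)" "(b, c) \<in> Restr (dord relabelled n) (fe ` ?S)"
      then obtain a' b' c' where *: "a = fe a'" "b = fe b'" "c = fe c'" "a' \<in> ?S" "b' \<in> ?S" "c' \<in> ?S" by blast
      have "trans (Restr (dord D n) ?S)"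
        using lin by (auto simp: linear_order_on_def partial_order_on_def preorder_on_def)
      moreover have "(a', b') \<in> Restr (dord D n) ?S" "(b', c') \<in> Restr (dord D n) ?S"
        using abc ord[OF *(4,5)] ord[OF *(5,6)] unfolding *(1,2,3) by (simp_all only:)
      ultimately have "(a', c') \<in> Restr (dord D n) ?S" by (rule transD)
      then show "(a, c) \<in> Restr (dord relabelled n) (fe ` ?S)"
        using ord[OF *(4,6)] unfolding *(1,3) by (simp only:)
    qed
    show "antisym (Restr (dord relabelled n) (fe ` ?S))"
    proof (rule antisymI)
      fix a b
      assume ab: "(a, b) \<in> Restr (dord relabelled n) (fe ` ?S)" "(b, a) \<in> Restr (dord relabelled n) (fe ` ?S)"
      then obtain a' b' where *: "a = fe a'" "b = fe b'" "a' \<in> ?S" "b' \<in> ?S" by blast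
      have "antisym (Restr (dord D n) ?S)"
        using lin by (auto simp: linear_order_on_def partial_order_on_def)
      moreover have "(a', b') \<in> Restr (dord D n) ?S" "(b', a') \<in> Restr (dord D n) ?S"
        using ab ord[OF *(3,4)] ord[OF *(4,3)] unfolding *(1,2) by (simp_all only:)
      ultimately have "a' = b'" by (rule antisymD)
      then show "a = b" using * by simp
    qed
    show "total_on (fe ` ?S) (Restr (dord relabelled n) (fe ` ?S))"
    proof (rule total_onI)
      fix a b assume "a \<in> fe ` ?S" "b \<in> fe ` ?S" "a \<noteq> b"
      then obtain a' b' where *: "a = fe a'" "b = fe b'" "a' \<in> ?S" "b' \<in> ?S" "a' \<noteq> b'" by blast
      have "total_on ?S (Restr (dord D n) ?S)" using lin by (auto simp: linear_order_on_def)
      from this[unfolded total_on_def, rule_format, OF *(3,4,5)]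
      show "(a, b) \<in> Restr (dord relabelled n) (fe ` ?S) \<or> (b, a) \<in> Restr (dord relabelled n) (fe ` ?S)"
        using ord[OF *(3,4)] ord[OF *(4,3)] unfolding *(1,2) by (simp only:)
    qed
  qed
qed

section \<open>Paths and the Vershik rule after relabelling\<close>

lemma inf_pathsD: "x \<in> inf_paths D \<Longrightarrow> x n \<in> dedges D n"
  by (simp add: inf_paths_def)

lemma inf_paths_relabelled_iff:
  assumes "\<And>n. x n \<in> dedges D n"
  shows "fe \<circ> x \<in> inf_paths relabelled \<longleftrightarrow> x \<in> inf_paths D"
  using assms fv_eq_iff[OF drng_mem dsrc_mem]
  by (simp add: inf_paths_def dedges_relabelled dsrc_relabelled drng_relabelled)

lemma inf_paths_relabelled: "inf_paths relabelled = (\<lambda>x. fe \<circ> x) ` inf_paths D"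
proof
  show "inf_paths relabelled \<subseteq> (\<lambda>x. fe \<circ> x) ` inf_paths D"
  proof
    fix y assume y: "y \<in> inf_paths relabelled"
    then have "y n \<in> fe ` dedges D n" for n by (simp add: inf_paths_def dedges_relabelled)
    then have "\<exists>e. e \<in> dedges D n \<and> y n = fe e" for n by blast
    then obtain x where x: "\<And>n. x n \<in> dedges D n" "\<And>n. y n = fe (x n)" by metis
    then have "y = fe \<circ> x" by auto
    then show "y \<in> (\<lambda>x. fe \<circ> x) ` inf_paths D"
      using y x(1) inf_paths_relabelled_iff by blast
  qed
  show "(\<lambda>x. fe \<circ> x) ` inf_paths D \<subseteq> inf_paths relabelled"
    using inf_paths_relabelled_iff inf_pathsD by blast
qed

lemma relabel_inj: "x \<in> inf_paths D \<Longrightarrow> y \<in> inf_paths D \<Longrightarrow> fe \<circ> x = fe \<circ> y \<Longrightarrow> x = y"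
  by (metis comp_apply ext fe_eq_iff inf_pathsD)

lemma relabel_cylinder:
  assumes "x \<in> inf_paths D" "y \<in> inf_paths D"
  shows "fe \<circ> y \<in> cylinder relabelled (fe \<circ> x) n \<longleftrightarrow> y \<in> cylinder D x n"
proof -
  have "fe (y i) = fe (x i) \<longleftrightarrow> y i = x i" for i
    using fe_eq_iff[OF inf_pathsD inf_pathsD] assms by blast
  then show ?thesis using assms inf_paths_relabelled by (auto simp: cylinder_def)
qed

lemma homeomorphic_relabel:
  "homeomorphic_map (path_topology D) (path_topology relabelled) (\<lambda>x. fe \<circ> x)"
proof (rule bijective_open_imp_homeomorphic_map)
  show "continuous_map (path_topology D) (path_topology relabelled) (\<lambda>x. fe \<circ> x)"
    unfolding continuous_map_def topspace_path_topology
  proof (intro conjI allI impI)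
    fix U assume U: "openin (path_topology relabelled) U"
    show "openin (path_topology D) {x \<in> inf_paths D. fe \<circ> x \<in> U}"
      unfolding openin_path_topology_iff
    proof (intro conjI ballI)
      fix x assume x: "x \<in> {x \<in> inf_paths D. fe \<circ> x \<in> U}"
      then obtain n where "cylinder relabelled (fe \<circ> x) n \<subseteq> U"
        using U unfolding openin_path_topology_iff by blast
      then have "cylinder D x n \<subseteq> {x \<in> inf_paths D. fe \<circ> x \<in> U}"
        using relabel_cylinder x cylinder_subset_inf_paths by blast
      then show "\<exists>n. cylinder D x n \<subseteq> {x \<in> inf_paths D. fe \<circ> x \<in> U}" by blast
    qed auto
  qed (use inf_paths_relabelled in auto)
  show "open_map (path_topology D) (path_topology relabelled) (\<lambda>x. fe \<circ> x)"
    unfolding open_map_def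
  proof (intro allI impI)
    fix U assume U: "openin (path_topology D) U"
    then have sub: "U \<subseteq> inf_paths D" unfolding openin_path_topology_iff by blast
    show "openin (path_topology relabelled) ((\<lambda>x. fe \<circ> x) ` U)"
      unfolding openin_path_topology_iff
    proof (intro conjI ballI)
      show "(\<lambda>x. fe \<circ> x) ` U \<subseteq> inf_paths relabelled" using sub inf_paths_relabelled by blast
      fix y assume "y \<in> (\<lambda>x. fe \<circ> x) ` U"
      then obtain x where x: "x \<in> U" "y = fe \<circ> x" by blast
      then obtain n where "cylinder D x n \<subseteq> U" using U unfolding openin_path_topology_iff by blast
      moreover have "cylinder relabelled (fe \<circ> x) n \<subseteq> (\<lambda>x. fe \<circ> x) ` cylinder D x n"
      proof
        fix z assume z: "z \<in> cylinder relabelled (fe \<circ> x) n"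
        then obtain z' where "z' \<in> inf_paths D" "z = fe \<circ> z'"
          using cylinder_subset_inf_paths inf_paths_relabelled by blast
        then show "z \<in> (\<lambda>x. fe \<circ> x) ` cylinder D x n" using z relabel_cylinder x sub by blast
      qed
      ultimately show "\<exists>n. cylinder relabelled y n \<subseteq> (\<lambda>x. fe \<circ> x) ` U" using x by blast
    qed
  qed
qed (use inf_paths_relabelled relabel_inj in \<open>auto simp: inj_on_def\<close>)

lemma max_path_relabelled: "x \<in> inf_paths D \<Longrightarrow> max_path relabelled (fe \<circ> x) \<longleftrightarrow> max_path D x"
  and min_path_relabelled: "x \<in> inf_paths D \<Longrightarrow> min_path relabelled (fe \<circ> x) \<longleftrightarrow> min_path D x"
  using inf_paths_relabelled
  by (auto simp: max_path_def min_path_def max_edge_relabelled min_edge_relabelled inf_pathsD)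

lemma path_succ_pred_relabelled:
  assumes "x \<in> inf_paths D" "y \<in> inf_paths D"
  shows "path_succ_pred relabelled n (fe \<circ> x) (fe \<circ> y) \<longleftrightarrow> path_succ_pred D n x y"
proof -
  have "fe (y i) = fe (x i) \<longleftrightarrow> y i = x i" for i
    using fe_eq_iff[OF inf_pathsD inf_pathsD] assms by blast
  then show ?thesis
    using assms inf_paths_relabelled
    by (auto simp: path_succ_pred_def edge_succ_relabelled min_edge_relabelled inf_pathsD)
qed

text \<open>A definite description carries over where it denotes, hence the premise that a unique
  successor exists in \<open>D\<close>.\<close>

lemma path_succ_relabelled:
  assumes x: "x \<in> inf_paths D"
    and ex1: "\<exists>!y. path_succ_pred D (LEAST n. \<not> max_edge D n (x n)) x y"
  shows "path_succ relabelled (fe \<circ> x) = fe \<circ> path_succ D x"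
proof -
  let ?n = "LEAST n. \<not> max_edge D n (x n)"
  have n: "(LEAST n. \<not> max_edge relabelled n ((fe \<circ> x) n)) = ?n"
    using max_edge_relabelled inf_pathsD[OF x] by simp
  have succ: "path_succ_pred D ?n x (path_succ D x)"
    unfolding path_succ_eq_The using ex1 by (rule theI')
  then have mem: "path_succ D x \<in> inf_paths D" by (simp add: path_succ_pred_def)
  show ?thesis
    unfolding path_succ_eq_The[of relabelled] n
  proof (rule the_equality)
    show "path_succ_pred relabelled ?n (fe \<circ> x) (fe \<circ> path_succ D x)"
      using succ path_succ_pred_relabelled[OF x mem] by simp
    fix z assume z: "path_succ_pred relabelled ?n (fe \<circ> x) z"
    then obtain z' where z': "z' \<in> inf_paths D" "z = fe \<circ> z'"
      using inf_paths_relabelled by (auto simp: path_succ_pred_def)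
    then have "path_succ_pred D ?n x z'" using z path_succ_pred_relabelled[OF x] by simp
    then show "z = fe \<circ> path_succ D x" using ex1 succ z' by blast
  qed
qed

lemma relabelled_topological_BV:
  assumes BV: "topological_BV D \<phi>"
    and ex1: "\<And>x. x \<in> inf_paths D \<Longrightarrow> \<not> max_path D x \<Longrightarrow>
      \<exists>!y. path_succ_pred D (LEAST n. \<not> max_edge D n (x n)) x y"
  shows "\<exists>\<psi>. topological_BV relabelled \<psi> \<and>
    top_conjugate (path_topology D) \<phi> (path_topology relabelled) \<psi>"
proof -
  let ?G = "\<lambda>x. fe \<circ> x"
  have hom: "homeomorphic_map (path_topology D) (path_topology D) \<phi>"
    using BV by (simp add: topological_BV_def)
  have \<phi>: "\<phi> x \<in> inf_paths D" if "x \<in> inf_paths D" for x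
    using homeomorphic_imp_surjective_map[OF hom] that by auto
  obtain g where g: "homeomorphic_maps (path_topology D) (path_topology relabelled) ?G g"
    using homeomorphic_relabel homeomorphic_map_maps by blast
  define \<psi> where "\<psi> = ?G \<circ> (\<phi> \<circ> g)"
  have conj: "\<psi> (?G x) = ?G (\<phi> x)" if "x \<in> inf_paths D" for x
    using g that by (simp add: \<psi>_def homeomorphic_maps_def)
  have "homeomorphic_map (path_topology relabelled) (path_topology D) g"
    using g homeomorphic_maps_sym homeomorphic_map_maps by blast
  then have "homeomorphic_map (path_topology relabelled) (path_topology relabelled) \<psi>"
    unfolding \<psi>_def
    by (rule homeomorphic_map_compose[OF homeomorphic_map_compose[OF _ hom] homeomorphic_relabel])
  moreover have "if max_path relabelled y then min_path relabelled (\<psi> y) else \<psi> y = path_succ relabelled y"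
    if y: "y \<in> inf_paths relabelled" for y
  proof -
    obtain x where x: "x \<in> inf_paths D" "y = ?G x" using y inf_paths_relabelled by blast
    have "if max_path D x then min_path D (\<phi> x) else \<phi> x = path_succ D x"
      using BV[unfolded topological_BV_def, THEN conjunct2, THEN conjunct1] x(1) by (rule bspec)
    then show ?thesis
      using conj[OF x(1)] max_path_relabelled[OF x(1)] min_path_relabelled[OF \<phi>[OF x(1)]]
        path_succ_relabelled[OF x(1) ex1[OF x(1)]] unfolding x(2)
      by (cases "max_path D x") simp_all
  qed
  ultimately have "topological_BV relabelled \<psi>"
    unfolding topological_BV_def using ordered_bratteli_relabelled by (intro conjI ballI)
  moreover have "top_conjugate (path_topology D) \<phi> (path_topology relabelled) \<psi>"
    unfolding top_conjugate_def using homeomorphic_relabel conj by auto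
  ultimately show ?thesis by blast
qed

end

text \<open>By the pigeonhole principle bounded sizes take one value infinitely often, so the
  infimum runs over a non-empty set and is attained at a finite value.\<close>

lemma bratteli_rank_le:
  assumes "\<And>n. card (dverts D n) \<le> k"
  shows "\<exists>j\<le>k. bratteli_rank D = enat j"
proof -
  let ?S = "{enat k | k. \<exists>\<^sub>\<infinity>n. card (dverts D n) = k}"
  have "(\<lambda>n. card (dverts D n)) ` UNIV \<subseteq> {..k}" using assms by auto
  then have "finite ((\<lambda>n. card (dverts D n)) ` UNIV)" by (rule finite_subset) simp
  then obtain m where "infinite {n. card (dverts D n) = card (dverts D m)}"
    using pigeonhole_infinite[of UNIV "\<lambda>n. card (dverts D n)"] by auto
  then have mem: "enat (card (dverts D m)) \<in> ?S" by (auto simp: INFM_iff_infinite)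
  then have "bratteli_rank D \<in> ?S"
    unfolding bratteli_rank_def Inf_enat_def by (auto intro: LeastI)
  moreover have "bratteli_rank D \<le> enat (card (dverts D m))"
    unfolding bratteli_rank_def using mem by (rule Inf_lower)
  ultimately show ?thesis using assms[of m] by (auto simp: le_trans)
qed

text \<open>Finite levels give countably many vertices and edges altogether, which can be numbered
  by \<open>nat\<close>; the numbered copy is conjugate and obeys the same bound on level
  sizes.\<close>

lemma topological_rank_le:
  fixes D :: "('v, 'e) ordered_diagram"
  assumes BV: "topological_BV D \<phi>"
    and ex1: "\<And>x. x \<in> inf_paths D \<Longrightarrow> \<not> max_path D x \<Longrightarrow>
      \<exists>!y. path_succ_pred D (LEAST n. \<not> max_edge D n (x n)) x y"
    and card: "\<And>n. card (dverts D n) \<le> k"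
  shows "topological_rank (path_topology D) \<phi> \<le> enat k"
proof -
  have brat: "ordered_bratteli D" using BV by (simp add: topological_BV_def)
  then have "finite (dverts D n)" "finite (dedges D n)" for n
    unfolding ordered_bratteli_def by blast+
  then have "countable (\<Union>n. dverts D n)" "countable (\<Union>n. dedges D n)"
    by (auto intro: countable_finite)
  then interpret diagram_relabelling D "to_nat_on (\<Union>n. dverts D n)" "to_nat_on (\<Union>n. dedges D n)"
    using brat by unfold_locales (auto intro: inj_on_to_nat_on)
  obtain \<psi> where \<psi>: "topological_BV relabelled \<psi>"
      "top_conjugate (path_topology D) \<phi> (path_topology relabelled) \<psi>"
    using relabelled_topological_BV[OF BV ex1] by blast
  have "card (dverts relabelled n) \<le> k" for n
  proof -
    have "finite (dverts D n)" using brat by (simp add: ordered_bratteli_def)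
    then show ?thesis using card[of n] card_image_le[of "dverts D n"]
      unfolding dverts_relabelled by (meson le_trans)
  qed
  then obtain j where j: "j \<le> k" "bratteli_rank relabelled = enat j" using bratteli_rank_le by blast
  have "topological_rank (path_topology D) \<phi> \<le> enat j"
    unfolding topological_rank_def by (rule Inf_lower) (use j \<psi> in blast)
  then show ?thesis using j(1) by (meson enat_ord_simps(1) order_trans)
qed

section \<open>The conjugacy theorem\<close>

lemma (in desubst_tower) topological_rank_BD:
  assumes "\<And>n. card (Al n) \<le> k"
  shows "topological_rank (path_topology BD) (vershik BD) \<le> enat k"
proof (rule topological_rank_le)
  show "topological_BV BD (vershik BD)"
    unfolding topological_BV_def
  proof (intro conjI ballI)
    fix x
    have "min_path BD (THE y. min_path BD y)" using ex1_min_path by (rule theI')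
    then show "if max_path BD x then min_path BD (vershik BD x) else vershik BD x = path_succ BD x"
      by (simp add: vershik_def)
  qed (rule ordered_bratteli_BD homeomorphic_vershik)+
  show "\<exists>!y. path_succ_pred BD (LEAST n. \<not> max_edge BD n (x n)) x y"
    if "x \<in> inf_paths BD" "\<not> max_path BD x" for x
    using vershik_rel_path_succ[OF vershik_rel_vershik[OF that(1)] that(2)] path_succ_natural_unique
    by blast
  show "card (dverts BD n) \<le> k" for n
  proof (cases n)
    case 0
    \<comment> \<open>The top level has one vertex, and \<open>k\<close> is at least 1 because the
      alphabet at level 0 is non-empty.\<close>
    have "0 < card (Al 0)" using boundary_letters(1)[of 0] finite_letters by (auto simp: card_gt_0_iff)
    then show ?thesis using assms[of 0] 0 by (simp add: dverts_natural)
  next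
    case (Suc m)
    then show ?thesis using assms[of m] by (simp add: dverts_natural card_image)
  qed
qed

lemma letter_occurs_in_point:
  assumes "recurrent_language X" "a \<in> alphabet X" "x \<in> X"
  shows "\<exists>i. x i = a"
proof -
  have "[a] \<in> language X" using assms(2) by (simp add: singleton_in_language_iff)
  then obtain N where "\<And>v. v \<in> language X \<Longrightarrow> N \<le> length v \<Longrightarrow> sublist [a] v"
    using assms(1) unfolding recurrent_language_def by blast
  then have "sublist [a] (subword x 0 N)" using assms(3) by (simp add: subword_in_language)
  then have "a \<in> set (subword x 0 N)" by (auto simp: sublist_def)
  then show ?thesis by (auto simp: subword_def)
qed

theorem theorem6p10:
  fixes A :: "'a set" and X :: "(int \<Rightarrow> 'a) set"
    and Al :: "nat \<Rightarrow> 'a set" and \<sigma> :: "nat \<Rightarrow> 'a \<Rightarrow> 'a list"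
  assumes "minimal_tree_shift A X"
    and "return_word_rep X Al \<sigma>"
  shows "properly_ordered (natural_diagram Al \<sigma>) \<and>
    top_conjugate (subtopology (full_shift A) X) shift_map
      (path_topology (natural_diagram Al \<sigma>)) (vershik (natural_diagram Al \<sigma>)) \<and>
    topological_rank (path_topology (natural_diagram Al \<sigma>)) (vershik (natural_diagram Al \<sigma>))
      \<le> enat (card (alphabet X))"
proof -
  obtain Xs xs \<tau> where X0: "Xs 0 = X" and Al0: "Al 0 = alphabet X"
    and rep: "\<And>n. xs n \<in> Xs n"
      "\<And>n. coding_morphism (Al (Suc n)) (\<tau> n) (return_words (Xs n) [xs n (- 1), xs n 0])"
      "\<And>n. is_derived_shift (Xs n) [xs n (- 1), xs n 0] (Al (Suc n)) (\<tau> n) (Xs (Suc n))"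
      "\<And>n b. b \<in> Al (Suc n) \<Longrightarrow> xs n (- 1) # \<sigma> n b = \<tau> n b @ [xs n (- 1)]"
    using assms(2) unfolding return_word_rep_def by metis
  have min: "minimal_shift A X" using assms(1) by (simp add: minimal_tree_shift_def)
  have ss: "shift_space A X" using min by (simp add: minimal_shift_def)
  have w: "[xs n (- 1), xs n 0] \<in> language (Xs n)" for n
    using subword_in_language[OF rep(1), of n "- 1" 2] by (simp add: numeral_2_eq_2 subword_Suc)
  have derived: "derived_shift (Xs n) [xs n (- 1), xs n 0] (Al (Suc n)) (\<tau> n) (Xs (Suc n))" for n
    using rep(2,3) w by unfold_locales auto
  have recurrent: "recurrent_language (Xs n)" for n
  proof (induction n)
    case 0
    then show ?case using minimal_shift_recurrent[OF min] X0 by simp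
  next
    case (Suc n)
    then show ?case by (rule derived_shift.derived_recurrent[OF derived])
  qed
  \<comment> \<open>The induction must treat all words at once: \<open>u\<close> at level
    \<open>n + 1\<close> becomes \<open>\<tau>(u)\<close> followed by the base word at level
    \<open>n\<close>, and the tree property is available only at level 0.\<close>
  have bound: "finite (return_words (Xs n) u) \<and> card (return_words (Xs n) u) \<le> card (alphabet X)"
    if "u \<in> language (Xs n)" "u \<noteq> []" for n u
    using that
  proof (induction n arbitrary: u)
    case 0
    then show ?case using card_return_words_tree[OF assms(1)] X0 by simp
  next
    case (Suc n)
    interpret derived_shift "Xs n" "[xs n (- 1), xs n 0]" "Al (Suc n)" "\<tau> n" "Xs (Suc n)"
      by (rule derived)
    have "morph_word (\<tau> n) u @ [xs n (- 1), xs n 0] \<in> language (Xs n)"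
      using Suc.prems(1) in_language_derived_iff by blast
    then have IH: "finite (return_words (Xs n) (morph_word (\<tau> n) u @ [xs n (- 1), xs n 0]))"
      "card (return_words (Xs n) (morph_word (\<tau> n) u @ [xs n (- 1), xs n 0])) \<le> card (alphabet X)"
      using Suc.IH by simp_all
    show ?case using card_derived_return_words[OF IH(1)] IH(2) by simp
  qed
  have space: "shift_space (Al (Suc n)) (Xs (Suc n))" for n
    using rep(3) by (simp add: is_derived_shift_def)
  \<comment> \<open>A shift space over \<open>Al n\<close> might omit letters; each \<open>b\<close>
    really occurs, since its return word followed by the base word is a word of the previous
    shift.\<close>
  have alph: "Al n = alphabet (Xs n)" for n
  proof (cases n)
    case 0
    then show ?thesis using X0 Al0 by simp
  next
    case (Suc m)
    show ?thesis
    proof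
      show "Al n \<subseteq> alphabet (Xs n)"
        using derived_shift.letter_in_language_derived[OF derived] Suc
        by (auto simp: singleton_in_language_iff)
      show "alphabet (Xs n) \<subseteq> Al n" using alphabet_subset[OF space] Suc by simp
    qed
  qed
  have fin: "finite (Al n)" for n
  proof (cases n)
    case 0
    then show ?thesis
      using Al0 alphabet_subset[OF ss] ss finite_subset by (auto simp: shift_space_def)
  next
    case (Suc m)
    then show ?thesis using space[of m] by (simp add: shift_space_def)
  qed
  have shift: "shift_by j x \<in> Xs n" if "x \<in> Xs n" for x n j
    using that ss space shift_space_shift_by X0 by (cases n) blast+
  have desub: "return_desubstitution (Xs n) (xs n (- 1)) (xs n 0) (Al (Suc n)) (\<tau> n) (Xs (Suc n)) (\<sigma> n)" for n
    unfolding return_desubstitution_def return_desubstitution_axioms_def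
    using derived rep(4) recurrent shift by blast
  obtain D K where maps: "\<And>n. desubst_maps (Xs n) (Xs (Suc n)) (\<sigma> n) (D n) (K n)"
    using return_desubstitution.ex_desubst_maps[OF desub] by metis
  \<comment> \<open>The coding morphisms turn the bound on return words into a bound on letters,
    hence on vertices, at every level.\<close>
  have card: "card (Al n) \<le> card (alphabet X)" for n
  proof (cases n)
    case (Suc m)
    have "card (Al (Suc m)) = card (return_words (Xs m) [xs m (- 1), xs m 0])"
      using rep(2) by (auto simp: coding_morphism_def intro: bij_betw_same_card)
    then show ?thesis using bound[OF w] Suc by simp
  qed (simp add: Al0)
  interpret desubst_tower A Xs Al \<sigma> "\<lambda>n. xs n (- 1)" "\<lambda>n. xs n 0" D K
  proof
    show "x i \<in> Al n" if "x \<in> Xs n" for x n i using that by (auto simp: alph alphabet_def)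
    then show "xs n (- 1) \<in> Al n" "xs n 0 \<in> Al n" for n using rep(1) by auto
    show "\<exists>i. x i = a" if "a \<in> Al n" "x \<in> Xs n" for a n x
      using letter_occurs_in_point[OF recurrent] that by (simp add: alph)
    show "\<sigma> n b \<noteq> [] \<and> hd (\<sigma> n b) = xs n 0 \<and> last (\<sigma> n b) = xs n (- 1)" if "b \<in> Al (Suc n)" for b n
      using return_desubstitution.sigma_nonempty[OF desub that]
        return_desubstitution.hd_sigma[OF desub that] return_desubstitution.last_sigma[OF desub that]
      by blast
    show "finite A" "closedin (full_shift A) (Xs 0)" using ss X0 by (auto simp: shift_space_def)
    show "Xs 0 \<noteq> {}" using rep(1) by blast
  qed (use maps fin shift in auto)
  show ?thesis
    using properly_ordered_BD conjugate_shift topological_rank_BD[OF card] X0 by simp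
qed

end
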